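(* Let $S$ be a commutative ring with identity, $G$ a finite group, and $\alpha=(S_g,\alpha_g)_{g\in G}$ a unital partial action of $G$ on $S$ such that $S$ is an $\alpha$-partial Galois extension of $S^{\alpha}$. Then every normal subgroup $H$ of $G$ induces a partial action $\alpha_{G/H}$ of $G/H$ on $S^{\alpha_H}$ (the one constructed in the context), and $S^{\alpha_H}$ is an $\alpha_{G/H}$-partial Galois extension of $S^{\alpha}$.
   Context: All rings are commutative with identity. Partial actions. A partial action of a group $G$ on a ring $S$ is a family $\alpha=(S_g,\alpha_g)_{g\in G}$ such that: (P1) each $S_g$ is an ideal of $S$ and $\alpha_g:S_{g^{-1}}\to S_g$ is a ring isomorphism; (P2) $S_1=S$, $\alpha_1=\mathrm{id}_S$; (P3) $\alpha_g(S_{g^{-1}}\cap S_h)=S_g\cap S_{gh}$ for all $g,h\in G$; (P4) $\alpha_g(\alpha_h(x))=\alpha_{gh}(x)$ for all $x\in S_{h^{-1}}\cap S_{(gh)^{-1}}$. It is unital if for each $g$ there is $1_g\in S$ with $S_g=S1_g$ and $1_g$ the identity of $S_g$; it is global if $S_g=S$ for all $g$. Invariants: $S^{\alpha}=\{s\in S:\alpha_g(s1_{g^{-1}})=s1_g \text{ for all } g\in G\}$. For a subgroup $H\le G$, $\alpha_H=(S_h,\alpha_h)_{h\in H}$ is the restricted partial action. Partial Galois extension: $S$ is an $\alpha$-partial Galois extension of $S^\alpha$ (with group $G$) if there exist $m\in\mathbb N$ and $x_i,y_i\in S$ ($1\le i\le m$) with $\sum_{i=1}^m x_i\alpha_g(y_i1_{g^{-1}})=\delta_{1,g}1_S$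 for every $g\in G$. Globalization: a globalization of a unital partial action $\alpha$ is a global action $\beta$ of $G$ on a ring $T$ such that $S$ is (identified with) an ideal of $T$, $S_g=S\cap\beta_g(S)$, $\beta_g|_{S_{g^{-1}}}=\alpha_g$ for all $g$, and $T=\sum_{g\in G}\beta_g(S)$. It exists and is unique up to isomorphism; for $G$ finite, $T$ has an identity $1_T$, $1_S$ is an idempotent of $T$ and $S=T1_S$. The induced partial action $\alpha_{G/H}$. Let $(T,\beta)$ be the globalization of $\alpha$ and $H=\{h_1=1,h_2,\dots,h_m\}$ a normal subgroup of $G$. Put $e_1=1_S$ and $e_i=(1_T-1_S)(1_T-\beta_{h_2}(1_S))\cdots(1_T-\beta_{h_{i-1}}(1_S))\beta_{h_i}(1_S)$ for $2\le i\le m$, define $\psi_H:T\to T$ by $\psi_H(t)=\sum_{i=1}^m\beta_{h_i}(t)e_i$, and put $e_H=\psi_H(1_S)$. Then $\alpha_{G/H}=(\tilde D_{gH},\alpha_{gH})_{gH\in G/H}$, where $\tilde 1_{gH}=\beta_g(e_H)1_S$, $\tilde D_{gH}=S^{\alpha_H}\tilde 1_{gH}$, and $\alpha_{gH}:\tilde D_{g^{-1}H}\to\tilde D_{gH}$ is $\alpha_{gH}(x)=\beta_g(\psi_H(x))1_S$. *)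

theory Defs
  imports "HOL-Algebra.Coset" "HOL-Algebra.Ideal" "HOL-Algebra.Subrings"
begin

section \<open>Partial actions\<close>

text \<open>
  The ideals \<open>D g\<close> are rings whose identity (if any) is not that of the ambient ring, so the
  isomorphisms \<open>a g\<close> are additive and multiplicative bijections; \<^const>\<open>ring_iso\<close> would demand
  that the ambient identity be preserved.
\<close>

locale partial_action = G: group G + R: cring R
  for G :: "('g, 'c) monoid_scheme" and R :: "('r, 'd) ring_scheme" +
  fixes D :: "'g \<Rightarrow> 'r set" and a :: "'g \<Rightarrow> 'r \<Rightarrow> 'r"
  assumes P1_ideal: "g \<in> carrier G \<Longrightarrow> ideal (D g) R"
    and P1_bij: "g \<in> carrier G \<Longrightarrow> bij_betw (a g) (D (inv\<^bsub>G\<^esub> g)) (D g)"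
    and P1_add: "\<lbrakk>g \<in> carrier G; x \<in> D (inv\<^bsub>G\<^esub> g); y \<in> D (inv\<^bsub>G\<^esub> g)\<rbrakk>
                  \<Longrightarrow> a g (x \<oplus>\<^bsub>R\<^esub> y) = a g x \<oplus>\<^bsub>R\<^esub> a g y"
    and P1_mult: "\<lbrakk>g \<in> carrier G; x \<in> D (inv\<^bsub>G\<^esub> g); y \<in> D (inv\<^bsub>G\<^esub> g)\<rbrakk>
                  \<Longrightarrow> a g (x \<otimes>\<^bsub>R\<^esub> y) = a g x \<otimes>\<^bsub>R\<^esub> a g y"
    and P2_dom: "D \<one>\<^bsub>G\<^esub> = carrier R"
    and P2_id: "x \<in> carrier R \<Longrightarrow> a \<one>\<^bsub>G\<^esub> x = x"
    and P3: "\<lbrakk>g \<in> carrier G; h \<in> carrier G\<rbrakk>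
              \<Longrightarrow> a g ` (D (inv\<^bsub>G\<^esub> g) \<inter> D h) = D g \<inter> D (g \<otimes>\<^bsub>G\<^esub> h)"
    and P4: "\<lbrakk>g \<in> carrier G; h \<in> carrier G;
               x \<in> D (inv\<^bsub>G\<^esub> h) \<inter> D (inv\<^bsub>G\<^esub> (g \<otimes>\<^bsub>G\<^esub> h))\<rbrakk>
              \<Longrightarrow> a g (a h x) = a (g \<otimes>\<^bsub>G\<^esub> h) x"

locale unital_partial_action = partial_action +
  assumes unital: "g \<in> carrier G \<Longrightarrow>
    \<exists>e \<in> carrier R. D g = (\<lambda>s. s \<otimes>\<^bsub>R\<^esub> e) ` carrier R \<and> (\<forall>x \<in> D g. e \<otimes>\<^bsub>R\<^esub> x = x)"

text \<open>The identity \<open>1\<^sub>g\<close> of \<open>D g\<close>; it is unique, since a commutative ring has at most one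
  identity.\<close>

definition ideal_one :: "('r, 'd) ring_scheme \<Rightarrow> 'r set \<Rightarrow> 'r" where
  "ideal_one R I = (THE e. e \<in> I \<and> (\<forall>x \<in> I. e \<otimes>\<^bsub>R\<^esub> x = x))"

definition invariants ::
  "('g, 'c) monoid_scheme \<Rightarrow> ('r, 'd) ring_scheme \<Rightarrow> ('g \<Rightarrow> 'r set) \<Rightarrow> ('g \<Rightarrow> 'r \<Rightarrow> 'r) \<Rightarrow> 'r set" where
  "invariants G R D a =
    {s \<in> carrier R. \<forall>g \<in> carrier G.
       a g (s \<otimes>\<^bsub>R\<^esub> ideal_one R (D (inv\<^bsub>G\<^esub> g))) = s \<otimes>\<^bsub>R\<^esub> ideal_one R (D g)}"

text \<open>For a unital partial action \<open>(D, a)\<close>: the ring \<open>R\<close> is a partial Galois extension of \<open>B\<close>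
  with group \<open>G\<close>, where \<open>B\<close> has to be the subring of invariants.\<close>

definition partial_galois_extension ::
  "('g, 'c) monoid_scheme \<Rightarrow> ('r, 'd) ring_scheme \<Rightarrow> ('g \<Rightarrow> 'r set) \<Rightarrow> ('g \<Rightarrow> 'r \<Rightarrow> 'r)
     \<Rightarrow> 'r set \<Rightarrow> bool" where
  "partial_galois_extension G R D a B \<longleftrightarrow>
     B = invariants G R D a \<and>
     (\<exists>(m::nat) x y. x \<in> {1..m} \<rightarrow> carrier R \<and> y \<in> {1..m} \<rightarrow> carrier R \<and>
        (\<forall>g \<in> carrier G.
           (\<Oplus>\<^bsub>R\<^esub>i\<in>{1..m}. x i \<otimes>\<^bsub>R\<^esub> a g (y i \<otimes>\<^bsub>R\<^esub> ideal_one R (D (inv\<^bsub>G\<^esub> g))))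
             = (if g = \<one>\<^bsub>G\<^esub> then \<one>\<^bsub>R\<^esub> else \<zero>\<^bsub>R\<^esub>)))"

section \<open>Globalization\<close>

text \<open>The global action is a partial action whose domains are all of \<open>T\<close>.  The identification of
  \<open>S\<close> with an ideal of \<open>T\<close> is an injective additive and multiplicative map \<open>j\<close>, which need not
  send \<open>\<one>\<^bsub>S\<^esub>\<close> to \<open>\<one>\<^bsub>T\<^esub>\<close>.\<close>

locale globalization =
  unital_partial_action G S D a + T: partial_action G T "\<lambda>_. carrier T" b
  for G :: "('g, 'c) monoid_scheme" and S :: "('s, 'd) ring_scheme"
    and D :: "'g \<Rightarrow> 's set" and a :: "'g \<Rightarrow> 's \<Rightarrow> 's"
    and T :: "('t, 'e) ring_scheme" and b :: "'g \<Rightarrow> 't \<Rightarrow> 't" +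
  fixes j :: "'s \<Rightarrow> 't"
  assumes j_inj: "inj_on j (carrier S)"
    and j_add: "\<lbrakk>x \<in> carrier S; y \<in> carrier S\<rbrakk> \<Longrightarrow> j (x \<oplus>\<^bsub>S\<^esub> y) = j x \<oplus>\<^bsub>T\<^esub> j y"
    and j_mult: "\<lbrakk>x \<in> carrier S; y \<in> carrier S\<rbrakk> \<Longrightarrow> j (x \<otimes>\<^bsub>S\<^esub> y) = j x \<otimes>\<^bsub>T\<^esub> j y"
    and j_ideal: "ideal (j ` carrier S) T"
    and dom_eq: "g \<in> carrier G \<Longrightarrow> j ` D g = j ` carrier S \<inter> b g ` j ` carrier S"
    and restrict_eq: "\<lbrakk>g \<in> carrier G; x \<in> D (inv\<^bsub>G\<^esub> g)\<rbrakk> \<Longrightarrow> b g (j x) = j (a g x)"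
    and span: "t \<in> carrier T \<Longrightarrow>
      \<exists>A c. finite A \<and> A \<subseteq> carrier G \<and> c \<in> A \<rightarrow> carrier S \<and> t = (\<Oplus>\<^bsub>T\<^esub>g\<in>A. b g (j (c g)))"

section \<open>The induced partial action of a quotient group\<close>

text \<open>
  Here \<open>u\<close> is the image of \<open>\<one>\<^bsub>S\<^esub>\<close> in \<open>T\<close>, and \<open>h\<close> enumerates \<open>H\<close> as
  \<open>h 1 = \<one>\<^bsub>G\<^esub>, h 2, \<dots>, h m\<close>.  As \<open>b (h 1)\<close> is the identity, the uniform formula for
  \<open>orth_idem\<close> has first factor \<open>\<one>\<^bsub>T\<^esub> \<ominus>\<^bsub>T\<^esub> u\<close> when \<open>i \<ge> 2\<close>, and is \<open>u\<close> when \<open>i = 1\<close>.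
\<close>

definition orth_idem ::
  "('t, 'e) ring_scheme \<Rightarrow> ('g \<Rightarrow> 't \<Rightarrow> 't) \<Rightarrow> 't \<Rightarrow> (nat \<Rightarrow> 'g) \<Rightarrow> nat \<Rightarrow> 't" where
  "orth_idem T b u h i =
     (\<Otimes>\<^bsub>T\<^esub>k\<in>{1..<i}. \<one>\<^bsub>T\<^esub> \<ominus>\<^bsub>T\<^esub> b (h k) u) \<otimes>\<^bsub>T\<^esub> b (h i) u"

definition psi ::
  "('t, 'e) ring_scheme \<Rightarrow> ('g \<Rightarrow> 't \<Rightarrow> 't) \<Rightarrow> 't \<Rightarrow> (nat \<Rightarrow> 'g) \<Rightarrow> nat \<Rightarrow> 't \<Rightarrow> 't" where
  "psi T b u h m t = (\<Oplus>\<^bsub>T\<^esub>i\<in>{1..m}. b (h i) t \<otimes>\<^bsub>T\<^esub> orth_idem T b u h i)"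

text \<open>The formulas for the identity \<open>1\<^sub>g\<^sub>H\<close>, the domain and the map of the induced partial action,
  in terms of a representative \<open>g\<close>.  The values lie in the ideal \<open>j ` carrier S\<close> of \<open>T\<close> and are
  transported back to \<open>S\<close>.\<close>

definition induced_one ::
  "('s, 'd) ring_scheme \<Rightarrow> ('t, 'e) ring_scheme \<Rightarrow> ('g \<Rightarrow> 't \<Rightarrow> 't) \<Rightarrow> ('s \<Rightarrow> 't)
     \<Rightarrow> (nat \<Rightarrow> 'g) \<Rightarrow> nat \<Rightarrow> 'g \<Rightarrow> 's" where
  "induced_one S T b j h m g =
     inv_into (carrier S) j (b g (psi T b (j \<one>\<^bsub>S\<^esub>) h m (j \<one>\<^bsub>S\<^esub>)) \<otimes>\<^bsub>T\<^esub> j \<one>\<^bsub>S\<^esub>)"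

definition induced_dom ::
  "('g, 'c) monoid_scheme \<Rightarrow> ('s, 'd) ring_scheme \<Rightarrow> ('g \<Rightarrow> 's set) \<Rightarrow> ('g \<Rightarrow> 's \<Rightarrow> 's)
     \<Rightarrow> ('t, 'e) ring_scheme \<Rightarrow> ('g \<Rightarrow> 't \<Rightarrow> 't) \<Rightarrow> ('s \<Rightarrow> 't)
     \<Rightarrow> 'g set \<Rightarrow> (nat \<Rightarrow> 'g) \<Rightarrow> nat \<Rightarrow> 'g \<Rightarrow> 's set" where
  "induced_dom G S D a T b j H h m g =
     (\<lambda>s. s \<otimes>\<^bsub>S\<^esub> induced_one S T b j h m g) ` invariants (G\<lparr>carrier := H\<rparr>) S D a"

definition induced_map ::
  "('s, 'd) ring_scheme \<Rightarrow> ('t, 'e) ring_scheme \<Rightarrow> ('g \<Rightarrow> 't \<Rightarrow> 't) \<Rightarrow> ('s \<Rightarrow> 't)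
     \<Rightarrow> (nat \<Rightarrow> 'g) \<Rightarrow> nat \<Rightarrow> 'g \<Rightarrow> 's \<Rightarrow> 's" where
  "induced_map S T b j h m g x =
     inv_into (carrier S) j (b g (psi T b (j \<one>\<^bsub>S\<^esub>) h m (j x)) \<otimes>\<^bsub>T\<^esub> j \<one>\<^bsub>S\<^esub>)"

text \<open>The family indexed by the cosets \<open>C \<in> carrier (G Mod H)\<close>.  A representative is chosen here;
  that the choice does not matter is something to be proved.\<close>

definition coset_rep :: "'g set \<Rightarrow> 'g" where
  "coset_rep C = (SOME g. g \<in> C)"

definition quotient_dom ::
  "('g, 'c) monoid_scheme \<Rightarrow> ('s, 'd) ring_scheme \<Rightarrow> ('g \<Rightarrow> 's set) \<Rightarrow> ('g \<Rightarrow> 's \<Rightarrow> 's)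
     \<Rightarrow> ('t, 'e) ring_scheme \<Rightarrow> ('g \<Rightarrow> 't \<Rightarrow> 't) \<Rightarrow> ('s \<Rightarrow> 't)
     \<Rightarrow> 'g set \<Rightarrow> (nat \<Rightarrow> 'g) \<Rightarrow> nat \<Rightarrow> 'g set \<Rightarrow> 's set" where
  "quotient_dom G S D a T b j H h m C = induced_dom G S D a T b j H h m (coset_rep C)"

definition quotient_map ::
  "('s, 'd) ring_scheme \<Rightarrow> ('t, 'e) ring_scheme \<Rightarrow> ('g \<Rightarrow> 't \<Rightarrow> 't) \<Rightarrow> ('s \<Rightarrow> 't)
     \<Rightarrow> (nat \<Rightarrow> 'g) \<Rightarrow> nat \<Rightarrow> 'g set \<Rightarrow> 's \<Rightarrow> 's" where
  "quotient_map S T b j h m C = induced_map S T b j h m (coset_rep C)"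

section \<open>Existence of the globalization for finite groups\<close>

text \<open>Not needed to state anything: it shows that the locale \<open>globalization\<close> is inhabited for every unital
  partial action of a finite group, including the requirement that \<open>T\<close> has an identity.\<close>

context unital_partial_action
begin

definition unit_of :: "'a \<Rightarrow> 'c" where "unit_of g = ideal_one R (D g)"

text \<open>The total map \<open>x \<mapsto> a g (x 1\<^bsub>g\<^sup>-\<^sup>1\<^esub>)\<close>.\<close>

definition ext_map :: "'a \<Rightarrow> 'c \<Rightarrow> 'c" where
  "ext_map g x = a g (x \<otimes>\<^bsub>R\<^esub> unit_of (inv\<^bsub>G\<^esub> g))"

lemma D_carr: "g \<in> carrier G \<Longrightarrow> x \<in> D g \<Longrightarrow> x \<in> carrier R"
  using P1_ideal ideal.Icarr by fast

lemma D_r: "g \<in> carrier G \<Longrightarrow> x \<in> D g \<Longrightarrow> y \<in> carrier R \<Longrightarrow> x \<otimes>\<^bsub>R\<^esub> y \<in> D g"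
  using P1_ideal ideal.I_r_closed by fast

lemma D_l: "g \<in> carrier G \<Longrightarrow> x \<in> D g \<Longrightarrow> y \<in> carrier R \<Longrightarrow> y \<otimes>\<^bsub>R\<^esub> x \<in> D g"
  using P1_ideal ideal.I_l_closed by fast

lemma unit_of:
  assumes g: "g \<in> carrier G"
  shows "unit_of g \<in> D g" and "\<And>x. x \<in> D g \<Longrightarrow> unit_of g \<otimes>\<^bsub>R\<^esub> x = x"
proof -
  obtain e where e: "e \<in> carrier R" "D g = (\<lambda>s. s \<otimes>\<^bsub>R\<^esub> e) ` carrier R"
    "\<forall>x \<in> D g. e \<otimes>\<^bsub>R\<^esub> x = x"
    using unital[OF g] by blast
  have "e = \<one>\<^bsub>R\<^esub> \<otimes>\<^bsub>R\<^esub> e" using e by simp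
  hence eD: "e \<in> D g" using e(2) by blast
  have "\<exists>!e. e \<in> D g \<and> (\<forall>x \<in> D g. e \<otimes>\<^bsub>R\<^esub> x = x)"
  proof (rule ex1I[of _ e])
    fix e' assume "e' \<in> D g \<and> (\<forall>x \<in> D g. e' \<otimes>\<^bsub>R\<^esub> x = x)"
    thus "e' = e" using eD e(3) D_carr[OF g] R.m_comm by metis
  qed (use eD e(3) in blast)
  from theI'[OF this]
  show "unit_of g \<in> D g" "\<And>x. x \<in> D g \<Longrightarrow> unit_of g \<otimes>\<^bsub>R\<^esub> x = x"
    unfolding unit_of_def ideal_one_def by auto
qed

lemma unit_carr [simp]: "g \<in> carrier G \<Longrightarrow> unit_of g \<in> carrier R"
  using unit_of(1) D_carr by blast

lemma unit_of_r: "g \<in> carrier G \<Longrightarrow> x \<in> D g \<Longrightarrow> x \<otimes>\<^bsub>R\<^esub> unit_of g = x"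
  using unit_of(2) D_carr R.m_comm unit_carr by metis

lemma a_in: "g \<in> carrier G \<Longrightarrow> x \<in> D (inv\<^bsub>G\<^esub> g) \<Longrightarrow> a g x \<in> D g"
  using P1_bij bij_betwE by fast

lemma D_iff: "g \<in> carrier G \<Longrightarrow> x \<in> D g \<longleftrightarrow> x \<in> carrier R \<and> x \<otimes>\<^bsub>R\<^esub> unit_of g = x"
  using unit_of_r D_l unit_of(1) D_carr by metis

lemma a_unit:
  assumes g: "g \<in> carrier G" and h: "h \<in> carrier G"
  shows "a g (unit_of (inv\<^bsub>G\<^esub> g) \<otimes>\<^bsub>R\<^esub> unit_of h) = unit_of g \<otimes>\<^bsub>R\<^esub> unit_of (g \<otimes>\<^bsub>G\<^esub> h)"
proof -
  let ?p = "unit_of (inv\<^bsub>G\<^esub> g) \<otimes>\<^bsub>R\<^esub> unit_of h"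
  let ?q = "unit_of g \<otimes>\<^bsub>R\<^esub> unit_of (g \<otimes>\<^bsub>G\<^esub> h)"
  have gi: "inv\<^bsub>G\<^esub> g \<in> carrier G" and gh: "g \<otimes>\<^bsub>G\<^esub> h \<in> carrier G" using g h by auto
  have pD: "?p \<in> D (inv\<^bsub>G\<^esub> g) \<inter> D h"
    using D_r[OF gi unit_of(1)[OF gi]] D_l[OF h unit_of(1)[OF h]] gi h by simp
  have qD: "?q \<in> D g \<inter> D (g \<otimes>\<^bsub>G\<^esub> h)"
    using D_r[OF g unit_of(1)[OF g]] D_l[OF gh unit_of(1)[OF gh]] g gh by simp
  then obtain z where z: "z \<in> D (inv\<^bsub>G\<^esub> g) \<inter> D h" "a g z = ?q"
    using P3[OF g h] by (metis imageE)
  have apD: "a g ?p \<in> D g \<inter> D (g \<otimes>\<^bsub>G\<^esub> h)" using P3[OF g h] pD by blast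
  have zc: "z \<in> carrier R" using z D_carr h by blast
  have pz: "z \<otimes>\<^bsub>R\<^esub> ?p = z"
    using z zc unit_of_r[OF gi] unit_of_r[OF h] gi h by (simp add: R.m_assoc[symmetric])
  have "?q = a g (z \<otimes>\<^bsub>R\<^esub> ?p)" using pz z by simp
  also have "\<dots> = ?q \<otimes>\<^bsub>R\<^esub> a g ?p" using P1_mult[OF g] z pD by simp
  also have "\<dots> = a g ?p \<otimes>\<^bsub>R\<^esub> ?q" using R.m_comm apD qD D_carr[OF g] by blast
  also have "\<dots> = a g ?p \<otimes>\<^bsub>R\<^esub> unit_of g \<otimes>\<^bsub>R\<^esub> unit_of (g \<otimes>\<^bsub>G\<^esub> h)"
    using apD D_carr[OF g] g gh by (simp add: R.m_assoc)
  also have "\<dots> = a g ?p" using apD unit_of_r[OF g] unit_of_r[OF gh] by auto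
  finally show ?thesis by simp
qed

lemma E_dom: "g \<in> carrier G \<Longrightarrow> x \<in> carrier R \<Longrightarrow> x \<otimes>\<^bsub>R\<^esub> unit_of (inv\<^bsub>G\<^esub> g) \<in> D (inv\<^bsub>G\<^esub> g)"
  by (simp add: D_l unit_of(1))

lemma E_in: "g \<in> carrier G \<Longrightarrow> x \<in> carrier R \<Longrightarrow> ext_map g x \<in> D g"
  unfolding ext_map_def by (intro a_in E_dom)

lemma E_carr [simp]: "g \<in> carrier G \<Longrightarrow> x \<in> carrier R \<Longrightarrow> ext_map g x \<in> carrier R"
  using E_in D_carr by blast

lemma E_add:
  "g \<in> carrier G \<Longrightarrow> x \<in> carrier R \<Longrightarrow> y \<in> carrier R
    \<Longrightarrow> ext_map g (x \<oplus>\<^bsub>R\<^esub> y) = ext_map g x \<oplus>\<^bsub>R\<^esub> ext_map g y"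
  unfolding ext_map_def by (simp add: R.l_distr P1_add E_dom)

lemma E_mult:
  assumes "g \<in> carrier G" "x \<in> carrier R" "y \<in> carrier R"
  shows "ext_map g (x \<otimes>\<^bsub>R\<^esub> y) = ext_map g x \<otimes>\<^bsub>R\<^esub> ext_map g y"
proof -
  let ?e = "unit_of (inv\<^bsub>G\<^esub> g)"
  have "x \<otimes>\<^bsub>R\<^esub> ?e \<otimes>\<^bsub>R\<^esub> (y \<otimes>\<^bsub>R\<^esub> ?e) = x \<otimes>\<^bsub>R\<^esub> (y \<otimes>\<^bsub>R\<^esub> (?e \<otimes>\<^bsub>R\<^esub> ?e))"
    using assms by (simp add: R.m_ac)
  also have "\<dots> = x \<otimes>\<^bsub>R\<^esub> y \<otimes>\<^bsub>R\<^esub> ?e" using assms by (simp add: R.m_assoc unit_of)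
  finally show ?thesis
    unfolding ext_map_def using assms by (metis P1_mult E_dom)
qed

lemma E_eq: "g \<in> carrier G \<Longrightarrow> x \<in> D (inv\<^bsub>G\<^esub> g) \<Longrightarrow> ext_map g x = a g x"
  unfolding ext_map_def by (simp add: unit_of_r)

lemma E_one: "g \<in> carrier G \<Longrightarrow> ext_map g \<one>\<^bsub>R\<^esub> = unit_of g"
  using a_unit[of g "inv\<^bsub>G\<^esub> g"] a_unit[of g "\<one>\<^bsub>G\<^esub>"] 
  unfolding ext_map_def
  by (metis D_iff G.inv_closed G.one_closed G.r_one P2_dom R.l_one R.one_closed R.r_one unit_carr unit_of(1)
      unit_of_r)

lemma E_id: "x \<in> carrier R \<Longrightarrow> ext_map \<one>\<^bsub>G\<^esub> x = x"
  using E_eq[of "\<one>\<^bsub>G\<^esub>"] P2_id P2_dom by simp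

lemma E_zero: "g \<in> carrier G \<Longrightarrow> ext_map g \<zero>\<^bsub>R\<^esub> = \<zero>\<^bsub>R\<^esub>"
  using E_add[of g "\<zero>\<^bsub>R\<^esub>" "\<zero>\<^bsub>R\<^esub>"]
    R.add.r_cancel_one'[of "ext_map g \<zero>\<^bsub>R\<^esub>" "ext_map g \<zero>\<^bsub>R\<^esub>"] by simp

lemma E_E:
  assumes g: "g \<in> carrier G" and h: "h \<in> carrier G" and x: "x \<in> carrier R"
  shows "ext_map g (ext_map h x) = unit_of g \<otimes>\<^bsub>R\<^esub> ext_map (g \<otimes>\<^bsub>G\<^esub> h) x"
proof -
  let ?gi = "inv\<^bsub>G\<^esub> g" let ?hi = "inv\<^bsub>G\<^esub> h" let ?gh = "g \<otimes>\<^bsub>G\<^esub> h"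
  let ?k = "inv\<^bsub>G\<^esub> ?gh"
  have c: "?gi \<in> carrier G" "?hi \<in> carrier G" "?gh \<in> carrier G" "?k \<in> carrier G"
    using g h by auto
  have k: "?k = ?hi \<otimes>\<^bsub>G\<^esub> ?gi" using g h by (simp add: G.inv_mult_group)
  have hk: "h \<otimes>\<^bsub>G\<^esub> ?k = ?gi" using g h k by (simp add: G.m_assoc[symmetric])
  have ghhi: "?gh \<otimes>\<^bsub>G\<^esub> ?hi = g" using g h by (simp add: G.m_assoc)
  let ?x = "x \<otimes>\<^bsub>R\<^esub> unit_of ?hi"
  have xD: "?x \<in> D ?hi" using E_dom h x .
  have uD: "unit_of ?hi \<otimes>\<^bsub>R\<^esub> unit_of ?k \<in> D ?hi" "unit_of ?hi \<otimes>\<^bsub>R\<^esub> unit_of ?k \<in> D ?k"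
    using D_r[OF c(2)] D_l[OF c(4)] unit_of(1)[OF c(2)] unit_of(1)[OF c(4)] c by simp_all
  have axD: "a h ?x \<in> D h" using a_in h xD .
  have axc: "a h ?x \<in> carrier R" using D_carr h axD .
  let ?w = "?x \<otimes>\<^bsub>R\<^esub> (unit_of ?hi \<otimes>\<^bsub>R\<^esub> unit_of ?k)"
  have wD: "?w \<in> D ?hi \<inter> D ?k" using D_l uD c x by simp
  have "a h ?x \<otimes>\<^bsub>R\<^esub> unit_of ?gi = a h ?x \<otimes>\<^bsub>R\<^esub> (unit_of h \<otimes>\<^bsub>R\<^esub> unit_of ?gi)"
    using unit_of_r[OF h axD] axc h c by (simp add: R.m_assoc[symmetric])
  also have "\<dots> = a h ?x \<otimes>\<^bsub>R\<^esub> a h (unit_of ?hi \<otimes>\<^bsub>R\<^esub> unit_of ?k)"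
    using a_unit[OF h c(4)] hk by simp
  also have "\<dots> = a h ?w" using P1_mult[OF h xD uD(1)] by simp
  finally have "ext_map g (ext_map h x) = a g (a h ?w)" unfolding ext_map_def by simp
  also have "\<dots> = a ?gh ?w" using P4[OF g h wD] .
  also have "?w = (x \<otimes>\<^bsub>R\<^esub> unit_of ?k) \<otimes>\<^bsub>R\<^esub> (unit_of ?k \<otimes>\<^bsub>R\<^esub> unit_of ?hi)"
  proof -
    have "?w = x \<otimes>\<^bsub>R\<^esub> ((unit_of ?hi \<otimes>\<^bsub>R\<^esub> unit_of ?hi) \<otimes>\<^bsub>R\<^esub> unit_of ?k)"
      using x c by (simp add: R.m_ac)
    also have "\<dots> = x \<otimes>\<^bsub>R\<^esub> (unit_of ?hi \<otimes>\<^bsub>R\<^esub> (unit_of ?k \<otimes>\<^bsub>R\<^esub> unit_of ?k))"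
      using c unit_of by simp
    also have "\<dots> = (x \<otimes>\<^bsub>R\<^esub> unit_of ?k) \<otimes>\<^bsub>R\<^esub> (unit_of ?k \<otimes>\<^bsub>R\<^esub> unit_of ?hi)"
      using x c by (simp add: R.m_ac)
    finally show ?thesis .
  qed
  also have "a ?gh \<dots> = a ?gh (x \<otimes>\<^bsub>R\<^esub> unit_of ?k) \<otimes>\<^bsub>R\<^esub> a ?gh (unit_of ?k \<otimes>\<^bsub>R\<^esub> unit_of ?hi)"
    by (rule P1_mult[OF c(3)]) (use E_dom[OF c(3) x] D_r[OF c(4)] unit_of(1)[OF c(4)] c in simp_all)
  also have "\<dots> = ext_map ?gh x \<otimes>\<^bsub>R\<^esub> (unit_of ?gh \<otimes>\<^bsub>R\<^esub> unit_of g)"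
    using a_unit[OF c(3) c(2)] ghhi unfolding ext_map_def by simp
  also have "\<dots> = ext_map ?gh x \<otimes>\<^bsub>R\<^esub> unit_of g"
    using unit_of_r[OF c(3) E_in[OF c(3) x]] c g x by (simp add: R.m_assoc[symmetric])
  also have "\<dots> = unit_of g \<otimes>\<^bsub>R\<^esub> ext_map ?gh x" using R.m_comm c g x by simp
  finally show ?thesis .
qed

lemma E_finsum:
  assumes g: "g \<in> carrier G" and "finite A" "f \<in> A \<rightarrow> carrier R"
  shows "ext_map g (\<Oplus>\<^bsub>R\<^esub>i\<in>A. f i) = (\<Oplus>\<^bsub>R\<^esub>i\<in>A. ext_map g (f i))"
  using assms(2,3)
proof (induction A rule: finite_induct)
  case empty thus ?case using E_zero g by simp
next
  case (insert x F)
  hence "f \<in> F \<rightarrow> carrier R" "f x \<in> carrier R" by auto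
  moreover hence "(\<lambda>i. ext_map g (f i)) \<in> F \<rightarrow> carrier R" using g by (simp add: Pi_def)
  ultimately show ?case using insert g by (simp add: E_add)
qed

end

text \<open>The globalization is realised inside the ring of functions from \<open>G\<close> to \<open>R\<close>.\<close>

definition fun_ring :: "'g set \<Rightarrow> ('r, 'd) ring_scheme \<Rightarrow> ('g \<Rightarrow> 'r) ring" where
  "fun_ring X R = \<lparr>carrier = X \<rightarrow>\<^sub>E carrier R, mult = \<lambda>f f'. \<lambda>x\<in>X. f x \<otimes>\<^bsub>R\<^esub> f' x,
     one = \<lambda>x\<in>X. \<one>\<^bsub>R\<^esub>, zero = \<lambda>x\<in>X. \<zero>\<^bsub>R\<^esub>, add = \<lambda>f f'. \<lambda>x\<in>X. f x \<oplus>\<^bsub>R\<^esub> f' x\<rparr>"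

lemma fun_ring_cring:
  assumes "cring R" shows "cring (fun_ring X R)"
proof -
  interpret cring R by fact
  show ?thesis
  proof (rule cringI)
    show "abelian_group (fun_ring X R)"
    proof (rule abelian_groupI)
      fix f assume f: "f \<in> carrier (fun_ring X R)"
      show "\<exists>f' \<in> carrier (fun_ring X R). f' \<oplus>\<^bsub>fun_ring X R\<^esub> f = \<zero>\<^bsub>fun_ring X R\<^esub>"
        by (rule bexI[of _ "\<lambda>x\<in>X. \<ominus>\<^bsub>R\<^esub> f x"])
          (use f in \<open>auto simp: fun_ring_def PiE_iff extensional_def fun_eq_iff l_neg\<close>)
    qed (auto simp: fun_ring_def PiE_iff extensional_def fun_eq_iff a_ac)
    show "Group.comm_monoid (fun_ring X R)"
      by (rule comm_monoidI) (auto simp: fun_ring_def PiE_iff extensional_def fun_eq_iff m_ac)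
  qed (auto simp: fun_ring_def PiE_iff extensional_def fun_eq_iff l_distr)
qed

context unital_partial_action
begin

definition glob_carrier :: "('a \<Rightarrow> 'c) set" where
  "glob_carrier = {f \<in> carrier G \<rightarrow>\<^sub>E carrier R. \<exists>c \<in> carrier G \<rightarrow> carrier R.
     \<forall>h \<in> carrier G. f h = (\<Oplus>\<^bsub>R\<^esub>g\<in>carrier G. ext_map (inv\<^bsub>G\<^esub> h \<otimes>\<^bsub>G\<^esub> g) (c g))}"

definition glob_ring :: "('a \<Rightarrow> 'c) ring" where
  "glob_ring = (fun_ring (carrier G) R)\<lparr>carrier := glob_carrier\<rparr>"

definition glob_act :: "'a \<Rightarrow> ('a \<Rightarrow> 'c) \<Rightarrow> 'a \<Rightarrow> 'c" where
  "glob_act g f = (\<lambda>h\<in>carrier G. f (inv\<^bsub>G\<^esub> g \<otimes>\<^bsub>G\<^esub> h))"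

definition glob_emb :: "'c \<Rightarrow> 'a \<Rightarrow> 'c" where
  "glob_emb s = (\<lambda>h\<in>carrier G. ext_map (inv\<^bsub>G\<^esub> h) s)"

lemma glob_mem: "f \<in> glob_carrier \<Longrightarrow> h \<in> carrier G \<Longrightarrow> f h \<in> carrier R"
  unfolding glob_carrier_def by auto

lemma glob_E:
  assumes fin: "finite (carrier G)" and f: "f \<in> glob_carrier" and h: "h \<in> carrier G" and k: "k \<in> carrier G"
  shows "ext_map (inv\<^bsub>G\<^esub> h \<otimes>\<^bsub>G\<^esub> k) (f k) = unit_of (inv\<^bsub>G\<^esub> h \<otimes>\<^bsub>G\<^esub> k) \<otimes>\<^bsub>R\<^esub> f h"
proof -
  let ?l = "inv\<^bsub>G\<^esub> h \<otimes>\<^bsub>G\<^esub> k"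
  have l: "?l \<in> carrier G" using h k by simp
  obtain c where c: "c \<in> carrier G \<rightarrow> carrier R"
    "\<And>h. h \<in> carrier G \<Longrightarrow> f h = (\<Oplus>\<^bsub>R\<^esub>g\<in>carrier G. ext_map (inv\<^bsub>G\<^esub> h \<otimes>\<^bsub>G\<^esub> g) (c g))"
    using f unfolding glob_carrier_def by blast
  have cg: "c g \<in> carrier R" if "g \<in> carrier G" for g using c that by auto
  have "ext_map ?l (f k) = (\<Oplus>\<^bsub>R\<^esub>g\<in>carrier G. ext_map ?l (ext_map (inv\<^bsub>G\<^esub> k \<otimes>\<^bsub>G\<^esub> g) (c g)))"
    unfolding c(2)[OF k] by (rule E_finsum) (use l fin k cg in auto)
  also have "\<dots> = (\<Oplus>\<^bsub>R\<^esub>g\<in>carrier G. unit_of ?l \<otimes>\<^bsub>R\<^esub> ext_map (inv\<^bsub>G\<^esub> h \<otimes>\<^bsub>G\<^esub> g) (c g))"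
  proof (rule R.finsum_cong', simp)
    fix g assume g: "g \<in> carrier G"
    have "?l \<otimes>\<^bsub>G\<^esub> (inv\<^bsub>G\<^esub> k \<otimes>\<^bsub>G\<^esub> g) = inv\<^bsub>G\<^esub> h \<otimes>\<^bsub>G\<^esub> g"
      using g h k by (metis G.inv_closed G.inv_solve_left G.m_assoc G.m_closed)
    thus "ext_map ?l (ext_map (inv\<^bsub>G\<^esub> k \<otimes>\<^bsub>G\<^esub> g) (c g)) = unit_of ?l \<otimes>\<^bsub>R\<^esub> ext_map (inv\<^bsub>G\<^esub> h \<otimes>\<^bsub>G\<^esub> g) (c g)"
      using E_E[OF l, of "inv\<^bsub>G\<^esub> k \<otimes>\<^bsub>G\<^esub> g" "c g"] g k cg by simp
  qed (use l h cg in auto)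
  also have "\<dots> = unit_of ?l \<otimes>\<^bsub>R\<^esub> f h"
    unfolding c(2)[OF h] by (rule R.finsum_rdistr[symmetric]) (use l fin h cg in auto)
  finally show ?thesis .
qed

lemma glob_closed:
  assumes fin: "finite (carrier G)"
  shows glob_gen: "g \<in> carrier G \<Longrightarrow> s \<in> carrier R \<Longrightarrow> glob_act g (glob_emb s) \<in> glob_carrier"
    and glob_add: "f \<in> glob_carrier \<Longrightarrow> f' \<in> glob_carrier \<Longrightarrow> f \<oplus>\<^bsub>fun_ring (carrier G) R\<^esub> f' \<in> glob_carrier"
    and glob_mult: "f \<in> glob_carrier \<Longrightarrow> f' \<in> glob_carrier \<Longrightarrow> f \<otimes>\<^bsub>fun_ring (carrier G) R\<^esub> f' \<in> glob_carrier"
    and glob_shift: "g \<in> carrier G \<Longrightarrow> f \<in> glob_carrier \<Longrightarrow> glob_act g f \<in> glob_carrier"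
proof -
  show "glob_act g (glob_emb s) \<in> glob_carrier" if g: "g \<in> carrier G" and s: "s \<in> carrier R"
  proof -
    have eq: "glob_act g (glob_emb s) h = ext_map (inv\<^bsub>G\<^esub> h \<otimes>\<^bsub>G\<^esub> g) s" if "h \<in> carrier G" for h
      using that g by (simp add: glob_act_def glob_emb_def G.inv_mult_group)
    have "ext_map (inv\<^bsub>G\<^esub> h \<otimes>\<^bsub>G\<^esub> g) s =
        (\<Oplus>\<^bsub>R\<^esub>k\<in>carrier G. ext_map (inv\<^bsub>G\<^esub> h \<otimes>\<^bsub>G\<^esub> k) (if k = g then s else \<zero>\<^bsub>R\<^esub>))"
      if h: "h \<in> carrier G" for h
    proof -
      have "(\<Oplus>\<^bsub>R\<^esub>k\<in>carrier G. ext_map (inv\<^bsub>G\<^esub> h \<otimes>\<^bsub>G\<^esub> k) (if k = g then s else \<zero>\<^bsub>R\<^esub>))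
        = (\<Oplus>\<^bsub>R\<^esub>k\<in>carrier G. if k = g then ext_map (inv\<^bsub>G\<^esub> h \<otimes>\<^bsub>G\<^esub> k) s else \<zero>\<^bsub>R\<^esub>)"
        by (rule R.finsum_cong') (use h s E_zero in auto)
      also have "\<dots> = ext_map (inv\<^bsub>G\<^esub> h \<otimes>\<^bsub>G\<^esub> g) s"
        by (rule R.add.finprod_singleton_swap) (use g fin h s in auto)
      finally show ?thesis by simp
    qed
    thus ?thesis unfolding glob_carrier_def using eq g s
      by (auto simp: glob_act_def glob_emb_def intro!: bexI[of _ "\<lambda>k. if k = g then s else \<zero>\<^bsub>R\<^esub>"])
  qed
  show "f \<oplus>\<^bsub>fun_ring (carrier G) R\<^esub> f' \<in> glob_carrier" if f: "f \<in> glob_carrier" and f': "f' \<in> glob_carrier"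
  proof -
    obtain c where c: "c \<in> carrier G \<rightarrow> carrier R"
      "\<And>h. h \<in> carrier G \<Longrightarrow> f h = (\<Oplus>\<^bsub>R\<^esub>g\<in>carrier G. ext_map (inv\<^bsub>G\<^esub> h \<otimes>\<^bsub>G\<^esub> g) (c g))"
      using f unfolding glob_carrier_def by blast
    obtain c' where c': "c' \<in> carrier G \<rightarrow> carrier R"
      "\<And>h. h \<in> carrier G \<Longrightarrow> f' h = (\<Oplus>\<^bsub>R\<^esub>g\<in>carrier G. ext_map (inv\<^bsub>G\<^esub> h \<otimes>\<^bsub>G\<^esub> g) (c' g))"
      using f' unfolding glob_carrier_def by blast
    have cg: "c g \<in> carrier R" "c' g \<in> carrier R" if "g \<in> carrier G" for g using c c' that by auto
    have "f h \<oplus>\<^bsub>R\<^esub> f' h = (\<Oplus>\<^bsub>R\<^esub>g\<in>carrier G. ext_map (inv\<^bsub>G\<^esub> h \<otimes>\<^bsub>G\<^esub> g) (c g \<oplus>\<^bsub>R\<^esub> c' g))" if h: "h \<in> carrier G" for h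
    proof -
      have "f h \<oplus>\<^bsub>R\<^esub> f' h = (\<Oplus>\<^bsub>R\<^esub>g\<in>carrier G. ext_map (inv\<^bsub>G\<^esub> h \<otimes>\<^bsub>G\<^esub> g) (c g) \<oplus>\<^bsub>R\<^esub> ext_map (inv\<^bsub>G\<^esub> h \<otimes>\<^bsub>G\<^esub> g) (c' g))"
        unfolding c(2)[OF h] c'(2)[OF h] by (rule R.finsum_addf[symmetric]) (use h cg in auto)
      also have "\<dots> = (\<Oplus>\<^bsub>R\<^esub>g\<in>carrier G. ext_map (inv\<^bsub>G\<^esub> h \<otimes>\<^bsub>G\<^esub> g) (c g \<oplus>\<^bsub>R\<^esub> c' g))"
        by (rule R.finsum_cong') (use h cg E_add in auto)
      finally show ?thesis .
    qed
    thus ?thesis using cg glob_mem[OF f] glob_mem[OF f'] unfolding glob_carrier_def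
      by (auto simp: fun_ring_def intro!: bexI[of _ "\<lambda>g. c g \<oplus>\<^bsub>R\<^esub> c' g"])
  qed
  show "f \<otimes>\<^bsub>fun_ring (carrier G) R\<^esub> f' \<in> glob_carrier" if f: "f \<in> glob_carrier" and f': "f' \<in> glob_carrier"
  proof -
    obtain c where c: "c \<in> carrier G \<rightarrow> carrier R"
      "\<And>h. h \<in> carrier G \<Longrightarrow> f' h = (\<Oplus>\<^bsub>R\<^esub>g\<in>carrier G. ext_map (inv\<^bsub>G\<^esub> h \<otimes>\<^bsub>G\<^esub> g) (c g))"
      using f' unfolding glob_carrier_def by blast
    have cg: "c g \<in> carrier R" if "g \<in> carrier G" for g using c that by auto
    note fm = glob_mem[OF f]
    have "f h \<otimes>\<^bsub>R\<^esub> f' h = (\<Oplus>\<^bsub>R\<^esub>g\<in>carrier G. ext_map (inv\<^bsub>G\<^esub> h \<otimes>\<^bsub>G\<^esub> g) (f g \<otimes>\<^bsub>R\<^esub> c g))" if h: "h \<in> carrier G" for h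
    proof -
      have "f h \<otimes>\<^bsub>R\<^esub> f' h = (\<Oplus>\<^bsub>R\<^esub>g\<in>carrier G. f h \<otimes>\<^bsub>R\<^esub> ext_map (inv\<^bsub>G\<^esub> h \<otimes>\<^bsub>G\<^esub> g) (c g))"
        unfolding c(2)[OF h] by (rule R.finsum_rdistr) (use h fin fm cg in auto)
      also have "\<dots> = (\<Oplus>\<^bsub>R\<^esub>g\<in>carrier G. ext_map (inv\<^bsub>G\<^esub> h \<otimes>\<^bsub>G\<^esub> g) (f g \<otimes>\<^bsub>R\<^esub> c g))"
      proof (rule R.finsum_cong', simp)
        fix g assume g: "g \<in> carrier G"
        let ?l = "inv\<^bsub>G\<^esub> h \<otimes>\<^bsub>G\<^esub> g"
        have l: "?l \<in> carrier G" using g h by simp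
        have "ext_map ?l (f g \<otimes>\<^bsub>R\<^esub> c g) = unit_of ?l \<otimes>\<^bsub>R\<^esub> f h \<otimes>\<^bsub>R\<^esub> ext_map ?l (c g)"
          using E_mult[OF l] glob_E[OF fin f h g] fm cg g by simp
        also have "\<dots> = f h \<otimes>\<^bsub>R\<^esub> (unit_of ?l \<otimes>\<^bsub>R\<^esub> ext_map ?l (c g))"
          using l cg g h fm by (simp add: R.m_ac)
        also have "\<dots> = f h \<otimes>\<^bsub>R\<^esub> ext_map ?l (c g)" using unit_of(2)[OF l E_in[OF l]] cg g by simp
        finally show "f h \<otimes>\<^bsub>R\<^esub> ext_map ?l (c g) = ext_map ?l (f g \<otimes>\<^bsub>R\<^esub> c g)" by simp
      qed (use h fm cg in auto)
      finally show ?thesis .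
    qed
    thus ?thesis using cg fm glob_mem[OF f'] unfolding glob_carrier_def
      by (auto simp: fun_ring_def intro!: bexI[of _ "\<lambda>g. f g \<otimes>\<^bsub>R\<^esub> c g"])
  qed
  show "glob_act g f \<in> glob_carrier" if g: "g \<in> carrier G" and f: "f \<in> glob_carrier"
  proof -
    obtain c where c: "c \<in> carrier G \<rightarrow> carrier R"
      "\<And>h. h \<in> carrier G \<Longrightarrow> f h = (\<Oplus>\<^bsub>R\<^esub>g\<in>carrier G. ext_map (inv\<^bsub>G\<^esub> h \<otimes>\<^bsub>G\<^esub> g) (c g))"
      using f unfolding glob_carrier_def by blast
    have cg: "c g \<in> carrier R" if "g \<in> carrier G" for g using c that by auto
    have inj: "inj_on (\<lambda>k. g \<otimes>\<^bsub>G\<^esub> k) (carrier G)" using g by (auto intro: inj_onI)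
    have im: "(\<lambda>k. g \<otimes>\<^bsub>G\<^esub> k) ` carrier G = carrier G"
      using g G.surj_const_mult by simp
    have [simp]: "inv\<^bsub>G\<^esub> g \<otimes>\<^bsub>G\<^esub> (g \<otimes>\<^bsub>G\<^esub> k) = k" if "k \<in> carrier G" for k
      using g that by (metis G.inv_closed G.l_inv G.l_one G.m_assoc)
    have "f (inv\<^bsub>G\<^esub> g \<otimes>\<^bsub>G\<^esub> h) = (\<Oplus>\<^bsub>R\<^esub>k\<in>carrier G. ext_map (inv\<^bsub>G\<^esub> h \<otimes>\<^bsub>G\<^esub> k) (c (inv\<^bsub>G\<^esub> g \<otimes>\<^bsub>G\<^esub> k)))"
      if h: "h \<in> carrier G" for h
    proof -
      have "(\<Oplus>\<^bsub>R\<^esub>k\<in>(\<lambda>k. g \<otimes>\<^bsub>G\<^esub> k) ` carrier G. ext_map (inv\<^bsub>G\<^esub> h \<otimes>\<^bsub>G\<^esub> k) (c (inv\<^bsub>G\<^esub> g \<otimes>\<^bsub>G\<^esub> k)))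
        = (\<Oplus>\<^bsub>R\<^esub>k\<in>carrier G. ext_map (inv\<^bsub>G\<^esub> h \<otimes>\<^bsub>G\<^esub> (g \<otimes>\<^bsub>G\<^esub> k)) (c (inv\<^bsub>G\<^esub> g \<otimes>\<^bsub>G\<^esub> (g \<otimes>\<^bsub>G\<^esub> k))))"
        by (rule R.finsum_reindex) (use inj g h cg in auto)
      also have "\<dots> = (\<Oplus>\<^bsub>R\<^esub>k\<in>carrier G. ext_map (inv\<^bsub>G\<^esub> (inv\<^bsub>G\<^esub> g \<otimes>\<^bsub>G\<^esub> h) \<otimes>\<^bsub>G\<^esub> k) (c k))"
        by (rule R.finsum_cong') (use g h cg in \<open>auto simp: G.inv_mult_group G.m_assoc\<close>)
      also have "\<dots> = f (inv\<^bsub>G\<^esub> g \<otimes>\<^bsub>G\<^esub> h)" using c(2)[of "inv\<^bsub>G\<^esub> g \<otimes>\<^bsub>G\<^esub> h"] g h by simp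
      finally show ?thesis using im by simp
    qed
    thus ?thesis using g cg glob_mem[OF f] unfolding glob_carrier_def
      by (auto simp: glob_act_def intro!: bexI[of _ "\<lambda>k. c (inv\<^bsub>G\<^esub> g \<otimes>\<^bsub>G\<^esub> k)"])
  qed
qed

lemma act_one: "f \<in> carrier G \<rightarrow>\<^sub>E carrier R \<Longrightarrow> glob_act \<one>\<^bsub>G\<^esub> f = f"
  by (auto simp: glob_act_def intro!: PiE_ext[of _ "carrier G" "\<lambda>_. carrier R"])

lemma emb_glob: "finite (carrier G) \<Longrightarrow> s \<in> carrier R \<Longrightarrow> glob_emb s \<in> glob_carrier"
  using glob_gen[of "\<one>\<^bsub>G\<^esub>" s] act_one[of "glob_emb s"] by (simp add: glob_emb_def)

lemma glob_uminus:
  assumes fin: "finite (carrier G)" and f: "f \<in> glob_carrier"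
  shows "\<ominus>\<^bsub>fun_ring (carrier G) R\<^esub> f \<in> glob_carrier"
proof -
  interpret F: cring "fun_ring (carrier G) R" by (rule fun_ring_cring) unfold_locales
  obtain c where c: "c \<in> carrier G \<rightarrow> carrier R"
    "\<And>h. h \<in> carrier G \<Longrightarrow> f h = (\<Oplus>\<^bsub>R\<^esub>g\<in>carrier G. ext_map (inv\<^bsub>G\<^esub> h \<otimes>\<^bsub>G\<^esub> g) (c g))"
    using f unfolding glob_carrier_def by blast
  have cg: "c g \<in> carrier R" if "g \<in> carrier G" for g using c that by auto
  define f' where "f' = (\<lambda>h\<in>carrier G. \<Oplus>\<^bsub>R\<^esub>g\<in>carrier G. ext_map (inv\<^bsub>G\<^esub> h \<otimes>\<^bsub>G\<^esub> g) (\<ominus>\<^bsub>R\<^esub> c g))"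
  have f'c: "f' \<in> carrier G \<rightarrow>\<^sub>E carrier R"
    unfolding f'_def by (auto intro!: R.finsum_closed simp: cg)
  have f': "f' \<in> glob_carrier"
    using f'c cg unfolding glob_carrier_def by (auto simp: f'_def intro!: bexI[of _ "\<lambda>g. \<ominus>\<^bsub>R\<^esub> c g"])
  have "f' h \<oplus>\<^bsub>R\<^esub> f h = \<zero>\<^bsub>R\<^esub>" if h: "h \<in> carrier G" for h
  proof -
    have "f' h \<oplus>\<^bsub>R\<^esub> f h = (\<Oplus>\<^bsub>R\<^esub>g\<in>carrier G. ext_map (inv\<^bsub>G\<^esub> h \<otimes>\<^bsub>G\<^esub> g) (\<ominus>\<^bsub>R\<^esub> c g) \<oplus>\<^bsub>R\<^esub> ext_map (inv\<^bsub>G\<^esub> h \<otimes>\<^bsub>G\<^esub> g) (c g))"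
      unfolding f'_def c(2)[OF h] using h by (simp, intro R.finsum_addf[symmetric]) (use h cg in auto)
    also have "\<dots> = (\<Oplus>\<^bsub>R\<^esub>g\<in>carrier G. \<zero>\<^bsub>R\<^esub>)"
      by (rule R.finsum_cong') (use h cg in \<open>auto simp: E_add[symmetric] R.l_neg E_zero\<close>)
    finally show ?thesis by simp
  qed
  hence "f' \<oplus>\<^bsub>fun_ring (carrier G) R\<^esub> f = \<zero>\<^bsub>fun_ring (carrier G) R\<^esub>"
    by (auto simp: fun_ring_def)
  hence "\<ominus>\<^bsub>fun_ring (carrier G) R\<^esub> f = f'"
    using f f'c by (intro F.minus_equality) (auto simp: fun_ring_def glob_carrier_def)
  thus ?thesis using f' by simp
qed

lemma glob_one:
  assumes fin: "finite (carrier G)"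
  shows "\<one>\<^bsub>fun_ring (carrier G) R\<^esub> \<in> glob_carrier"
proof -
  let ?F = "fun_ring (carrier G) R"
  interpret F: cring ?F by (rule fun_ring_cring) unfold_locales
  have "\<exists>u \<in> glob_carrier. \<forall>h \<in> A. u h = \<one>\<^bsub>R\<^esub>" if "finite A" "A \<subseteq> carrier G" for A
    using that
  proof (induction A rule: finite_induct)
    case empty
    thus ?case using emb_glob[OF fin R.one_closed] by blast
  next
    case (insert g A)
    then obtain u where u: "u \<in> glob_carrier" "\<forall>h \<in> A. u h = \<one>\<^bsub>R\<^esub>" by auto
    have g: "g \<in> carrier G" using insert by simp
    let ?e = "glob_act g (glob_emb \<one>\<^bsub>R\<^esub>)"
    have e: "?e \<in> glob_carrier" using glob_gen[OF fin g] by simp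
    let ?v = "u \<oplus>\<^bsub>?F\<^esub> (?e \<oplus>\<^bsub>?F\<^esub> (\<ominus>\<^bsub>?F\<^esub> (u \<otimes>\<^bsub>?F\<^esub> ?e)))"
    let ?w = "\<ominus>\<^bsub>?F\<^esub> (u \<otimes>\<^bsub>?F\<^esub> ?e)"
    have w: "?w \<in> glob_carrier" using u e glob_mult glob_uminus fin by blast
    have v: "?v \<in> glob_carrier" using u e w glob_add fin by blast
    have Fc: "glob_carrier \<subseteq> carrier ?F" unfolding glob_carrier_def fun_ring_def by auto
    have rn: "(u \<otimes>\<^bsub>?F\<^esub> ?e) \<oplus>\<^bsub>?F\<^esub> ?w = \<zero>\<^bsub>?F\<^esub>" using u e Fc by (intro F.r_neg) auto
    have wh: "u h \<otimes>\<^bsub>R\<^esub> ?e h \<oplus>\<^bsub>R\<^esub> ?w h = \<zero>\<^bsub>R\<^esub>" if "h \<in> carrier G" for h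
      using fun_cong[OF rn, of h] that by (simp add: fun_ring_def)
    have vh: "?v h = u h \<oplus>\<^bsub>R\<^esub> (?e h \<oplus>\<^bsub>R\<^esub> ?w h)" if "h \<in> carrier G" for h
      using that by (simp add: fun_ring_def)
    have eg: "?e g = \<one>\<^bsub>R\<^esub>"
      using g E_id by (simp add: glob_act_def glob_emb_def)
    have "?v g = \<one>\<^bsub>R\<^esub>"
      using vh[OF g] wh[OF g] eg glob_mem[OF u(1) g] glob_mem[OF w g]
      by (simp add: R.a_lcomm)
    moreover have "?v h = \<one>\<^bsub>R\<^esub>" if "h \<in> A" for h
    proof -
      have h: "h \<in> carrier G" using that insert by auto
      show ?thesis using vh[OF h] wh[OF h] u that glob_mem[OF e h] by simp
    qed
    ultimately show ?case using v by blast
  qed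
  from this[OF fin subset_refl] obtain u where u: "u \<in> glob_carrier" "\<forall>h \<in> carrier G. u h = \<one>\<^bsub>R\<^esub>" by blast
  have "u = \<one>\<^bsub>?F\<^esub>"
    using u by (intro PiE_ext[of _ "carrier G" "\<lambda>_. carrier R"]) (auto simp: glob_carrier_def fun_ring_def)
  thus ?thesis using u by simp
qed

lemma glob_cring: assumes "finite (carrier G)" shows "cring glob_ring"
proof -
  interpret F: cring "fun_ring (carrier G) R" by (rule fun_ring_cring) unfold_locales
  have "subring glob_carrier (fun_ring (carrier G) R)"
    by (rule F.subringI) (use assms glob_one glob_uminus glob_mult glob_add in
        \<open>auto simp: glob_carrier_def fun_ring_def\<close>)
  thus ?thesis
    unfolding glob_ring_def using F.subcringI' F.subcring_iff[OF subringE(1)] by blast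
qed

lemma glob_finsum:
  assumes "finite (carrier G)" "finite A" "f \<in> A \<rightarrow> glob_carrier" "h \<in> carrier G"
  shows "(\<Oplus>\<^bsub>glob_ring\<^esub>i\<in>A. f i) h = (\<Oplus>\<^bsub>R\<^esub>i\<in>A. f i h)"
proof -
  interpret T: cring glob_ring by (rule glob_cring) fact
  have c: "carrier glob_ring = glob_carrier" by (simp add: glob_ring_def)
  show ?thesis using assms(2,3)
  proof (induction A rule: finite_induct)
    case empty
    show ?case unfolding T.finsum_empty R.finsum_empty
      using assms(4) by (simp add: glob_ring_def fun_ring_def)
  next
    case (insert x A)
    have "(\<lambda>i. f i h) \<in> A \<rightarrow> carrier R" "f x h \<in> carrier R"
      using insert.prems assms(4) glob_mem by fastforce+
    moreover have "f \<in> A \<rightarrow> carrier glob_ring" "f x \<in> carrier glob_ring" using insert.prems c by auto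
    ultimately show ?case using insert assms(4)
      by (simp add: T.finsum_insert) (simp add: glob_ring_def fun_ring_def)
  qed
qed

theorem globalization_exists:
  assumes fin: "finite (carrier G)"
  shows "globalization G R D a glob_ring glob_act glob_emb"
proof -
  interpret T: cring glob_ring by (rule glob_cring) fact
  have c: "carrier glob_ring = glob_carrier" by (simp add: glob_ring_def)
  have ext: "f = f'" if "f \<in> glob_carrier" "f' \<in> glob_carrier" "\<And>h. h \<in> carrier G \<Longrightarrow> f h = f' h" for f f'
    using that by (intro PiE_ext[of _ "carrier G" "\<lambda>_. carrier R"]) (auto simp: glob_carrier_def)
  have comp: "glob_act g (glob_act k f) = glob_act (g \<otimes>\<^bsub>G\<^esub> k) f"
    if "g \<in> carrier G" "k \<in> carrier G" for g k f
    using that by (auto simp: glob_act_def G.inv_mult_group G.m_assoc intro!: restrict_ext)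
  have one: "glob_act \<one>\<^bsub>G\<^esub> f = f" if "f \<in> glob_carrier" for f
    using that act_one by (simp add: glob_carrier_def)
  note shift = glob_shift[OF fin]
  have bij: "bij_betw (glob_act g) glob_carrier glob_carrier" if g: "g \<in> carrier G" for g
    by (rule bij_betw_byWitness[where f' = "glob_act (inv\<^bsub>G\<^esub> g)"])
      (use g comp one shift in auto)
  have emb: "glob_emb s \<in> glob_carrier" if "s \<in> carrier R" for s using emb_glob fin that .
  have emb1: "glob_emb s \<one>\<^bsub>G\<^esub> = s" if "s \<in> carrier R" for s using that E_id by (simp add: glob_emb_def)
  have gen: "glob_act g (glob_emb s) h = ext_map (inv\<^bsub>G\<^esub> h \<otimes>\<^bsub>G\<^esub> g) s" if "g \<in> carrier G" "h \<in> carrier G" for g h s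
    using that by (simp add: glob_act_def glob_emb_def G.inv_mult_group)
  have eadd: "glob_emb (x \<oplus>\<^bsub>R\<^esub> y) = glob_emb x \<oplus>\<^bsub>glob_ring\<^esub> glob_emb y" if "x \<in> carrier R" "y \<in> carrier R" for x y
    using that by (auto simp: glob_emb_def glob_ring_def fun_ring_def E_add intro!: restrict_ext)
  have emult: "glob_emb (x \<otimes>\<^bsub>R\<^esub> y) = glob_emb x \<otimes>\<^bsub>glob_ring\<^esub> glob_emb y" if "x \<in> carrier R" "y \<in> carrier R" for x y
    using that by (auto simp: glob_emb_def glob_ring_def fun_ring_def E_mult intro!: restrict_ext)
  have absorb: "f \<otimes>\<^bsub>glob_ring\<^esub> glob_emb s = glob_emb (f \<one>\<^bsub>G\<^esub> \<otimes>\<^bsub>R\<^esub> s)"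
    if f: "f \<in> glob_carrier" and s: "s \<in> carrier R" for f s
  proof -
    have "f h \<otimes>\<^bsub>R\<^esub> ext_map (inv\<^bsub>G\<^esub> h) s = ext_map (inv\<^bsub>G\<^esub> h) (f \<one>\<^bsub>G\<^esub> \<otimes>\<^bsub>R\<^esub> s)" if h: "h \<in> carrier G" for h
    proof -
      let ?l = "inv\<^bsub>G\<^esub> h"
      have l: "?l \<in> carrier G" using h by simp
      note f1 = glob_mem[OF f G.one_closed] and fh = glob_mem[OF f h]
      have "ext_map ?l (f \<one>\<^bsub>G\<^esub> \<otimes>\<^bsub>R\<^esub> s) = unit_of ?l \<otimes>\<^bsub>R\<^esub> f h \<otimes>\<^bsub>R\<^esub> ext_map ?l s"
        using E_mult[OF l f1 s] glob_E[OF fin f h G.one_closed] l by simp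
      also have "\<dots> = f h \<otimes>\<^bsub>R\<^esub> (unit_of ?l \<otimes>\<^bsub>R\<^esub> ext_map ?l s)" using l s fh by (simp add: R.m_ac)
      also have "\<dots> = f h \<otimes>\<^bsub>R\<^esub> ext_map ?l s" using unit_of(2)[OF l E_in[OF l s]] by simp
      finally show ?thesis by simp
    qed
    thus ?thesis by (auto simp: glob_emb_def glob_ring_def fun_ring_def intro!: restrict_ext)
  qed
  have restr: "glob_act g (glob_emb x) = glob_emb (a g x)" if g: "g \<in> carrier G" and x: "x \<in> D (inv\<^bsub>G\<^esub> g)" for g x
  proof (rule ext)
    have gi: "inv\<^bsub>G\<^esub> g \<in> carrier G" using g by simp
    have xc: "x \<in> carrier R" using D_carr[OF gi x] .
    have ac: "a g x \<in> carrier R" using a_in[OF g x] D_carr g by blast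
    show "glob_act g (glob_emb x) \<in> glob_carrier" using shift g emb xc by blast
    show "glob_emb (a g x) \<in> glob_carrier" using emb ac .
    fix h assume h: "h \<in> carrier G"
    let ?l = "inv\<^bsub>G\<^esub> h"
    have l: "?l \<in> carrier G" "?l \<otimes>\<^bsub>G\<^esub> g \<in> carrier G" using h g by auto
    have lg: "?l \<otimes>\<^bsub>G\<^esub> g \<otimes>\<^bsub>G\<^esub> inv\<^bsub>G\<^esub> g = ?l" using g h by (simp add: G.m_assoc)
    have "ext_map (?l \<otimes>\<^bsub>G\<^esub> g) x = ext_map (?l \<otimes>\<^bsub>G\<^esub> g) (x \<otimes>\<^bsub>R\<^esub> unit_of (inv\<^bsub>G\<^esub> g))"
      using unit_of_r[OF gi x] by simp
    also have "\<dots> = ext_map (?l \<otimes>\<^bsub>G\<^esub> g) x \<otimes>\<^bsub>R\<^esub> ext_map (?l \<otimes>\<^bsub>G\<^esub> g) (ext_map (inv\<^bsub>G\<^esub> g) \<one>\<^bsub>R\<^esub>)"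
      using E_mult[OF l(2) xc] E_one[OF gi] gi by simp
    also have "\<dots> = ext_map (?l \<otimes>\<^bsub>G\<^esub> g) x \<otimes>\<^bsub>R\<^esub> (unit_of (?l \<otimes>\<^bsub>G\<^esub> g) \<otimes>\<^bsub>R\<^esub> unit_of ?l)"
      using E_E[OF l(2) gi R.one_closed] lg E_one[OF l(1)] by simp
    also have "\<dots> = ext_map (?l \<otimes>\<^bsub>G\<^esub> g) x \<otimes>\<^bsub>R\<^esub> unit_of ?l"
      using unit_of_r[OF l(2) E_in[OF l(2) xc]] l xc by (simp add: R.m_assoc[symmetric])
    also have "\<dots> = unit_of ?l \<otimes>\<^bsub>R\<^esub> ext_map (?l \<otimes>\<^bsub>G\<^esub> g) x" using l xc R.m_comm by simp
    also have "\<dots> = ext_map ?l (a g x)" using E_E[OF l(1) g xc] E_eq[OF g x] by simp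
    finally show "glob_act g (glob_emb x) h = glob_emb (a g x) h"
      using gen[OF g h] h by (simp add: glob_emb_def)
  qed
  interpret T: partial_action G glob_ring "\<lambda>_. carrier glob_ring" glob_act
  proof (intro partial_action.intro partial_action_axioms.intro)
    fix g assume g: "g \<in> carrier G"
    show "ideal (carrier glob_ring) glob_ring" by (rule T.oneideal)
    show "bij_betw (glob_act g) (carrier glob_ring) (carrier glob_ring)" using bij g c by simp
    fix k assume k: "k \<in> carrier G"
    show "glob_act g ` (carrier glob_ring \<inter> carrier glob_ring) = carrier glob_ring \<inter> carrier glob_ring"
      using bij[OF g] c by (simp add: bij_betw_def)
  next
    fix g x y assume g: "g \<in> carrier G"
    show "glob_act g (x \<oplus>\<^bsub>glob_ring\<^esub> y) = glob_act g x \<oplus>\<^bsub>glob_ring\<^esub> glob_act g y"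
      using g by (auto simp: glob_act_def glob_ring_def fun_ring_def intro!: restrict_ext)
    show "glob_act g (x \<otimes>\<^bsub>glob_ring\<^esub> y) = glob_act g x \<otimes>\<^bsub>glob_ring\<^esub> glob_act g y"
      using g by (auto simp: glob_act_def glob_ring_def fun_ring_def intro!: restrict_ext)
  qed (use comp one c G.group_axioms T.cring_axioms in auto)
  show ?thesis
  proof (intro globalization.intro globalization_axioms.intro)
    show "inj_on glob_emb (carrier R)" using emb1 by (metis inj_onI)
    show "ideal (glob_emb ` carrier R) glob_ring"
    proof (rule idealI)
      show "ring glob_ring" by unfold_locales
      show "subgroup (glob_emb ` carrier R) (add_monoid glob_ring)"
      proof (rule T.add.subgroupI)
        show "glob_emb ` carrier R \<subseteq> carrier glob_ring" using emb c by auto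
        show "glob_emb ` carrier R \<noteq> {}" by auto
        fix f assume "f \<in> glob_emb ` carrier R"
        then obtain s where s: "s \<in> carrier R" "f = glob_emb s" by auto
        have z: "glob_emb \<zero>\<^bsub>R\<^esub> = \<zero>\<^bsub>glob_ring\<^esub>"
          by (auto simp: glob_emb_def glob_ring_def fun_ring_def E_zero intro!: restrict_ext)
        have "glob_emb (\<ominus>\<^bsub>R\<^esub> s) \<oplus>\<^bsub>glob_ring\<^esub> f = \<zero>\<^bsub>glob_ring\<^esub>"
          using s eadd[of "\<ominus>\<^bsub>R\<^esub> s" s] z by (simp add: R.l_neg)
        hence "\<ominus>\<^bsub>glob_ring\<^esub> f = glob_emb (\<ominus>\<^bsub>R\<^esub> s)"
          using s emb c by (intro T.minus_equality) auto
        thus "\<ominus>\<^bsub>glob_ring\<^esub> f \<in> glob_emb ` carrier R" using s by simp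
      next
        fix f f' assume "f \<in> glob_emb ` carrier R" "f' \<in> glob_emb ` carrier R"
        thus "f \<oplus>\<^bsub>glob_ring\<^esub> f' \<in> glob_emb ` carrier R" using eadd[symmetric] by auto
      qed
      fix f t assume "f \<in> glob_emb ` carrier R" and t: "t \<in> carrier glob_ring"
      then obtain s where s: "s \<in> carrier R" "f = glob_emb s" by auto
      have "t \<otimes>\<^bsub>glob_ring\<^esub> f = glob_emb (t \<one>\<^bsub>G\<^esub> \<otimes>\<^bsub>R\<^esub> s)" using absorb s t c by simp
      moreover have "t \<one>\<^bsub>G\<^esub> \<in> carrier R" using t c glob_mem by simp
      ultimately show "t \<otimes>\<^bsub>glob_ring\<^esub> f \<in> glob_emb ` carrier R" using s by simp
      thus "f \<otimes>\<^bsub>glob_ring\<^esub> t \<in> glob_emb ` carrier R" using T.m_comm[OF t, of f] s emb[of s] c by simp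
    qed
  next
    fix g assume g: "g \<in> carrier G"
    show "glob_emb ` D g = glob_emb ` carrier R \<inter> glob_act g ` glob_emb ` carrier R"
    proof (intro equalityI subsetI)
      fix f assume "f \<in> glob_emb ` D g"
      then obtain x where x: "x \<in> D g" "f = glob_emb x" by auto
      then obtain y where y: "y \<in> D (inv\<^bsub>G\<^esub> g)" "a g y = x"
        using P1_bij[OF g] by (metis bij_betw_imp_surj_on imageE)
      have yc: "y \<in> carrier R" using D_carr y g G.inv_closed by blast
      have "f = glob_act g (glob_emb y)" using restr[OF g y(1)] x y by simp
      thus "f \<in> glob_emb ` carrier R \<inter> glob_act g ` glob_emb ` carrier R"
        using x yc D_carr[OF g] by blast
    next
      fix f assume "f \<in> glob_emb ` carrier R \<inter> glob_act g ` glob_emb ` carrier R"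
      then obtain x y where xy: "x \<in> carrier R" "y \<in> carrier R" "f = glob_emb x"
        "f = glob_act g (glob_emb y)" by auto
      have "x = ext_map g y" using gen[OF g G.one_closed, of y] emb1 xy g by simp
      thus "f \<in> glob_emb ` D g" using E_in g xy by blast
    qed
  next
    fix t assume "t \<in> carrier glob_ring"
    hence t: "t \<in> glob_carrier" using c by simp
    then obtain d where d: "d \<in> carrier G \<rightarrow> carrier R"
      "\<And>h. h \<in> carrier G \<Longrightarrow> t h = (\<Oplus>\<^bsub>R\<^esub>g\<in>carrier G. ext_map (inv\<^bsub>G\<^esub> h \<otimes>\<^bsub>G\<^esub> g) (d g))"
      unfolding glob_carrier_def by blast
    have m: "(\<lambda>g. glob_act g (glob_emb (d g))) \<in> carrier G \<rightarrow> glob_carrier"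
      using d(1) shift emb by auto
    have "t = (\<Oplus>\<^bsub>glob_ring\<^esub>g\<in>carrier G. glob_act g (glob_emb (d g)))"
    proof (rule ext[OF t])
      show "(\<Oplus>\<^bsub>glob_ring\<^esub>g\<in>carrier G. glob_act g (glob_emb (d g))) \<in> glob_carrier"
        using T.finsum_closed m c by metis
      fix h assume h: "h \<in> carrier G"
      show "t h = (\<Oplus>\<^bsub>glob_ring\<^esub>g\<in>carrier G. glob_act g (glob_emb (d g))) h"
        unfolding glob_finsum[OF fin fin m h] d(2)[OF h]
        by (rule R.finsum_cong') (use h Pi_mem[OF d(1)] gen in auto)
    qed
    thus "\<exists>A c. finite A \<and> A \<subseteq> carrier G \<and> c \<in> A \<rightarrow> carrier R \<and>
        t = (\<Oplus>\<^bsub>glob_ring\<^esub>g\<in>A. glob_act g (glob_emb (c g)))"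
      using fin d(1) by blast
  qed (use eadd emult restr unital_partial_action_axioms T.partial_action_axioms in auto)
qed

end
end

theory Submission
  imports Defs
begin

text \<open>
  For a subgroup \<open>H\<close>, restriction \<open>t \<mapsto> t 1\<^sub>S\<close> is an isomorphism from the ideal \<open>T\<^sup>H e\<^sub>H\<close> of
  the ring of fixed points \<open>T\<^sup>H\<close> onto \<open>S\<^sup>\<alpha>\<^sup>H\<close>, with inverse \<open>\<psi>\<^sub>H\<close>.  If \<open>H\<close> is normal, \<open>G/H\<close> acts
  globally on \<open>T\<^sup>H\<close>, and \<open>\<alpha>\<^sub>G\<^sub>/\<^sub>H\<close> is the restriction of this action to the ideal; taking
  \<open>H = G\<close>, where \<open>e\<^sub>G = 1\<close>, gives \<open>S\<^sup>\<alpha> = T\<^sup>G 1\<^sub>S\<close> and hence the invariants of \<open>\<alpha>\<^sub>G\<^sub>/\<^sub>H\<close>.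
  For the Galois property, a system \<open>(x\<^sub>i, y\<^sub>i)\<close> of \<open>S\<close> lifts to one of \<open>T\<close>; as \<open>T\<close> is Galois
  over \<open>T\<^sup>H\<close>, some \<open>c\<close> has \<open>H\<close>-trace \<open>1\<close>, and then the traces of \<open>c x\<^sub>i\<close> and of \<open>y\<^sub>i\<close> form
  a system of \<open>T\<^sup>H\<close> for \<open>G/H\<close>, which is multiplied by \<open>1\<^sub>S\<close>.
\<close>

section \<open>Finite sums and Nakayama's lemma\<close>

lemma (in abelian_monoid) finsum_swap:
  assumes "finite A" "finite B" "\<And>x y. x \<in> A \<Longrightarrow> y \<in> B \<Longrightarrow> f x y \<in> carrier G"
  shows "(\<Oplus>x\<in>A. \<Oplus>y\<in>B. f x y) = (\<Oplus>y\<in>B. \<Oplus>x\<in>A. f x y)"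
  using assms(1,3)
proof (induction A rule: finite_induct)
  case empty
  show ?case by simp
next
  case (insert a A)
  have "(\<Oplus>y\<in>B. \<Oplus>x\<in>insert a A. f x y) = (\<Oplus>y\<in>B. f a y \<oplus> (\<Oplus>x\<in>A. f x y))"
    by (rule finsum_cong') (use insert in \<open>auto intro!: finsum_closed simp: Pi_def\<close>)
  also have "\<dots> = (\<Oplus>y\<in>B. f a y) \<oplus> (\<Oplus>y\<in>B. \<Oplus>x\<in>A. f x y)"
    by (rule finsum_addf) (use insert in \<open>auto intro!: finsum_closed\<close>)
  also have "\<dots> = (\<Oplus>x\<in>insert a A. \<Oplus>y\<in>B. f x y)"
    using insert by (simp add: Pi_def)
  finally show ?case ..
qed

lemma (in abelian_monoid) finsum_Times:
  assumes "finite A" "finite B" "\<And>x y. x \<in> A \<Longrightarrow> y \<in> B \<Longrightarrow> f x y \<in> carrier G"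
  shows "(\<Oplus>z\<in>A \<times> B. f (fst z) (snd z)) = (\<Oplus>x\<in>A. \<Oplus>y\<in>B. f x y)"
  using assms(1,3)
proof (induction A rule: finite_induct)
  case empty
  show ?case by simp
next
  case (insert a A)
  have "(\<Oplus>z\<in>insert a A \<times> B. f (fst z) (snd z)) = (\<Oplus>z\<in>Pair a ` B \<union> A \<times> B. f (fst z) (snd z))"
    by (rule arg_cong[of _ _ "finsum G _"]) auto
  also have "\<dots> = (\<Oplus>z\<in>Pair a ` B. f (fst z) (snd z)) \<oplus> (\<Oplus>z\<in>A \<times> B. f (fst z) (snd z))"
    by (rule finsum_Un_disjoint) (use insert assms(2) in auto)
  also have "(\<Oplus>z\<in>Pair a ` B. f (fst z) (snd z)) = (\<Oplus>y\<in>B. f a y)"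
    by (subst finsum_reindex) (use insert in \<open>auto intro: inj_onI\<close>)
  also have "(\<Oplus>z\<in>A \<times> B. f (fst z) (snd z)) = (\<Oplus>x\<in>A. \<Oplus>y\<in>B. f x y)"
    using insert by simp
  finally show ?case
    using insert by (simp add: Pi_def)
qed

text \<open>The generators \<open>x\<close> are eliminated one at a time, multiplying by elements of \<open>1 + I\<close>,
  which avoids determinants.\<close>

lemma (in cring) nakayama:
  assumes I: "additive_subgroup I R" and mult: "\<And>a b. a \<in> I \<Longrightarrow> b \<in> I \<Longrightarrow> a \<otimes> b \<in> I"
    and "finite F" "x \<in> F \<rightarrow> carrier R" "i \<in> I"
    and "\<And>t. t \<in> carrier R \<Longrightarrow> \<exists>c \<in> F \<rightarrow> I. (\<one> \<ominus> i) \<otimes> t = (\<Oplus>k\<in>F. c k \<otimes> x k)"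
  shows "\<one> \<in> I"
  using assms(3-)
proof (induction F arbitrary: i rule: finite_induct)
  interpret I: additive_subgroup I R by fact
  \<comment> \<open>Without generators the hypothesis at 1 reads 1 - \<open>i\<close> = 0, so 1 =
    \<open>i\<close> lies in \<open>I\<close>.\<close>
  case empty
  from empty(3)[of \<one>] empty(2) have "\<one> \<ominus> i = \<zero>" by simp
  hence "\<one> = i" using I.a_Hcarr[OF empty(2)] by simp
  thus ?case using empty(2) by simp
next
  interpret I: additive_subgroup I R by fact
  case (insert l F)
  have Ic: "a \<in> carrier R" if "a \<in> I" for a using that by (rule I.a_Hcarr)
  have xl: "x l \<in> carrier R" and xF: "x \<in> F \<rightarrow> carrier R" using insert by auto
  have split: "\<exists>b \<in> I. \<exists>d \<in> F \<rightarrow> I. (\<one> \<ominus> i) \<otimes> t = b \<otimes> x l \<oplus> (\<Oplus>k\<in>F. d k \<otimes> x k)"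
    if "t \<in> carrier R" for t
  proof -
    from insert.prems(3)[OF that] obtain c
      where c: "c \<in> insert l F \<rightarrow> I" "(\<one> \<ominus> i) \<otimes> t = (\<Oplus>k\<in>insert l F. c k \<otimes> x k)" by blast
    have "(\<Oplus>k\<in>insert l F. c k \<otimes> x k) = c l \<otimes> x l \<oplus> (\<Oplus>k\<in>F. c k \<otimes> x k)"
      by (rule finsum_insert) (use insert.hyps Pi_mem[OF c(1)] Pi_mem[OF insert.prems(1)] Ic in auto)
    thus ?thesis using c by (intro bexI[of _ "c l"] bexI[of _ c]) auto
  qed
  from split[OF xl] obtain a c where a: "a \<in> I" and c: "c \<in> F \<rightarrow> I"
    and eq: "(\<one> \<ominus> i) \<otimes> x l = a \<otimes> x l \<oplus> (\<Oplus>k\<in>F. c k \<otimes> x k)" by blast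
  have carr: "i \<in> carrier R" "a \<in> carrier R" using insert a Ic by auto
  have sumc: "(\<Oplus>k\<in>F. d k \<otimes> x k) \<in> carrier R" if "d \<in> F \<rightarrow> I" for d
    by (rule finsum_closed) (use Pi_mem[OF that] Pi_mem[OF xF] Ic in auto)
  \<comment> \<open>Collecting the \<open>x l\<close> terms of \<open>eq\<close> on the left gives
    them the coefficient 1 - \<open>?r\<close>. The index \<open>?i\<close> for the smaller
    generating set is chosen so that 1 - \<open>?i\<close> is the product of 1 - \<open>?r\<close>
    and 1 - \<open>i\<close>.\<close>
  let ?r = "i \<oplus> a"
  let ?i = "i \<oplus> (?r \<ominus> i \<otimes> ?r)"
  have r: "?r \<in> I" using a insert I.a_closed by blast
  have elim: "(\<one> \<ominus> ?r) \<otimes> x l = (\<Oplus>k\<in>F. c k \<otimes> x k)"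
  proof -
    have "(\<one> \<ominus> ?r) \<otimes> x l = (\<one> \<ominus> i) \<otimes> x l \<ominus> a \<otimes> x l"
      using carr xl by algebra
    also have "\<dots> = (\<Oplus>k\<in>F. c k \<otimes> x k)"
    proof -
      have "a \<otimes> x l \<oplus> w \<ominus> a \<otimes> x l = w" if "w \<in> carrier R" for w
        using carr xl that by algebra
      thus ?thesis unfolding eq using sumc[OF c] by blast
    qed
    finally show ?thesis .
  qed
  show ?case
  proof (rule insert.IH[OF xF])
    show "?i \<in> I" using r insert.prems a mult I.a_closed I.a_inv_closed by (simp add: minus_eq)
    fix t assume t: "t \<in> carrier R"
    obtain b d where b: "b \<in> I" and d: "d \<in> F \<rightarrow> I"
      and eqt: "(\<one> \<ominus> i) \<otimes> t = b \<otimes> x l \<oplus> (\<Oplus>k\<in>F. d k \<otimes> x k)" using split[OF t] by blast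
    let ?c = "\<lambda>k. b \<otimes> c k \<oplus> (\<one> \<ominus> ?r) \<otimes> d k"
    have bc: "b \<in> carrier R" using b Ic by simp
    have "(\<one> \<ominus> ?i) \<otimes> t = (\<one> \<ominus> ?r) \<otimes> ((\<one> \<ominus> i) \<otimes> t)"
      using carr t by algebra
    also have "\<dots> = b \<otimes> ((\<one> \<ominus> ?r) \<otimes> x l) \<oplus> (\<one> \<ominus> ?r) \<otimes> (\<Oplus>k\<in>F. d k \<otimes> x k)"
    proof -
      have "(\<one> \<ominus> ?r) \<otimes> (b \<otimes> x l \<oplus> w) = b \<otimes> ((\<one> \<ominus> ?r) \<otimes> x l) \<oplus> (\<one> \<ominus> ?r) \<otimes> w"
        if "w \<in> carrier R" for w
        using carr bc xl that by algebra
      thus ?thesis unfolding eqt using sumc[OF d] by blast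
    qed
    also have "\<dots> = (\<Oplus>k\<in>F. b \<otimes> (c k \<otimes> x k)) \<oplus> (\<Oplus>k\<in>F. (\<one> \<ominus> ?r) \<otimes> (d k \<otimes> x k))"
      unfolding elim
      by (intro arg_cong2[of _ _ _ _ "add R"] finsum_rdistr) (use insert.hyps bc carr Pi_mem[OF c] Pi_mem[OF d] Pi_mem[OF xF] Ic in auto)
    also have "\<dots> = (\<Oplus>k\<in>F. b \<otimes> (c k \<otimes> x k) \<oplus> (\<one> \<ominus> ?r) \<otimes> (d k \<otimes> x k))"
      by (rule finsum_addf[symmetric]) (use bc carr Pi_mem[OF c] Pi_mem[OF d] Pi_mem[OF xF] Ic in auto)
    also have "\<dots> = (\<Oplus>k\<in>F. ?c k \<otimes> x k)"
    proof (rule finsum_cong')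
      fix k assume k: "k \<in> F"
      hence "c k \<in> carrier R" "d k \<in> carrier R" "x k \<in> carrier R"
        using Pi_mem[OF c] Pi_mem[OF d] Pi_mem[OF xF] Ic by auto
      thus "b \<otimes> (c k \<otimes> x k) \<oplus> (\<one> \<ominus> ?r) \<otimes> (d k \<otimes> x k) = ?c k \<otimes> x k"
        using bc carr by algebra
    qed (use bc carr Pi_mem[OF c] Pi_mem[OF d] Pi_mem[OF xF] Ic in auto)
    finally have "(\<one> \<ominus> ?i) \<otimes> t = (\<Oplus>k\<in>F. ?c k \<otimes> x k)" .
    moreover have "?c k \<in> I" if "k \<in> F" for k
    proof -
      have ck: "c k \<in> I" "d k \<in> I" using Pi_mem[OF c] Pi_mem[OF d] that by auto
      \<comment> \<open>\<open>I\<close> is only closed under its own products, so the factor 1 -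
        \<open>?r\<close> is expanded until every product has both factors in
        \<open>I\<close>.\<close>
      have "?c k = b \<otimes> c k \<oplus> (d k \<ominus> ?r \<otimes> d k)" using Ic[OF ck(1)] Ic[OF ck(2)] bc carr by algebra
      thus ?thesis using ck b r mult I.a_closed I.a_inv_closed by (simp add: minus_eq)
    qed
    ultimately show "\<exists>c\<in>F \<rightarrow> I. (\<one> \<ominus> ?i) \<otimes> t = (\<Oplus>k\<in>F. c k \<otimes> x k)"
      by (intro bexI[of _ ?c]) auto
  qed
qed

section \<open>Global actions and traces\<close>

text \<open>Bijectivity of the maps follows from the action laws, see \<open>act_inv\<close>. The
  locale serves both for \<open>G\<close> on \<open>T\<close> and for the quotient group on the ring
  of \<open>H\<close>-fixed elements.\<close>

locale global_action = G: group G + T: cring T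
  for G :: "('g, 'c) monoid_scheme" and T :: "('t, 'e) ring_scheme" +
  fixes b :: "'g \<Rightarrow> 't \<Rightarrow> 't"
  assumes hom: "g \<in> carrier G \<Longrightarrow> b g \<in> ring_hom T T"
    and act_one: "t \<in> carrier T \<Longrightarrow> b \<one>\<^bsub>G\<^esub> t = t"
    and act_act: "\<lbrakk>g \<in> carrier G; k \<in> carrier G; t \<in> carrier T\<rbrakk> \<Longrightarrow> b g (b k t) = b (g \<otimes>\<^bsub>G\<^esub> k) t"

text \<open>The unit is preserved because \<open>a g\<close> is surjective: the image of 1 acts as
  an identity on the image of \<open>a g\<close>, which is the whole ring.\<close>

lemma (in partial_action) global_actionI:
  assumes "\<And>g. g \<in> carrier G \<Longrightarrow> D g = carrier R"
  shows "global_action G R a"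
proof
  fix g assume g: "g \<in> carrier G"
  have bij: "bij_betw (a g) (carrier R) (carrier R)" using P1_bij[OF g] assms g by simp
  hence c: "a g x \<in> carrier R" if "x \<in> carrier R" for x using that bij_betwE by fast
  have m: "a g (x \<otimes>\<^bsub>R\<^esub> y) = a g x \<otimes>\<^bsub>R\<^esub> a g y" if "x \<in> carrier R" "y \<in> carrier R" for x y
    using P1_mult[OF g] that assms g by simp
  have "a g \<one>\<^bsub>R\<^esub> \<otimes>\<^bsub>R\<^esub> y = y" if "y \<in> carrier R" for y
    using bij that m[of "\<one>\<^bsub>R\<^esub>"] by (metis R.l_one R.one_closed bij_betw_imp_surj_on imageE)
  from this[of "\<one>\<^bsub>R\<^esub>"] have "a g \<one>\<^bsub>R\<^esub> = \<one>\<^bsub>R\<^esub>" using c by simp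
  thus "a g \<in> ring_hom R R"
    using c m P1_add[OF g] assms g by (intro ring_hom_memI) auto
qed (use P2_id P4 assms in auto)

context global_action
begin

lemma hom_cring: "g \<in> carrier G \<Longrightarrow> ring_hom_cring T T (b g)"
  using hom by (intro ring_hom_cring.intro ring_hom_cring_axioms.intro T.cring_axioms)

lemma act_closed [simp]: "g \<in> carrier G \<Longrightarrow> t \<in> carrier T \<Longrightarrow> b g t \<in> carrier T"
  by (rule ring_hom_closed[OF hom])

lemma act_add: "\<lbrakk>g \<in> carrier G; s \<in> carrier T; t \<in> carrier T\<rbrakk> \<Longrightarrow> b g (s \<oplus>\<^bsub>T\<^esub> t) = b g s \<oplus>\<^bsub>T\<^esub> b g t"
  by (rule ring_hom_add[OF hom])

lemma act_mult: "\<lbrakk>g \<in> carrier G; s \<in> carrier T; t \<in> carrier T\<rbrakk> \<Longrightarrow> b g (s \<otimes>\<^bsub>T\<^esub> t) = b g s \<otimes>\<^bsub>T\<^esub> b g t"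
  by (rule ring_hom_mult[OF hom])

lemma act_unit [simp]: "g \<in> carrier G \<Longrightarrow> b g \<one>\<^bsub>T\<^esub> = \<one>\<^bsub>T\<^esub>"
  by (rule ring_hom_one[OF hom])

lemma act_zero [simp]: "g \<in> carrier G \<Longrightarrow> b g \<zero>\<^bsub>T\<^esub> = \<zero>\<^bsub>T\<^esub>"
  by (rule ring_hom_cring.hom_zero[OF hom_cring])

lemma act_a_inv: "\<lbrakk>g \<in> carrier G; t \<in> carrier T\<rbrakk> \<Longrightarrow> b g (\<ominus>\<^bsub>T\<^esub> t) = \<ominus>\<^bsub>T\<^esub> b g t"
  by (rule ring_hom_cring.hom_a_inv[OF hom_cring])

lemma act_finsum:
  "\<lbrakk>g \<in> carrier G; f \<in> A \<rightarrow> carrier T\<rbrakk> \<Longrightarrow> b g (\<Oplus>\<^bsub>T\<^esub>i\<in>A. f i) = (\<Oplus>\<^bsub>T\<^esub>i\<in>A. b g (f i))"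
  using ring_hom_cring.hom_finsum[OF hom_cring] by (simp add: comp_def)

lemma act_inv [simp]:
  assumes "g \<in> carrier G" "t \<in> carrier T"
  shows "b g (b (inv\<^bsub>G\<^esub> g) t) = t" and "b (inv\<^bsub>G\<^esub> g) (b g t) = t"
  using assms by (simp_all add: act_act act_one)

section \<open>Fixed elements, traces and Galois coordinates\<close>

definition fixed :: "'g set \<Rightarrow> 't set" where
  "fixed H = {t \<in> carrier T. \<forall>k \<in> H. b k t = t}"

definition trace :: "'g set \<Rightarrow> 't \<Rightarrow> 't" where
  "trace H t = (\<Oplus>\<^bsub>T\<^esub>k\<in>H. b k t)"

text \<open>For a finite subgroup \<open>H\<close> these are Galois coordinates of \<open>T\<close>
  over the ring fixed by \<open>H\<close>. The index set is arbitrary because the lifted system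
  below is indexed by pairs.\<close>

definition galois_system :: "'g set \<Rightarrow> 'i set \<Rightarrow> ('i \<Rightarrow> 't) \<Rightarrow> ('i \<Rightarrow> 't) \<Rightarrow> bool" where
  "galois_system H I x y \<longleftrightarrow> finite I \<and> x \<in> I \<rightarrow> carrier T \<and> y \<in> I \<rightarrow> carrier T \<and>
     (\<forall>g \<in> H. (\<Oplus>\<^bsub>T\<^esub>i\<in>I. x i \<otimes>\<^bsub>T\<^esub> b g (y i)) = (if g = \<one>\<^bsub>G\<^esub> then \<one>\<^bsub>T\<^esub> else \<zero>\<^bsub>T\<^esub>))"

lemma fixed_closed: "t \<in> fixed H \<Longrightarrow> t \<in> carrier T"
  by (simp add: fixed_def)

lemma fixed_act: "t \<in> fixed H \<Longrightarrow> k \<in> H \<Longrightarrow> b k t = t"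
  by (simp add: fixed_def)

lemma fixed_subring: "H \<subseteq> carrier G \<Longrightarrow> subring (fixed H) T"
  by (rule T.subringI) (auto simp: fixed_def act_add act_mult act_a_inv subset_iff)

lemma fixed_cring: "H \<subseteq> carrier G \<Longrightarrow> cring (T\<lparr>carrier := fixed H\<rparr>)"
  using T.subcring_iff[OF subringE(1)] T.subcringI' fixed_subring by blast

context
  fixes H
  assumes H: "subgroup H G" and fin: "finite H"
begin

lemma Hc: "k \<in> H \<Longrightarrow> k \<in> carrier G"
  using H subgroup.mem_carrier by fast

text \<open>Left multiplication by an element of \<open>H\<close> permutes the summands.\<close>

lemma trace_fixed: "t \<in> carrier T \<Longrightarrow> trace H t \<in> fixed H"
proof -
  assume t: "t \<in> carrier T"
  have "b g (trace H t) = trace H t" if g: "g \<in> H" for g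
  proof -
    have inj: "inj_on ((\<otimes>\<^bsub>G\<^esub>) g) H" using g Hc by (auto intro: inj_onI)
    have im: "(\<otimes>\<^bsub>G\<^esub>) g ` H = H"
    proof (intro equalityI subsetI)
      fix k assume k: "k \<in> H"
      have "k = g \<otimes>\<^bsub>G\<^esub> (inv\<^bsub>G\<^esub> g \<otimes>\<^bsub>G\<^esub> k)" using g k Hc by (simp add: G.m_assoc[symmetric])
      thus "k \<in> (\<otimes>\<^bsub>G\<^esub>) g ` H"
        using g k H subgroup.m_closed subgroup.m_inv_closed by fastforce
    qed (use g H subgroup.m_closed in fast)
    have "b g (trace H t) = (\<Oplus>\<^bsub>T\<^esub>k\<in>H. b g (b k t))"
      unfolding trace_def using g t Hc by (intro act_finsum) auto
    also have "\<dots> = (\<Oplus>\<^bsub>T\<^esub>k\<in>H. b (g \<otimes>\<^bsub>G\<^esub> k) t)"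
      by (rule T.finsum_cong') (use g t Hc act_act in auto)
    also have "\<dots> = (\<Oplus>\<^bsub>T\<^esub>k\<in>(\<otimes>\<^bsub>G\<^esub>) g ` H. b k t)"
      by (rule T.finsum_reindex[symmetric]) (use inj g t Hc in auto)
    finally show ?thesis unfolding im trace_def .
  qed
  thus ?thesis using t Hc by (auto simp: fixed_def trace_def intro!: T.finsum_closed)
qed

lemma trace_closed [simp]: "t \<in> carrier T \<Longrightarrow> trace H t \<in> carrier T"
  using trace_fixed fixed_closed by blast

lemma trace_add: "s \<in> carrier T \<Longrightarrow> t \<in> carrier T \<Longrightarrow> trace H (s \<oplus>\<^bsub>T\<^esub> t) = trace H s \<oplus>\<^bsub>T\<^esub> trace H t"
  unfolding trace_def
  by (rule trans[OF T.finsum_cong' T.finsum_addf]) (auto simp: Hc act_add)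

text \<open>This linearity makes the traces an ideal of the fixed ring, though in general not of
  \<open>T\<close>.\<close>

lemma trace_mult:
  assumes "s \<in> fixed H" "t \<in> carrier T"
  shows "trace H (s \<otimes>\<^bsub>T\<^esub> t) = s \<otimes>\<^bsub>T\<^esub> trace H t"
proof -
  have s: "s \<in> carrier T" using assms fixed_closed by blast
  have "s \<otimes>\<^bsub>T\<^esub> trace H t = (\<Oplus>\<^bsub>T\<^esub>k\<in>H. s \<otimes>\<^bsub>T\<^esub> b k t)"
    unfolding trace_def using assms(2) s fin Hc by (intro T.finsum_rdistr) auto
  also have "\<dots> = trace H (s \<otimes>\<^bsub>T\<^esub> t)"
    unfolding trace_def by (rule T.finsum_cong') (use assms s Hc in \<open>auto simp: act_mult fixed_act\<close>)
  finally show ?thesis ..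
qed

lemma trace_additive_subgroup: "additive_subgroup (trace H ` carrier T) T"
proof (intro additive_subgroup.intro T.add.subgroupI)
  fix a assume "a \<in> trace H ` carrier T"
  then obtain t where t: "t \<in> carrier T" "a = trace H t" by blast
  have "trace H \<zero>\<^bsub>T\<^esub> = \<zero>\<^bsub>T\<^esub>"
    unfolding trace_def by (rule T.add.finprod_one_eqI) (simp add: Hc)
  hence "trace H (\<ominus>\<^bsub>T\<^esub> t) \<oplus>\<^bsub>T\<^esub> trace H t = \<zero>\<^bsub>T\<^esub>"
    using trace_add[of "\<ominus>\<^bsub>T\<^esub> t" t] t by (simp add: T.l_neg)
  hence "\<ominus>\<^bsub>T\<^esub> a = trace H (\<ominus>\<^bsub>T\<^esub> t)" using t by (intro T.minus_equality) auto
  thus "\<ominus>\<^bsub>T\<^esub> a \<in> trace H ` carrier T" using t by blast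
next
  fix a c assume "a \<in> trace H ` carrier T" "c \<in> trace H ` carrier T"
  then obtain s t where "s \<in> carrier T" "t \<in> carrier T" "a = trace H s" "c = trace H t" by blast
  thus "a \<oplus>\<^bsub>T\<^esub> c \<in> trace H ` carrier T" using trace_add by (intro image_eqI[of _ _ "s \<oplus>\<^bsub>T\<^esub> t"]) auto
qed auto

text \<open>The system gives \<open>t = \<Sum> x\<^sub>i trace (y\<^sub>i t)\<close> for all \<open>t\<close>, so Nakayama's lemma
  applies to the ideal of traces.\<close>

lemma galois_system_trace_one:
  assumes "galois_system H I x y"
  shows "\<exists>c \<in> carrier T. trace H c = \<one>\<^bsub>T\<^esub>"
proof -
  have I: "finite I" and x: "\<And>i. i \<in> I \<Longrightarrow> x i \<in> carrier T" and y: "\<And>i. i \<in> I \<Longrightarrow> y i \<in> carrier T"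
    and gal: "\<And>g. g \<in> H \<Longrightarrow> (\<Oplus>\<^bsub>T\<^esub>i\<in>I. x i \<otimes>\<^bsub>T\<^esub> b g (y i)) = (if g = \<one>\<^bsub>G\<^esub> then \<one>\<^bsub>T\<^esub> else \<zero>\<^bsub>T\<^esub>)"
    using assms unfolding galois_system_def by auto
  have one: "\<one>\<^bsub>G\<^esub> \<in> H" using H subgroup.one_closed by blast
  have expand: "t = (\<Oplus>\<^bsub>T\<^esub>i\<in>I. trace H (y i \<otimes>\<^bsub>T\<^esub> t) \<otimes>\<^bsub>T\<^esub> x i)" if t: "t \<in> carrier T" for t
  proof -
    have "(\<Oplus>\<^bsub>T\<^esub>i\<in>I. trace H (y i \<otimes>\<^bsub>T\<^esub> t) \<otimes>\<^bsub>T\<^esub> x i)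
        = (\<Oplus>\<^bsub>T\<^esub>i\<in>I. \<Oplus>\<^bsub>T\<^esub>k\<in>H. (x i \<otimes>\<^bsub>T\<^esub> b k (y i)) \<otimes>\<^bsub>T\<^esub> b k t)"
    proof (rule T.finsum_cong')
      fix i assume i: "i \<in> I"
      have "trace H (y i \<otimes>\<^bsub>T\<^esub> t) \<otimes>\<^bsub>T\<^esub> x i = (\<Oplus>\<^bsub>T\<^esub>k\<in>H. b k (y i \<otimes>\<^bsub>T\<^esub> t) \<otimes>\<^bsub>T\<^esub> x i)"
        unfolding trace_def by (rule T.finsum_ldistr) (use i x y t fin Hc in auto)
      also have "\<dots> = (\<Oplus>\<^bsub>T\<^esub>k\<in>H. (x i \<otimes>\<^bsub>T\<^esub> b k (y i)) \<otimes>\<^bsub>T\<^esub> b k t)"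
        by (rule T.finsum_cong') (use i x y t Hc in \<open>auto simp: act_mult T.m_ac\<close>)
      finally show "trace H (y i \<otimes>\<^bsub>T\<^esub> t) \<otimes>\<^bsub>T\<^esub> x i = (\<Oplus>\<^bsub>T\<^esub>k\<in>H. (x i \<otimes>\<^bsub>T\<^esub> b k (y i)) \<otimes>\<^bsub>T\<^esub> b k t)" .
    qed (use x y t Hc in \<open>auto intro!: T.finsum_closed\<close>)
    \<comment> \<open>After the exchange the inner sum contains the Galois sum for \<open>k\<close>,
      so only \<open>k\<close> = 1 contributes.\<close>
    also have "\<dots> = (\<Oplus>\<^bsub>T\<^esub>k\<in>H. \<Oplus>\<^bsub>T\<^esub>i\<in>I. (x i \<otimes>\<^bsub>T\<^esub> b k (y i)) \<otimes>\<^bsub>T\<^esub> b k t)"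
      by (rule T.finsum_swap) (use I fin x y t Hc in auto)
    also have "\<dots> = (\<Oplus>\<^bsub>T\<^esub>k\<in>H. if k = \<one>\<^bsub>G\<^esub> then t else \<zero>\<^bsub>T\<^esub>)"
    proof (rule T.finsum_cong')
      fix k assume k: "k \<in> H"
      have "(\<Oplus>\<^bsub>T\<^esub>i\<in>I. (x i \<otimes>\<^bsub>T\<^esub> b k (y i)) \<otimes>\<^bsub>T\<^esub> b k t) = (\<Oplus>\<^bsub>T\<^esub>i\<in>I. x i \<otimes>\<^bsub>T\<^esub> b k (y i)) \<otimes>\<^bsub>T\<^esub> b k t"
        by (rule T.finsum_ldistr[symmetric]) (use I x y t k Hc in auto)
      thus "(\<Oplus>\<^bsub>T\<^esub>i\<in>I. (x i \<otimes>\<^bsub>T\<^esub> b k (y i)) \<otimes>\<^bsub>T\<^esub> b k t) = (if k = \<one>\<^bsub>G\<^esub> then t else \<zero>\<^bsub>T\<^esub>)"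
        using gal[OF k] k t Hc by (simp add: act_one)
    qed (use t in auto)
    also have "\<dots> = t"
      using T.add.finprod_singleton_swap[OF one fin, of "\<lambda>_. t"] t by simp
    finally show ?thesis ..
  qed
  have "\<one>\<^bsub>T\<^esub> \<in> trace H ` carrier T"
  \<comment> \<open>With zero in place of the lemma's \<open>i\<close>, its expansion hypothesis is
    \<open>expand\<close>. A product of two traces is a trace because the first factor is
    fixed.\<close>
  proof (rule T.nakayama[OF trace_additive_subgroup _ I, of x "\<zero>\<^bsub>T\<^esub>"])
    fix a c assume "a \<in> trace H ` carrier T" "c \<in> trace H ` carrier T"
    then obtain s t where "s \<in> carrier T" "t \<in> carrier T" "a = trace H s" "c = trace H t" by blast
    thus "a \<otimes>\<^bsub>T\<^esub> c \<in> trace H ` carrier T"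
      using trace_mult[OF trace_fixed] by (intro image_eqI[of _ _ "trace H s \<otimes>\<^bsub>T\<^esub> t"]) auto
  next
    fix t assume t: "t \<in> carrier T"
    show "\<exists>c \<in> I \<rightarrow> trace H ` carrier T. (\<one>\<^bsub>T\<^esub> \<ominus>\<^bsub>T\<^esub> \<zero>\<^bsub>T\<^esub>) \<otimes>\<^bsub>T\<^esub> t = (\<Oplus>\<^bsub>T\<^esub>k\<in>I. c k \<otimes>\<^bsub>T\<^esub> x k)"
      using expand[OF t] t y
      by (intro bexI[of _ "\<lambda>i. trace H (y i \<otimes>\<^bsub>T\<^esub> t)"]) (auto simp: T.minus_eq)
  qed (use x trace_additive_subgroup additive_subgroup.zero_closed in auto)
  thus ?thesis by force
qed

text \<open>Multiplying the \<open>x\<^sub>i\<close> by an element of trace one before taking traces makes the diagonal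
  sum equal to \<open>1\<close>.\<close>

lemma galois_system_fixed:
  assumes "galois_system (carrier G) I x y"
  shows "\<exists>x' y'. x' \<in> I \<rightarrow> fixed H \<and> y' \<in> I \<rightarrow> fixed H \<and>
     (\<forall>g \<in> carrier G. (\<Oplus>\<^bsub>T\<^esub>i\<in>I. x' i \<otimes>\<^bsub>T\<^esub> b g (y' i)) = (if g \<in> H then \<one>\<^bsub>T\<^esub> else \<zero>\<^bsub>T\<^esub>))"
proof -
  have I: "finite I" and x: "\<And>i. i \<in> I \<Longrightarrow> x i \<in> carrier T" and y: "\<And>i. i \<in> I \<Longrightarrow> y i \<in> carrier T"
    and gal: "\<And>g. g \<in> carrier G \<Longrightarrow>
      (\<Oplus>\<^bsub>T\<^esub>i\<in>I. x i \<otimes>\<^bsub>T\<^esub> b g (y i)) = (if g = \<one>\<^bsub>G\<^esub> then \<one>\<^bsub>T\<^esub> else \<zero>\<^bsub>T\<^esub>)"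
    using assms unfolding galois_system_def by auto
  \<comment> \<open>A system for the whole group restricts to \<open>H\<close>, which supplies the
    element of trace one.\<close>
  have "galois_system H I x y"
    using assms Hc unfolding galois_system_def by auto
  then obtain c where c: "c \<in> carrier T" "trace H c = \<one>\<^bsub>T\<^esub>" using galois_system_trace_one by blast
  let ?x = "\<lambda>i. trace H (c \<otimes>\<^bsub>T\<^esub> x i)" and ?y = "\<lambda>i. trace H (y i)"
  have "(\<Oplus>\<^bsub>T\<^esub>i\<in>I. ?x i \<otimes>\<^bsub>T\<^esub> b g (?y i)) = (if g \<in> H then \<one>\<^bsub>T\<^esub> else \<zero>\<^bsub>T\<^esub>)" if g: "g \<in> carrier G" for g
  proof -
    \<comment> \<open>This is the general term of the expanded product, with the action of
      \<open>l\<close> pulled out so that a Galois sum of the original system appears under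
      \<open>b l\<close>.\<close>
    let ?f = "\<lambda>i l k. b l c \<otimes>\<^bsub>T\<^esub> b l (x i \<otimes>\<^bsub>T\<^esub> b (inv\<^bsub>G\<^esub> l \<otimes>\<^bsub>G\<^esub> (g \<otimes>\<^bsub>G\<^esub> k)) (y i))"
    have fc: "?f i l k \<in> carrier T" if "i \<in> I" "l \<in> H" "k \<in> H" for i l k
      using that c g x y Hc by simp
    have yy: "b g (?y i) = (\<Oplus>\<^bsub>T\<^esub>k\<in>H. b (g \<otimes>\<^bsub>G\<^esub> k) (y i))" if "i \<in> I" for i
      unfolding trace_def using that g y Hc
      by (subst act_finsum) (auto intro!: T.finsum_cong' simp: act_act)
    have one: "?x i \<otimes>\<^bsub>T\<^esub> b g (?y i) = (\<Oplus>\<^bsub>T\<^esub>l\<in>H. \<Oplus>\<^bsub>T\<^esub>k\<in>H. ?f i l k)" if i: "i \<in> I" for i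
    proof -
      have Y: "b g (?y i) \<in> carrier T" using g y i by simp
      have "?x i \<otimes>\<^bsub>T\<^esub> b g (?y i) = (\<Oplus>\<^bsub>T\<^esub>l\<in>H. b l (c \<otimes>\<^bsub>T\<^esub> x i) \<otimes>\<^bsub>T\<^esub> b g (?y i))"
        unfolding trace_def[of _ "c \<otimes>\<^bsub>T\<^esub> x i"]
        by (rule T.finsum_ldistr) (use i c x Y fin Hc in auto)
      also have "\<dots> = (\<Oplus>\<^bsub>T\<^esub>l\<in>H. \<Oplus>\<^bsub>T\<^esub>k\<in>H. ?f i l k)"
      proof (rule T.finsum_cong')
        fix l assume l: "l \<in> H"
        have "b l (c \<otimes>\<^bsub>T\<^esub> x i) \<otimes>\<^bsub>T\<^esub> b g (?y i)
            = (\<Oplus>\<^bsub>T\<^esub>k\<in>H. b l (c \<otimes>\<^bsub>T\<^esub> x i) \<otimes>\<^bsub>T\<^esub> b (g \<otimes>\<^bsub>G\<^esub> k) (y i))"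
          unfolding yy[OF i] by (rule T.finsum_rdistr) (use i l g c x y fin Hc in auto)
        also have "\<dots> = (\<Oplus>\<^bsub>T\<^esub>k\<in>H. ?f i l k)"
        proof (rule T.finsum_cong')
          fix k assume k: "k \<in> H"
          have "l \<otimes>\<^bsub>G\<^esub> (inv\<^bsub>G\<^esub> l \<otimes>\<^bsub>G\<^esub> (g \<otimes>\<^bsub>G\<^esub> k)) = g \<otimes>\<^bsub>G\<^esub> k"
            using l k g Hc by (simp add: G.m_assoc[symmetric])
          thus "b l (c \<otimes>\<^bsub>T\<^esub> x i) \<otimes>\<^bsub>T\<^esub> b (g \<otimes>\<^bsub>G\<^esub> k) (y i) = ?f i l k"
            using i l k g c x y Hc by (simp add: act_mult act_act T.m_assoc)
        qed (use i l fc in auto)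
        finally show "b l (c \<otimes>\<^bsub>T\<^esub> x i) \<otimes>\<^bsub>T\<^esub> b g (?y i) = (\<Oplus>\<^bsub>T\<^esub>k\<in>H. ?f i l k)" .
      qed (use i fc in \<open>auto intro!: T.finsum_closed\<close>)
      finally show ?thesis .
    qed
    have two: "(\<Oplus>\<^bsub>T\<^esub>i\<in>I. \<Oplus>\<^bsub>T\<^esub>k\<in>H. ?f i l k) = (if g \<in> H then b l c else \<zero>\<^bsub>T\<^esub>)" if l: "l \<in> H" for l
    proof -
      have "(\<Oplus>\<^bsub>T\<^esub>i\<in>I. \<Oplus>\<^bsub>T\<^esub>k\<in>H. ?f i l k) = (\<Oplus>\<^bsub>T\<^esub>k\<in>H. \<Oplus>\<^bsub>T\<^esub>i\<in>I. ?f i l k)"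
        by (rule T.finsum_swap) (use I fin l fc in auto)
      also have "\<dots> = (\<Oplus>\<^bsub>T\<^esub>k\<in>H. if inv\<^bsub>G\<^esub> g \<otimes>\<^bsub>G\<^esub> l = k then b l c else \<zero>\<^bsub>T\<^esub>)"
      \<comment> \<open>The Galois sum at \<open>?m\<close> vanishes unless \<open>?m\<close> = 1,
        which determines \<open>k\<close> from \<open>g\<close> and \<open>l\<close>.\<close>
      proof (rule T.finsum_cong')
        fix k assume k: "k \<in> H"
        let ?m = "inv\<^bsub>G\<^esub> l \<otimes>\<^bsub>G\<^esub> (g \<otimes>\<^bsub>G\<^esub> k)"
        have m: "?m \<in> carrier G" using g k l Hc by simp
        have iff: "?m = \<one>\<^bsub>G\<^esub> \<longleftrightarrow> inv\<^bsub>G\<^esub> g \<otimes>\<^bsub>G\<^esub> l = k"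
          using g k l Hc by (metis G.inv_closed G.inv_solve_left G.m_closed G.r_one G.one_closed)
        have "(\<Oplus>\<^bsub>T\<^esub>i\<in>I. ?f i l k) = b l c \<otimes>\<^bsub>T\<^esub> (\<Oplus>\<^bsub>T\<^esub>i\<in>I. b l (x i \<otimes>\<^bsub>T\<^esub> b ?m (y i)))"
          by (rule T.finsum_rdistr[symmetric]) (use I l m c x y Hc in auto)
        also have "(\<Oplus>\<^bsub>T\<^esub>i\<in>I. b l (x i \<otimes>\<^bsub>T\<^esub> b ?m (y i))) = b l (\<Oplus>\<^bsub>T\<^esub>i\<in>I. x i \<otimes>\<^bsub>T\<^esub> b ?m (y i))"
          by (rule act_finsum[symmetric]) (use l m x y Hc in auto)
        also have "b l c \<otimes>\<^bsub>T\<^esub> \<dots> = (if inv\<^bsub>G\<^esub> g \<otimes>\<^bsub>G\<^esub> l = k then b l c else \<zero>\<^bsub>T\<^esub>)"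
          unfolding gal[OF m] iff using l c Hc by simp
        finally show "(\<Oplus>\<^bsub>T\<^esub>i\<in>I. ?f i l k) = \<dots>" .
      qed (use l c Hc in auto)
      \<comment> \<open>The one value of \<open>k\<close> that contributes lies in \<open>H\<close>
        exactly when \<open>g\<close> does. The terms \<open>b l c\<close> that survive then add up
        to the trace of \<open>c\<close>.\<close>
      also have "\<dots> = (if g \<in> H then b l c else \<zero>\<^bsub>T\<^esub>)"
      proof (cases "g \<in> H")
        case True
        hence "inv\<^bsub>G\<^esub> g \<otimes>\<^bsub>G\<^esub> l \<in> H" using l H by (simp add: subgroup.m_closed subgroup.m_inv_closed)
        thus ?thesis
          using True T.add.finprod_singleton[of "inv\<^bsub>G\<^esub> g \<otimes>\<^bsub>G\<^esub> l" H "\<lambda>_. b l c"] fin l c Hc by simp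
      next
        case False
        have "inv\<^bsub>G\<^esub> g \<otimes>\<^bsub>G\<^esub> l \<notin> H"
        proof
          assume A: "inv\<^bsub>G\<^esub> g \<otimes>\<^bsub>G\<^esub> l \<in> H"
          have "g = l \<otimes>\<^bsub>G\<^esub> inv\<^bsub>G\<^esub> (inv\<^bsub>G\<^esub> g \<otimes>\<^bsub>G\<^esub> l)"
            using g l Hc by (simp add: G.inv_mult_group G.m_assoc[symmetric])
          thus False using A l H False by (metis subgroup.m_closed subgroup.m_inv_closed)
        qed
        hence "(\<Oplus>\<^bsub>T\<^esub>k\<in>H. if inv\<^bsub>G\<^esub> g \<otimes>\<^bsub>G\<^esub> l = k then b l c else \<zero>\<^bsub>T\<^esub>) = \<zero>\<^bsub>T\<^esub>"
          by (intro T.add.finprod_one_eqI) auto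
        thus ?thesis using False by simp
      qed
      finally show ?thesis .
    qed
    have "(\<Oplus>\<^bsub>T\<^esub>i\<in>I. ?x i \<otimes>\<^bsub>T\<^esub> b g (?y i)) = (\<Oplus>\<^bsub>T\<^esub>i\<in>I. \<Oplus>\<^bsub>T\<^esub>l\<in>H. \<Oplus>\<^bsub>T\<^esub>k\<in>H. ?f i l k)"
      by (rule T.finsum_cong') (use one fc in \<open>auto intro!: T.finsum_closed\<close>)
    also have "\<dots> = (\<Oplus>\<^bsub>T\<^esub>l\<in>H. \<Oplus>\<^bsub>T\<^esub>i\<in>I. \<Oplus>\<^bsub>T\<^esub>k\<in>H. ?f i l k)"
      by (rule T.finsum_swap) (use I fin fc in \<open>auto intro!: T.finsum_closed\<close>)
    also have "\<dots> = (\<Oplus>\<^bsub>T\<^esub>l\<in>H. if g \<in> H then b l c else \<zero>\<^bsub>T\<^esub>)"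
      by (rule T.finsum_cong') (use two c Hc in auto)
    also have "\<dots> = (if g \<in> H then \<one>\<^bsub>T\<^esub> else \<zero>\<^bsub>T\<^esub>)"
      using c(2) by (simp add: trace_def)
    finally show ?thesis .
  qed
  thus ?thesis
    using c x y trace_fixed by (intro exI[of _ ?x] exI[of _ ?y]) auto
qed

end

end

section \<open>Restriction of a global action to a unital ideal\<close>

lemma (in unital_partial_action) ideal_one_eqI:
  assumes "g \<in> carrier G" "e \<in> D g" "\<And>x. x \<in> D g \<Longrightarrow> e \<otimes>\<^bsub>R\<^esub> x = x"
  shows "ideal_one R (D g) = e"
  using assms unit_of unit_of_r D_carr R.m_comm unfolding unit_of_def[symmetric] by metis

lemma (in unital_partial_action) invariants_ext_map:
  "invariants G R D a = {s \<in> carrier R. \<forall>g \<in> carrier G. ext_map g s = s \<otimes>\<^bsub>R\<^esub> unit_of g}"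
  by (simp add: invariants_def ext_map_def unit_of_def)

text \<open>An enumeration of \<open>I\<close> turns a system over an arbitrary finite index set
  into one indexed by an initial segment of the positive numbers.\<close>

lemma (in unital_partial_action) galois_ext_map:
  assumes "B = invariants G R D a" "finite I" "x \<in> I \<rightarrow> carrier R" "y \<in> I \<rightarrow> carrier R"
    and "\<And>g. g \<in> carrier G \<Longrightarrow>
      (\<Oplus>\<^bsub>R\<^esub>i\<in>I. x i \<otimes>\<^bsub>R\<^esub> ext_map g (y i)) = (if g = \<one>\<^bsub>G\<^esub> then \<one>\<^bsub>R\<^esub> else \<zero>\<^bsub>R\<^esub>)"
  shows "partial_galois_extension G R D a B"
proof -
  obtain f where f: "bij_betw f {1..card I} I"
    using ex_bij_betw_nat_finite_1[OF assms(2)] by blast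
  hence fI: "f k \<in> I" if "k \<in> {1..card I}" for k using that bij_betwE by blast
  have "(\<Oplus>\<^bsub>R\<^esub>k\<in>{1..card I}. x (f k) \<otimes>\<^bsub>R\<^esub> ext_map g (y (f k)))
      = (if g = \<one>\<^bsub>G\<^esub> then \<one>\<^bsub>R\<^esub> else \<zero>\<^bsub>R\<^esub>)" if g: "g \<in> carrier G" for g
  proof -
    have "(\<Oplus>\<^bsub>R\<^esub>i\<in>f ` {1..card I}. x i \<otimes>\<^bsub>R\<^esub> ext_map g (y i))
        = (\<Oplus>\<^bsub>R\<^esub>k\<in>{1..card I}. x (f k) \<otimes>\<^bsub>R\<^esub> ext_map g (y (f k)))"
      by (rule R.finsum_reindex)
        (use f fI g Pi_mem[OF assms(3)] Pi_mem[OF assms(4)] in \<open>auto simp: bij_betw_def\<close>)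
    thus ?thesis using assms(5)[OF g] f by (simp add: bij_betw_def)
  qed
  hence "x \<circ> f \<in> {1..card I} \<rightarrow> carrier R \<and> y \<circ> f \<in> {1..card I} \<rightarrow> carrier R \<and>
      (\<forall>g \<in> carrier G. (\<Oplus>\<^bsub>R\<^esub>i\<in>{1..card I}. (x \<circ> f) i \<otimes>\<^bsub>R\<^esub> ext_map g ((y \<circ> f) i))
        = (if g = \<one>\<^bsub>G\<^esub> then \<one>\<^bsub>R\<^esub> else \<zero>\<^bsub>R\<^esub>))"
    using fI assms(3,4) by (auto simp: Pi_iff)
  thus ?thesis
    unfolding partial_galois_extension_def ext_map_def unit_of_def using assms(1) by blast
qed

text \<open>Up to the isomorphism \<open>p\<close> with inverse \<open>q\<close>, the ring \<open>R\<close> is the ideal of \<open>T\<close> generated by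
  the idempotent \<open>p \<one>\<close>, and \<open>q\<close> is the projection of \<open>T\<close> onto it.\<close>

locale ideal_restriction = global_action G T b + R: cring R
  for G :: "('g, 'c) monoid_scheme" and T :: "('t, 'e) ring_scheme" and b :: "'g \<Rightarrow> 't \<Rightarrow> 't"
    and R :: "('r, 'd) ring_scheme" +
  fixes p :: "'r \<Rightarrow> 't" and q :: "'t \<Rightarrow> 'r"
  assumes q_hom: "q \<in> ring_hom T R"
    and p_closed [simp]: "x \<in> carrier R \<Longrightarrow> p x \<in> carrier T"
    and q_p [simp]: "x \<in> carrier R \<Longrightarrow> q (p x) = x"
    and p_q: "t \<in> carrier T \<Longrightarrow> p (q t) = t \<otimes>\<^bsub>T\<^esub> p \<one>\<^bsub>R\<^esub>"
begin

abbreviation e where "e \<equiv> p \<one>\<^bsub>R\<^esub>"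

text \<open>\<open>dom\<close> and \<open>map\<close> have the shape of \<open>induced_dom\<close>
  and \<open>induced_map\<close>, so the later identification with the quotient family is a mere
  unfolding.\<close>

definition dom :: "'g \<Rightarrow> 'r set" where
  "dom g = (\<lambda>s. s \<otimes>\<^bsub>R\<^esub> q (b g e)) ` carrier R"

definition map :: "'g \<Rightarrow> 'r \<Rightarrow> 'r" where
  "map g x = q (b g (p x))"

lemma q_closed [simp]: "t \<in> carrier T \<Longrightarrow> q t \<in> carrier R"
  by (rule ring_hom_closed[OF q_hom])

lemma q_add: "s \<in> carrier T \<Longrightarrow> t \<in> carrier T \<Longrightarrow> q (s \<oplus>\<^bsub>T\<^esub> t) = q s \<oplus>\<^bsub>R\<^esub> q t"
  by (rule ring_hom_add[OF q_hom])

lemma q_mult: "s \<in> carrier T \<Longrightarrow> t \<in> carrier T \<Longrightarrow> q (s \<otimes>\<^bsub>T\<^esub> t) = q s \<otimes>\<^bsub>R\<^esub> q t"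
  by (rule ring_hom_mult[OF q_hom])

lemma q_one [simp]: "q \<one>\<^bsub>T\<^esub> = \<one>\<^bsub>R\<^esub>"
  by (rule ring_hom_one[OF q_hom])

lemma p_e: "x \<in> carrier R \<Longrightarrow> p x \<otimes>\<^bsub>T\<^esub> e = p x"
  using p_q[of "p x"] by simp

text \<open>\<open>p\<close> is not assumed to be a homomorphism. It becomes additive and
  multiplicative because \<open>p_q\<close> recovers any element that absorbs \<open>e\<close> from
  its image under \<open>q\<close>.\<close>

lemma p_add: "x \<in> carrier R \<Longrightarrow> y \<in> carrier R \<Longrightarrow> p (x \<oplus>\<^bsub>R\<^esub> y) = p x \<oplus>\<^bsub>T\<^esub> p y"
  using p_q[of "p x \<oplus>\<^bsub>T\<^esub> p y"] by (simp add: q_add T.l_distr p_e)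

lemma p_mult: "x \<in> carrier R \<Longrightarrow> y \<in> carrier R \<Longrightarrow> p (x \<otimes>\<^bsub>R\<^esub> y) = p x \<otimes>\<^bsub>T\<^esub> p y"
  using p_q[of "p x \<otimes>\<^bsub>T\<^esub> p y"] by (simp add: q_mult T.m_assoc p_e)

lemma e_swap: "s \<in> carrier T \<Longrightarrow> t \<in> carrier T \<Longrightarrow> s \<otimes>\<^bsub>T\<^esub> e \<otimes>\<^bsub>T\<^esub> t = s \<otimes>\<^bsub>T\<^esub> t \<otimes>\<^bsub>T\<^esub> e"
  by (simp add: T.m_ac)

lemma e_idem: "e \<otimes>\<^bsub>T\<^esub> e = e"
  by (rule p_e) simp

lemma be_idem: "g \<in> carrier G \<Longrightarrow> b g e \<otimes>\<^bsub>T\<^esub> b g e = b g e"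
  using act_mult[of g e e] e_idem by simp

text \<open>Membership becomes absorption of the idempotent \<open>b g e\<close>, so that all
  questions about domains are settled by computations in \<open>T\<close>.\<close>

lemma dom_iff:
  assumes g: "g \<in> carrier G"
  shows "x \<in> dom g \<longleftrightarrow> x \<in> carrier R \<and> p x \<otimes>\<^bsub>T\<^esub> b g e = p x"
proof
  assume "x \<in> dom g"
  then obtain s where s: "s \<in> carrier R" "x = s \<otimes>\<^bsub>R\<^esub> q (b g e)" unfolding dom_def by blast
  have "p x = p s \<otimes>\<^bsub>T\<^esub> e \<otimes>\<^bsub>T\<^esub> b g e" using s g by (simp add: p_mult p_q T.m_ac)
  also have "\<dots> = p s \<otimes>\<^bsub>T\<^esub> b g e" using s by (simp add: p_e)
  finally show "x \<in> carrier R \<and> p x \<otimes>\<^bsub>T\<^esub> b g e = p x" using s g by (simp add: T.m_assoc be_idem)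
next
  assume x: "x \<in> carrier R \<and> p x \<otimes>\<^bsub>T\<^esub> b g e = p x"
  hence "x = x \<otimes>\<^bsub>R\<^esub> q (b g e)" using q_mult[of "p x" "b g e"] g by simp
  thus "x \<in> dom g" using x unfolding dom_def by blast
qed

lemma map_closed [simp]: "g \<in> carrier G \<Longrightarrow> x \<in> carrier R \<Longrightarrow> map g x \<in> carrier R"
  by (simp add: map_def)

lemma p_map: "g \<in> carrier G \<Longrightarrow> x \<in> carrier R \<Longrightarrow> p (map g x) = b g (p x) \<otimes>\<^bsub>T\<^esub> e"
  by (simp add: map_def p_q)

lemma act_p_e: "g \<in> carrier G \<Longrightarrow> x \<in> carrier R \<Longrightarrow> b g (p x) \<otimes>\<^bsub>T\<^esub> b g e = b g (p x)"
  using act_mult[of g "p x" e] by (simp add: p_e)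

lemma map_dom: "g \<in> carrier G \<Longrightarrow> x \<in> carrier R \<Longrightarrow> map g x \<in> dom g"
  by (simp add: dom_iff p_map e_swap act_p_e)

text \<open>Passing through \<open>R\<close> between the two steps multiplies by \<open>e\<close>,
  and \<open>b g\<close> turns this factor into \<open>b g e\<close>.\<close>

lemma map_map:
  assumes "g \<in> carrier G" "k \<in> carrier G" "x \<in> dom (inv\<^bsub>G\<^esub> k)"
  shows "map g (map k x) = map (g \<otimes>\<^bsub>G\<^esub> k) x \<otimes>\<^bsub>R\<^esub> q (b g e)"
  using assms by (simp add: dom_iff) (simp add: map_def p_q act_mult act_act q_mult)

text \<open>\<open>b g\<close> carries absorption of \<open>b h e\<close> to absorption of the
  translate of \<open>e\<close> by the product of \<open>g\<close> and \<open>h\<close>.\<close>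

lemma map_dom_inter:
  assumes g: "g \<in> carrier G" and h: "h \<in> carrier G" and x: "x \<in> dom h"
  shows "map g x \<in> dom (g \<otimes>\<^bsub>G\<^esub> h)"
proof -
  have xc: "x \<in> carrier R" and xh: "p x \<otimes>\<^bsub>T\<^esub> b h e = p x" using x h by (auto simp: dom_iff)
  have "b g (p x) \<otimes>\<^bsub>T\<^esub> b (g \<otimes>\<^bsub>G\<^esub> h) e = b g (p x)"
    using act_mult[of g "p x" "b h e"] g h xc xh by (simp add: act_act)
  hence "b g (p x) \<otimes>\<^bsub>T\<^esub> e \<otimes>\<^bsub>T\<^esub> b (g \<otimes>\<^bsub>G\<^esub> h) e = b g (p x) \<otimes>\<^bsub>T\<^esub> e"
    using g h xc by (simp add: e_swap)
  thus ?thesis using g h xc by (simp add: dom_iff p_map)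
qed

lemma map_inv:
  assumes g: "g \<in> carrier G" and x: "x \<in> dom g"
  shows "map g (map (inv\<^bsub>G\<^esub> g) x) = x"
proof -
  have xc: "x \<in> carrier R" and xg: "p x \<otimes>\<^bsub>T\<^esub> b g e = p x" using x g by (auto simp: dom_iff)
  show ?thesis using g x map_map[of g "inv\<^bsub>G\<^esub> g" x] q_mult[of "p x" "b g e"] xc xg
    by (simp add: map_def act_one)
qed

lemma unital_partial_action: "unital_partial_action G R dom map"
proof (intro unital_partial_action.intro unital_partial_action_axioms.intro
    partial_action.intro partial_action_axioms.intro)
  fix g assume g: "g \<in> carrier G"
  have unit: "q (b g e) \<otimes>\<^bsub>R\<^esub> x = x" if "x \<in> dom g" for x
    using that g q_mult[of "p x" "b g e"] by (simp add: dom_iff R.m_comm)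
  have dom_c: "x \<in> carrier R" if "x \<in> dom h" "h \<in> carrier G" for x h
    using that by (simp add: dom_iff)
  show "\<exists>e' \<in> carrier R. dom g = (\<lambda>s. s \<otimes>\<^bsub>R\<^esub> e') ` carrier R \<and> (\<forall>x \<in> dom g. e' \<otimes>\<^bsub>R\<^esub> x = x)"
    using unit g by (intro bexI[of _ "q (b g e)"]) (auto simp: dom_def)
  have "dom g = PIdl\<^bsub>R\<^esub> q (b g e)"
    by (simp add: dom_def cgenideal_def image_def) blast
  thus "ideal (dom g) R" using R.cgenideal_ideal g by simp
  show "bij_betw (map g) (dom (inv\<^bsub>G\<^esub> g)) (dom g)"
    by (rule bij_betw_byWitness[of _ "map (inv\<^bsub>G\<^esub> g)"])
      (use g map_inv[of "inv\<^bsub>G\<^esub> g"] map_inv[of g] map_dom dom_c in auto)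
  fix x y assume x: "x \<in> dom (inv\<^bsub>G\<^esub> g)" and y: "y \<in> dom (inv\<^bsub>G\<^esub> g)"
  show "map g (x \<oplus>\<^bsub>R\<^esub> y) = map g x \<oplus>\<^bsub>R\<^esub> map g y"
    using dom_c[OF x] dom_c[OF y] g by (simp add: map_def p_add act_add q_add)
  show "map g (x \<otimes>\<^bsub>R\<^esub> y) = map g x \<otimes>\<^bsub>R\<^esub> map g y"
    using dom_c[OF x] dom_c[OF y] g by (simp add: map_def p_mult act_mult q_mult)
next
  show "dom \<one>\<^bsub>G\<^esub> = carrier R"
    by (auto simp: dom_iff act_one p_e)
  show "map \<one>\<^bsub>G\<^esub> x = x" if "x \<in> carrier R" for x
    using that by (simp add: map_def act_one)
next
  fix g h assume g: "g \<in> carrier G" and h: "h \<in> carrier G"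
  show "map g ` (dom (inv\<^bsub>G\<^esub> g) \<inter> dom h) = dom g \<inter> dom (g \<otimes>\<^bsub>G\<^esub> h)"
  proof (intro equalityI subsetI)
    fix z assume "z \<in> map g ` (dom (inv\<^bsub>G\<^esub> g) \<inter> dom h)"
    thus "z \<in> dom g \<inter> dom (g \<otimes>\<^bsub>G\<^esub> h)" using g h map_dom map_dom_inter dom_iff by auto
  next
    fix z assume z: "z \<in> dom g \<inter> dom (g \<otimes>\<^bsub>G\<^esub> h)"
    \<comment> \<open>The preimage of \<open>z\<close> is its image under the inverse of
      \<open>g\<close>; by this identity \<open>map_dom_inter\<close> places it in
      \<open>dom h\<close>.\<close>
    have "inv\<^bsub>G\<^esub> g \<otimes>\<^bsub>G\<^esub> (g \<otimes>\<^bsub>G\<^esub> h) = h" using g h by (simp add: G.m_assoc[symmetric])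
    hence "map (inv\<^bsub>G\<^esub> g) z \<in> dom (inv\<^bsub>G\<^esub> g) \<inter> dom h"
      using z g h map_dom[of "inv\<^bsub>G\<^esub> g" z] map_dom_inter[of "inv\<^bsub>G\<^esub> g" "g \<otimes>\<^bsub>G\<^esub> h" z] by (auto simp: dom_iff)
    thus "z \<in> map g ` (dom (inv\<^bsub>G\<^esub> g) \<inter> dom h)" using map_inv[OF g] z by force
  qed
  fix x assume x: "x \<in> dom (inv\<^bsub>G\<^esub> h) \<inter> dom (inv\<^bsub>G\<^esub> (g \<otimes>\<^bsub>G\<^esub> h))"
  hence xc: "x \<in> carrier R" using h by (simp add: dom_iff)
  \<comment> \<open>Since \<open>x\<close> lies in the domain belonging to the inverse of
    \<open>h\<close>, its image lies in \<open>dom g\<close>, where the extra factor of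
    \<open>map_map\<close> is absorbed.\<close>
  have "(g \<otimes>\<^bsub>G\<^esub> h) \<otimes>\<^bsub>G\<^esub> inv\<^bsub>G\<^esub> h = g" using g h by (simp add: G.m_assoc)
  hence "map (g \<otimes>\<^bsub>G\<^esub> h) x \<in> dom g"
    using map_dom_inter[of "g \<otimes>\<^bsub>G\<^esub> h" "inv\<^bsub>G\<^esub> h" x] g h x by simp
  hence "map (g \<otimes>\<^bsub>G\<^esub> h) x \<otimes>\<^bsub>R\<^esub> q (b g e) = map (g \<otimes>\<^bsub>G\<^esub> h) x"
    using q_mult[of "p (map (g \<otimes>\<^bsub>G\<^esub> h) x)" "b g e"] g h xc by (simp add: dom_iff)
  thus "map g (map h x) = map (g \<otimes>\<^bsub>G\<^esub> h) x" using map_map g h x by simp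
qed (rule G.group_axioms R.cring_axioms)+

sublocale restricted: unital_partial_action G R dom map
  by (rule unital_partial_action)

lemma restricted_unit: "g \<in> carrier G \<Longrightarrow> restricted.unit_of g = q (b g e)"
  unfolding restricted.unit_of_def
proof (rule restricted.ideal_one_eqI)
  assume g: "g \<in> carrier G"
  show "q (b g e) \<in> dom g" using g map_dom[of g "\<one>\<^bsub>R\<^esub>"] by (simp add: map_def)
  fix x assume "x \<in> dom g"
  thus "q (b g e) \<otimes>\<^bsub>R\<^esub> x = x"
    using g q_mult[of "p x" "b g e"] by (simp add: dom_iff R.m_comm)
qed

text \<open>Cutting \<open>x\<close> down to the domain only contributes the factors
  \<open>e\<close> and \<open>b g e\<close>: the first becomes 1 under \<open>q\<close>, the second
  is absorbed by \<open>b g (p x)\<close>.\<close>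

lemma restricted_ext_map:
  assumes "g \<in> carrier G" "x \<in> carrier R"
  shows "restricted.ext_map g x = q (b g (p x))"
  using assms unfolding restricted.ext_map_def
  by (simp add: restricted_unit map_def p_mult p_q act_mult act_act act_one p_e q_mult T.m_assoc)
     (simp add: q_mult[symmetric] act_p_e)

end

section \<open>Invariants and Galois systems of the restricted action\<close>

context ideal_restriction
begin

lemma restricted_invariants:
  "invariants G R dom map = {s \<in> carrier R. \<forall>g \<in> carrier G. q (b g (p s)) = s \<otimes>\<^bsub>R\<^esub> q (b g e)}"
  unfolding restricted.invariants_ext_map by (auto simp: restricted_ext_map restricted_unit)

text \<open>Projecting the system by \<open>q\<close> multiplies the Galois sum by
  \<open>q (b g e)\<close>. This factor is 1 at the neutral element, and elsewhere the sum is zero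
  anyway.\<close>

lemma restricted_galois:
  assumes "B = invariants G R dom map" and gal: "galois_system (carrier G) I x y"
  shows "partial_galois_extension G R dom map B"
proof -
  have I: "finite I" and x: "\<And>i. i \<in> I \<Longrightarrow> x i \<in> carrier T" and y: "\<And>i. i \<in> I \<Longrightarrow> y i \<in> carrier T"
    and gal: "\<And>g. g \<in> carrier G \<Longrightarrow>
      (\<Oplus>\<^bsub>T\<^esub>i\<in>I. x i \<otimes>\<^bsub>T\<^esub> b g (y i)) = (if g = \<one>\<^bsub>G\<^esub> then \<one>\<^bsub>T\<^esub> else \<zero>\<^bsub>T\<^esub>)"
    using gal unfolding galois_system_def by auto
  interpret q: ring_hom_cring T R q
    by (intro ring_hom_cring.intro ring_hom_cring_axioms.intro T.cring_axioms R.cring_axioms q_hom)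
  show ?thesis
  proof (rule restricted.galois_ext_map[OF assms(1) I, of "\<lambda>i. q (x i)" "\<lambda>i. q (y i)"])
    fix g assume g: "g \<in> carrier G"
    let ?s = "\<Oplus>\<^bsub>T\<^esub>i\<in>I. x i \<otimes>\<^bsub>T\<^esub> b g (y i)"
    have s: "?s \<in> carrier T" using x y g by (auto intro!: T.finsum_closed)
    have "(\<Oplus>\<^bsub>R\<^esub>i\<in>I. q (x i) \<otimes>\<^bsub>R\<^esub> restricted.ext_map g (q (y i)))
        = (\<Oplus>\<^bsub>R\<^esub>i\<in>I. q (x i \<otimes>\<^bsub>T\<^esub> b g (y i)) \<otimes>\<^bsub>R\<^esub> q (b g e))"
      by (rule R.finsum_cong')
        (use x y g in \<open>auto simp: restricted_ext_map p_q act_mult q_mult R.m_assoc\<close>)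
    also have "\<dots> = (\<Oplus>\<^bsub>R\<^esub>i\<in>I. q (x i \<otimes>\<^bsub>T\<^esub> b g (y i))) \<otimes>\<^bsub>R\<^esub> q (b g e)"
      by (rule R.finsum_ldistr[symmetric]) (use I x y g in auto)
    also have "(\<Oplus>\<^bsub>R\<^esub>i\<in>I. q (x i \<otimes>\<^bsub>T\<^esub> b g (y i))) = q ?s"
      using q.hom_finsum[of "\<lambda>i. x i \<otimes>\<^bsub>T\<^esub> b g (y i)" I] x y g by (simp add: comp_def)
    also have "q ?s \<otimes>\<^bsub>R\<^esub> q (b g e) = (if g = \<one>\<^bsub>G\<^esub> then \<one>\<^bsub>R\<^esub> else \<zero>\<^bsub>R\<^esub>)"
      unfolding gal[OF g] using g by (simp add: act_one)
    finally show "(\<Oplus>\<^bsub>R\<^esub>i\<in>I. q (x i) \<otimes>\<^bsub>R\<^esub> restricted.ext_map g (q (y i))) = \<dots>" .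
  qed (use x y in auto)
qed

end

section \<open>The idempotent of a subgroup\<close>

text \<open>\<open>u\<close> stands for the identity of \<open>S\<close> inside \<open>T\<close>.
  The locale is used for the normal subgroup and also for the whole group.\<close>

locale idempotent_cover = global_action G T b
  for G :: "('g, 'c) monoid_scheme" and T :: "('t, 'e) ring_scheme" and b :: "'g \<Rightarrow> 't \<Rightarrow> 't" +
  fixes u :: 't and H :: "'g set" and h :: "nat \<Rightarrow> 'g" and m :: nat
  assumes u_closed [simp]: "u \<in> carrier T" and u_idem: "u \<otimes>\<^bsub>T\<^esub> u = u"
    and H: "subgroup H G" and h_bij: "bij_betw h {1..m} H"
begin

abbreviation oi where "oi \<equiv> orth_idem T b u h"

text \<open>This is the idempotent \<open>e\<^sub>H\<close>: \<open>psi\<close> takes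
  \<open>u\<close> to it, by \<open>psi_fixed_mult\<close> at the fixed element 1. By
  \<open>sum_oi\<close> it is the join of the idempotents \<open>b k u\<close> with \<open>k\<close>
  in \<open>H\<close>.\<close>

definition e where "e = (\<Oplus>\<^bsub>T\<^esub>i\<in>{1..m}. oi i)"

lemma H_closed: "k \<in> H \<Longrightarrow> k \<in> carrier G"
  using H subgroup.mem_carrier by fast

lemma h_H: "i \<in> {1..m} \<Longrightarrow> h i \<in> H"
  using h_bij bij_betwE by blast

lemma h_closed: "i \<in> {1..m} \<Longrightarrow> h i \<in> carrier G"
  using h_H H_closed by blast

lemma h_surj: "k \<in> H \<Longrightarrow> \<exists>i \<in> {1..m}. k = h i"
  using h_bij unfolding bij_betw_def by blast

lemma oi_closed: "i \<in> {1..m} \<Longrightarrow> oi i \<in> carrier T"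
  unfolding orth_idem_def using h_closed by (auto intro!: T.m_closed T.finprod_closed)

lemma e_closed [simp]: "e \<in> carrier T"
  unfolding e_def using oi_closed by (auto intro!: T.finsum_closed)

lemma bu_idem: "g \<in> carrier G \<Longrightarrow> b g u \<otimes>\<^bsub>T\<^esub> b g u = b g u"
  using act_mult[of g u u] u_idem by simp

lemma oi_bu:
  assumes i: "i \<in> {1..m}"
  shows "oi i \<otimes>\<^bsub>T\<^esub> b (h i) u = oi i"
proof -
  have "(\<Otimes>\<^bsub>T\<^esub>k\<in>{1..<i}. \<one>\<^bsub>T\<^esub> \<ominus>\<^bsub>T\<^esub> b (h k) u) \<in> carrier T"
    using i h_closed by (auto intro!: T.finprod_closed)
  thus ?thesis using i h_closed[OF i] unfolding orth_idem_def by (simp add: T.m_assoc bu_idem)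
qed

text \<open>Telescoping: if P is the product so far and v the next translate of \<open>u\<close>,
  then Pv + (1 - P) = 1 - (1 - v)P.\<close>

lemma sum_oi:
  "n \<le> m \<Longrightarrow> (\<Oplus>\<^bsub>T\<^esub>i\<in>{1..n}. oi i) = \<one>\<^bsub>T\<^esub> \<ominus>\<^bsub>T\<^esub> (\<Otimes>\<^bsub>T\<^esub>k\<in>{1..n}. \<one>\<^bsub>T\<^esub> \<ominus>\<^bsub>T\<^esub> b (h k) u)"
proof (induction n)
  case 0
  show ?case by (simp add: T.minus_eq T.r_neg)
next
  case (Suc n)
  let ?P = "\<Otimes>\<^bsub>T\<^esub>k\<in>{1..n}. \<one>\<^bsub>T\<^esub> \<ominus>\<^bsub>T\<^esub> b (h k) u"
  have P: "?P \<in> carrier T" using Suc.prems h_closed by (auto intro!: T.finprod_closed)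
  have s: "Suc n \<in> {1..m}" using Suc.prems by simp
  have v: "b (h (Suc n)) u \<in> carrier T" using h_closed[OF s] by simp
  have ins: "{1..Suc n} = insert (Suc n) {1..n}" by auto
  have "(\<Oplus>\<^bsub>T\<^esub>i\<in>{1..Suc n}. oi i) = oi (Suc n) \<oplus>\<^bsub>T\<^esub> (\<Oplus>\<^bsub>T\<^esub>i\<in>{1..n}. oi i)"
    unfolding ins using Suc.prems oi_closed by (intro T.finsum_insert) auto
  also have "\<dots> = ?P \<otimes>\<^bsub>T\<^esub> b (h (Suc n)) u \<oplus>\<^bsub>T\<^esub> (\<one>\<^bsub>T\<^esub> \<ominus>\<^bsub>T\<^esub> ?P)"
    using Suc by (simp add: orth_idem_def atLeastLessThanSuc_atLeastAtMost)
  also have "\<dots> = \<one>\<^bsub>T\<^esub> \<ominus>\<^bsub>T\<^esub> (\<one>\<^bsub>T\<^esub> \<ominus>\<^bsub>T\<^esub> b (h (Suc n)) u) \<otimes>\<^bsub>T\<^esub> ?P"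
  proof -
    have "P' \<otimes>\<^bsub>T\<^esub> w \<oplus>\<^bsub>T\<^esub> (\<one>\<^bsub>T\<^esub> \<ominus>\<^bsub>T\<^esub> P') = \<one>\<^bsub>T\<^esub> \<ominus>\<^bsub>T\<^esub> (\<one>\<^bsub>T\<^esub> \<ominus>\<^bsub>T\<^esub> w) \<otimes>\<^bsub>T\<^esub> P'"
      if "P' \<in> carrier T" "w \<in> carrier T" for P' w
      using that by (simp add: T.minus_eq T.l_distr T.r_distr T.l_minus T.r_minus T.minus_add T.m_ac T.a_ac)
    thus ?thesis using P v by blast
  qed
  also have "(\<one>\<^bsub>T\<^esub> \<ominus>\<^bsub>T\<^esub> b (h (Suc n)) u) \<otimes>\<^bsub>T\<^esub> ?P = (\<Otimes>\<^bsub>T\<^esub>k\<in>{1..Suc n}. \<one>\<^bsub>T\<^esub> \<ominus>\<^bsub>T\<^esub> b (h k) u)"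
    unfolding ins using Suc.prems h_closed by (intro T.finprod_insert[symmetric]) auto
  finally show ?case .
qed

text \<open>By \<open>sum_oi\<close>, \<open>e\<close> differs from 1 by a multiple of 1 -
  \<open>b k u\<close>, which \<open>b k u\<close> annihilates.\<close>

lemma e_bu:
  assumes k: "k \<in> H"
  shows "e \<otimes>\<^bsub>T\<^esub> b k u = b k u"
proof -
  obtain i where i: "i \<in> {1..m}" "k = h i" using h_surj[OF k] by blast
  let ?P = "\<lambda>A. \<Otimes>\<^bsub>T\<^esub>k\<in>A. \<one>\<^bsub>T\<^esub> \<ominus>\<^bsub>T\<^esub> b (h k) u"
  have Pi: "?P ({1..m} - {i}) \<in> carrier T" using h_closed by (auto intro!: T.finprod_closed)
  have v: "b k u \<in> carrier T" "b k u \<otimes>\<^bsub>T\<^esub> b k u = b k u" using H_closed[OF k] bu_idem by auto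
  have "?P {1..m} = ?P (insert i ({1..m} - {i}))" using i by (simp add: insert_absorb)
  also have "\<dots> = (\<one>\<^bsub>T\<^esub> \<ominus>\<^bsub>T\<^esub> b k u) \<otimes>\<^bsub>T\<^esub> ?P ({1..m} - {i})"
    unfolding i(2) using h_closed i by (intro T.finprod_insert) auto
  finally have e: "e = \<one>\<^bsub>T\<^esub> \<ominus>\<^bsub>T\<^esub> (\<one>\<^bsub>T\<^esub> \<ominus>\<^bsub>T\<^esub> b k u) \<otimes>\<^bsub>T\<^esub> ?P ({1..m} - {i})"
    unfolding e_def sum_oi[OF le_refl] by simp
  have "(\<one>\<^bsub>T\<^esub> \<ominus>\<^bsub>T\<^esub> (\<one>\<^bsub>T\<^esub> \<ominus>\<^bsub>T\<^esub> w) \<otimes>\<^bsub>T\<^esub> P) \<otimes>\<^bsub>T\<^esub> w = w"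
    if "P \<in> carrier T" "w \<in> carrier T" "w \<otimes>\<^bsub>T\<^esub> w = w" for P w
  proof -
    have "(\<one>\<^bsub>T\<^esub> \<ominus>\<^bsub>T\<^esub> (\<one>\<^bsub>T\<^esub> \<ominus>\<^bsub>T\<^esub> w) \<otimes>\<^bsub>T\<^esub> P) \<otimes>\<^bsub>T\<^esub> w = w \<ominus>\<^bsub>T\<^esub> (w \<ominus>\<^bsub>T\<^esub> w \<otimes>\<^bsub>T\<^esub> w) \<otimes>\<^bsub>T\<^esub> P"
      using that(1,2)
      by (simp add: T.minus_eq T.l_distr T.r_distr T.l_minus T.r_minus T.minus_add T.m_ac T.a_ac)
    also have "\<dots> = w" using that(1,2) unfolding that(3) by (simp add: T.minus_eq T.r_neg)
    finally show ?thesis .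
  qed
  thus ?thesis unfolding e using Pi v by blast
qed

lemma bu_e: "k \<in> H \<Longrightarrow> b k u \<otimes>\<^bsub>T\<^esub> e = b k u"
  using e_bu H_closed by (simp add: T.m_comm)

text \<open>Each piece \<open>oi i\<close> is a multiple of a translate of \<open>u\<close>, so
  \<open>e\<close> lies in the ideal generated by the translates.\<close>

lemma e_kill:
  assumes t: "t \<in> carrier T" and "\<And>k. k \<in> H \<Longrightarrow> t \<otimes>\<^bsub>T\<^esub> b k u = \<zero>\<^bsub>T\<^esub>"
  shows "t \<otimes>\<^bsub>T\<^esub> e = \<zero>\<^bsub>T\<^esub>"
proof -
  have "t \<otimes>\<^bsub>T\<^esub> oi i = \<zero>\<^bsub>T\<^esub>" if i: "i \<in> {1..m}" for i
  proof -
    have "t \<otimes>\<^bsub>T\<^esub> oi i = t \<otimes>\<^bsub>T\<^esub> (oi i \<otimes>\<^bsub>T\<^esub> b (h i) u)" using oi_bu[OF i] by simp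
    also have "\<dots> = (t \<otimes>\<^bsub>T\<^esub> b (h i) u) \<otimes>\<^bsub>T\<^esub> oi i"
      using t oi_closed[OF i] h_closed[OF i] by (simp add: T.m_ac)
    also have "\<dots> = \<zero>\<^bsub>T\<^esub>" using assms(2)[OF h_H[OF i]] oi_closed[OF i] by simp
    finally show ?thesis .
  qed
  moreover have "t \<otimes>\<^bsub>T\<^esub> e = (\<Oplus>\<^bsub>T\<^esub>i\<in>{1..m}. t \<otimes>\<^bsub>T\<^esub> oi i)"
    unfolding e_def using t oi_closed by (intro T.finsum_rdistr) auto
  ultimately show ?thesis using T.add.finprod_one_eqI[of "{1..m}" "\<lambda>i. t \<otimes>\<^bsub>T\<^esub> oi i"] by simp
qed

text \<open>This local-to-global principle reduces the proofs of invariance below to a comparison on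
  each translate of \<open>u\<close>.\<close>

lemma eq_on_cover:
  assumes "s \<in> carrier T" "t \<in> carrier T" and "\<And>k. k \<in> H \<Longrightarrow> s \<otimes>\<^bsub>T\<^esub> b k u = t \<otimes>\<^bsub>T\<^esub> b k u"
  shows "s \<otimes>\<^bsub>T\<^esub> e = t \<otimes>\<^bsub>T\<^esub> e"
proof -
  have "(s \<ominus>\<^bsub>T\<^esub> t) \<otimes>\<^bsub>T\<^esub> b k u = \<zero>\<^bsub>T\<^esub>" if "k \<in> H" for k
  proof -
    have "(s \<ominus>\<^bsub>T\<^esub> t) \<otimes>\<^bsub>T\<^esub> b k u = s \<otimes>\<^bsub>T\<^esub> b k u \<ominus>\<^bsub>T\<^esub> t \<otimes>\<^bsub>T\<^esub> b k u"
      using assms(1,2) H_closed[OF that] by (simp add: T.minus_eq T.l_distr T.l_minus)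
    thus ?thesis using assms H_closed[OF that] that by (simp add: T.minus_eq T.r_neg)
  qed
  hence "(s \<ominus>\<^bsub>T\<^esub> t) \<otimes>\<^bsub>T\<^esub> e = \<zero>\<^bsub>T\<^esub>" using assms by (intro e_kill) auto
  hence "s \<otimes>\<^bsub>T\<^esub> e \<ominus>\<^bsub>T\<^esub> t \<otimes>\<^bsub>T\<^esub> e = \<zero>\<^bsub>T\<^esub>"
    using assms by (simp add: T.minus_eq T.l_distr T.l_minus)
  thus ?thesis using assms by simp
qed

lemma act_shift_bu:
  assumes "k \<in> H" "l \<in> H" "t \<in> carrier T"
  shows "b k t \<otimes>\<^bsub>T\<^esub> b l u = b k (t \<otimes>\<^bsub>T\<^esub> b (inv\<^bsub>G\<^esub> k \<otimes>\<^bsub>G\<^esub> l) u)"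
  using assms H_closed by (simp add: act_mult act_act G.m_assoc[symmetric])

lemma e_fixed: "e \<in> fixed H"
proof -
  \<comment> \<open>Like \<open>e\<close>, its image \<open>b k e\<close> acts as the identity on
    every translate of \<open>u\<close> by an element of \<open>H\<close>.\<close>
  have *: "b k e \<otimes>\<^bsub>T\<^esub> e = e" if k: "k \<in> H" for k
  proof -
    have "b k e \<otimes>\<^bsub>T\<^esub> b l u = \<one>\<^bsub>T\<^esub> \<otimes>\<^bsub>T\<^esub> b l u" if l: "l \<in> H" for l
    proof -
      have kl: "inv\<^bsub>G\<^esub> k \<otimes>\<^bsub>G\<^esub> l \<in> H" using k l H by (simp add: subgroup.m_closed subgroup.m_inv_closed)
      show ?thesis
        using act_shift_bu[OF k l e_closed] e_bu[OF kl] k l H_closed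
        by (simp add: act_act G.m_assoc[symmetric])
    qed
    from eq_on_cover[OF _ _ this] show ?thesis using k H_closed by simp
  qed
  have "b k e = e" if k: "k \<in> H" for k
  proof -
    have ki: "inv\<^bsub>G\<^esub> k \<in> H" using k H subgroup.m_inv_closed by fast
    have kc: "k \<in> carrier G" using k H_closed by simp
    \<comment> \<open>Applying \<open>b k\<close> to the relation for the inverse gives the reverse
      absorption.\<close>
    have "b k (b (inv\<^bsub>G\<^esub> k) e \<otimes>\<^bsub>T\<^esub> e) = b k e" using *[OF ki] by simp
    hence "e \<otimes>\<^bsub>T\<^esub> b k e = b k e" using kc by (simp add: act_mult)
    thus ?thesis using *[OF k] kc T.m_comm[of e "b k e"] by simp
  qed
  thus ?thesis by (simp add: fixed_def)
qed

section \<open>Gluing along the cover: the map \<open>psi\<close>\<close>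

lemma psi_closed [simp]: "t \<in> carrier T \<Longrightarrow> psi T b u h m t \<in> carrier T"
  unfolding psi_def using h_closed oi_closed by (auto intro!: T.finsum_closed)

lemma psi_distrib:
  "s \<in> carrier T \<Longrightarrow> t \<in> carrier T \<Longrightarrow>
    psi T b u h m t \<otimes>\<^bsub>T\<^esub> s = (\<Oplus>\<^bsub>T\<^esub>i\<in>{1..m}. b (h i) t \<otimes>\<^bsub>T\<^esub> oi i \<otimes>\<^bsub>T\<^esub> s)"
  unfolding psi_def using h_closed oi_closed by (intro T.finsum_ldistr) auto

lemma psi_e:
  assumes t: "t \<in> carrier T"
  shows "psi T b u h m t \<otimes>\<^bsub>T\<^esub> e = psi T b u h m t"
proof -
  have oi_e: "oi i \<otimes>\<^bsub>T\<^esub> e = oi i" if i: "i \<in> {1..m}" for i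
  proof -
    have "oi i \<otimes>\<^bsub>T\<^esub> e = oi i \<otimes>\<^bsub>T\<^esub> (b (h i) u \<otimes>\<^bsub>T\<^esub> e)"
      using oi_bu[OF i] oi_closed[OF i] h_closed[OF i] by (simp flip: T.m_assoc)
    thus ?thesis using bu_e[OF h_H[OF i]] oi_bu[OF i] by simp
  qed
  show ?thesis
    unfolding psi_distrib[OF e_closed t] unfolding psi_def
    by (rule T.finsum_cong') (use t h_closed oi_closed oi_e in \<open>auto simp: T.m_assoc\<close>)
qed

text \<open>\<open>b (h i)\<close> leaves \<open>y\<close> unchanged and moves \<open>u\<close> to
  the translate absorbed by \<open>oi i\<close>. On fixed multiples of \<open>e\<close>,
  \<open>psi\<close> thus undoes multiplication by \<open>u\<close>.\<close>

lemma psi_fixed_mult: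
  assumes y: "y \<in> fixed H"
  shows "psi T b u h m (y \<otimes>\<^bsub>T\<^esub> u) = y \<otimes>\<^bsub>T\<^esub> e"
proof -
  have yc: "y \<in> carrier T" using y by (rule fixed_closed)
  have "psi T b u h m (y \<otimes>\<^bsub>T\<^esub> u) = (\<Oplus>\<^bsub>T\<^esub>i\<in>{1..m}. y \<otimes>\<^bsub>T\<^esub> oi i)"
    unfolding psi_def
  proof (rule T.finsum_cong')
    fix i assume i: "i \<in> {1..m}"
    have "b (h i) (y \<otimes>\<^bsub>T\<^esub> u) \<otimes>\<^bsub>T\<^esub> oi i = y \<otimes>\<^bsub>T\<^esub> (oi i \<otimes>\<^bsub>T\<^esub> b (h i) u)"
      using fixed_act[OF y h_H[OF i]] h_closed[OF i] oi_closed[OF i] yc by (simp add: act_mult T.m_ac)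
    thus "b (h i) (y \<otimes>\<^bsub>T\<^esub> u) \<otimes>\<^bsub>T\<^esub> oi i = y \<otimes>\<^bsub>T\<^esub> oi i" using oi_bu[OF i] by simp
  qed (use yc oi_closed in auto)
  also have "\<dots> = y \<otimes>\<^bsub>T\<^esub> e"
    unfolding e_def by (rule T.finsum_rdistr[symmetric]) (use yc oi_closed in auto)
  finally show ?thesis .
qed

text \<open>The hypotheses say that \<open>x\<close> is the image in \<open>T\<close> of an
  \<open>H\<close>-invariant element of \<open>S\<close>; compare
  \<open>invariants_subgroup_iff\<close>.\<close>

context
  fixes x
  assumes x: "x \<in> carrier T" and x_u: "x \<otimes>\<^bsub>T\<^esub> u = x"
    and inv: "\<And>k. k \<in> H \<Longrightarrow> b k x \<otimes>\<^bsub>T\<^esub> u = x \<otimes>\<^bsub>T\<^esub> b k u"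
begin

text \<open>The elements \<open>b k x\<close>, each living on the translate \<open>b k u\<close>,
  agree on overlaps, and \<open>psi\<close> glues them to one element.\<close>

lemma psi_bu:
  assumes k: "k \<in> H"
  shows "psi T b u h m x \<otimes>\<^bsub>T\<^esub> b k u = b k x"
proof -
  have kc: "k \<in> carrier G" using k H_closed by simp
  have bx: "b k x = b k x \<otimes>\<^bsub>T\<^esub> b k u" using act_mult[of k x u] x_u x kc by simp
  have "psi T b u h m x \<otimes>\<^bsub>T\<^esub> b k u = (\<Oplus>\<^bsub>T\<^esub>i\<in>{1..m}. b (h i) x \<otimes>\<^bsub>T\<^esub> oi i \<otimes>\<^bsub>T\<^esub> b k u)"
    using x kc by (intro psi_distrib) auto
  also have "\<dots> = (\<Oplus>\<^bsub>T\<^esub>i\<in>{1..m}. b k x \<otimes>\<^bsub>T\<^esub> oi i)"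
  proof (rule T.finsum_cong')
    fix i assume i: "i \<in> {1..m}"
    let ?l = "inv\<^bsub>G\<^esub> k \<otimes>\<^bsub>G\<^esub> h i"
    have hc: "h i \<in> carrier G" and oc: "oi i \<in> carrier T" using h_closed oi_closed i by auto
    have l: "?l \<in> H" using k h_H[OF i] H by (simp add: subgroup.m_closed subgroup.m_inv_closed)
    have kl: "k \<otimes>\<^bsub>G\<^esub> ?l = h i" using kc hc by (simp add: G.m_assoc[symmetric])
    \<comment> \<open>The agreement on the overlap is the invariance of \<open>x\<close> at
      \<open>?l\<close>, translated by \<open>k\<close>.\<close>
    have "b (h i) x \<otimes>\<^bsub>T\<^esub> b k u = b k (b ?l x \<otimes>\<^bsub>T\<^esub> u)"
      using act_mult[of k "b ?l x" u] act_act[of k ?l x] kl x kc H_closed[OF l] by simp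
    also have "\<dots> = b k x \<otimes>\<^bsub>T\<^esub> b (h i) u"
      unfolding inv[OF l] using act_mult[of k x "b ?l u"] act_act[of k ?l u] kl x kc H_closed[OF l] by simp
    finally have "b (h i) x \<otimes>\<^bsub>T\<^esub> b k u = b k x \<otimes>\<^bsub>T\<^esub> b (h i) u" .
    hence "b (h i) x \<otimes>\<^bsub>T\<^esub> oi i \<otimes>\<^bsub>T\<^esub> b k u = b k x \<otimes>\<^bsub>T\<^esub> b (h i) u \<otimes>\<^bsub>T\<^esub> oi i"
      using x kc hc oc by (metis T.m_assoc T.m_comm act_closed u_closed)
    thus "b (h i) x \<otimes>\<^bsub>T\<^esub> oi i \<otimes>\<^bsub>T\<^esub> b k u = b k x \<otimes>\<^bsub>T\<^esub> oi i"
      using oi_bu[OF i] x kc hc oc by (simp add: T.m_assoc T.m_comm[of "b (h i) u"])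
  qed (use x kc oi_closed in auto)
  also have "\<dots> = b k x \<otimes>\<^bsub>T\<^esub> e"
    unfolding e_def by (rule T.finsum_rdistr[symmetric]) (use x kc oi_closed in auto)
  also have "\<dots> = b k x"
    using bx bu_e[OF k] x kc by (metis T.m_assoc act_closed e_closed u_closed)
  finally show ?thesis .
qed

lemma psi_u: "psi T b u h m x \<otimes>\<^bsub>T\<^esub> u = x"
  using psi_bu[OF subgroup.one_closed[OF H]] x by (simp add: act_one)

text \<open>The action of \<open>k\<close> only permutes the local elements that \<open>psi\<close>
  glues, so the glued element does not change.\<close>

lemma psi_fixed: "psi T b u h m x \<in> fixed H"
proof -
  let ?y = "psi T b u h m x"
  have y: "?y \<in> carrier T" using x by simp
  have "b k ?y = ?y" if k: "k \<in> H" for k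
  proof -
    have kc: "k \<in> carrier G" using k H_closed by simp
    have "b k ?y \<otimes>\<^bsub>T\<^esub> b l u = ?y \<otimes>\<^bsub>T\<^esub> b l u" if l: "l \<in> H" for l
    proof -
      have kl: "inv\<^bsub>G\<^esub> k \<otimes>\<^bsub>G\<^esub> l \<in> H" using k l H by (simp add: subgroup.m_closed subgroup.m_inv_closed)
      have "b k ?y \<otimes>\<^bsub>T\<^esub> b l u = b k (b (inv\<^bsub>G\<^esub> k \<otimes>\<^bsub>G\<^esub> l) x)"
        using act_shift_bu[OF k l y] psi_bu[OF kl] by simp
      thus ?thesis using psi_bu[OF l] x kc H_closed[OF l] by (simp add: act_act G.m_assoc[symmetric])
    qed
    from eq_on_cover[OF _ y this] have "b k ?y \<otimes>\<^bsub>T\<^esub> e = ?y" using y kc psi_e[OF x] by simp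
    moreover have "b k ?y = b k ?y \<otimes>\<^bsub>T\<^esub> e"
      using act_mult[OF kc y e_closed] psi_e[OF x] fixed_act[OF e_fixed k] by simp
    ultimately show ?thesis by simp
  qed
  thus ?thesis using y by (simp add: fixed_def)
qed

end

text \<open>The ring \<open>T\<close> is the sum of the rings \<open>T oi\<^sub>i\<close>, on each of which the translate by
  \<open>h i\<close> of the given system is used.\<close>

lemma galois_system_lift:
  assumes I: "finite I" and x: "\<And>i. i \<in> I \<Longrightarrow> x i \<in> carrier T" and y: "\<And>i. i \<in> I \<Longrightarrow> y i \<in> carrier T"
    and gal: "\<And>g. g \<in> H \<Longrightarrow> (\<Oplus>\<^bsub>T\<^esub>i\<in>I. x i \<otimes>\<^bsub>T\<^esub> b g (y i)) = (if g = \<one>\<^bsub>G\<^esub> then u else \<zero>\<^bsub>T\<^esub>)"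
    and e: "e = \<one>\<^bsub>T\<^esub>"
  shows "galois_system H ({1..m} \<times> I) (\<lambda>z. oi (fst z) \<otimes>\<^bsub>T\<^esub> b (h (fst z)) (x (snd z)))
    (\<lambda>z. b (h (fst z)) (y (snd z)))"
  unfolding galois_system_def
proof (intro conjI ballI)
  fix g assume g: "g \<in> H"
  have gc: "g \<in> carrier G" using g H_closed by simp
  have "(\<Oplus>\<^bsub>T\<^esub>z\<in>{1..m} \<times> I. oi (fst z) \<otimes>\<^bsub>T\<^esub> b (h (fst z)) (x (snd z)) \<otimes>\<^bsub>T\<^esub> b g (b (h (fst z)) (y (snd z))))
      = (\<Oplus>\<^bsub>T\<^esub>k\<in>{1..m}. \<Oplus>\<^bsub>T\<^esub>i\<in>I. oi k \<otimes>\<^bsub>T\<^esub> b (h k) (x i) \<otimes>\<^bsub>T\<^esub> b g (b (h k) (y i)))"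
    by (rule T.finsum_Times) (use I x y gc h_closed oi_closed in auto)
  also have "\<dots> = (\<Oplus>\<^bsub>T\<^esub>k\<in>{1..m}. if g = \<one>\<^bsub>G\<^esub> then oi k else \<zero>\<^bsub>T\<^esub>)"
  proof (rule T.finsum_cong')
    fix k assume k: "k \<in> {1..m}"
    \<comment> \<open>The conjugate of \<open>g\<close> by \<open>h k\<close> moves
      \<open>b (h k)\<close> in front of both factors. It stays in \<open>H\<close> and is trivial
      exactly when \<open>g\<close> is.\<close>
    let ?g = "inv\<^bsub>G\<^esub> (h k) \<otimes>\<^bsub>G\<^esub> (g \<otimes>\<^bsub>G\<^esub> h k)"
    have hc: "h k \<in> carrier G" and oc: "oi k \<in> carrier T" using h_closed oi_closed k by auto
    have gH: "?g \<in> H" using g h_H[OF k] H by (simp add: subgroup.m_closed subgroup.m_inv_closed)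
    have gg: "?g \<in> carrier G" "h k \<otimes>\<^bsub>G\<^esub> ?g = g \<otimes>\<^bsub>G\<^esub> h k" using gc hc by (simp_all add: G.m_assoc[symmetric])
    have one: "?g = \<one>\<^bsub>G\<^esub> \<longleftrightarrow> g = \<one>\<^bsub>G\<^esub>"
      using gc hc gg(2) by (metis G.l_one G.m_closed G.one_closed G.r_cancel_one' G.r_one G.l_inv)
    have "(\<Oplus>\<^bsub>T\<^esub>i\<in>I. oi k \<otimes>\<^bsub>T\<^esub> b (h k) (x i) \<otimes>\<^bsub>T\<^esub> b g (b (h k) (y i)))
        = (\<Oplus>\<^bsub>T\<^esub>i\<in>I. oi k \<otimes>\<^bsub>T\<^esub> b (h k) (x i \<otimes>\<^bsub>T\<^esub> b ?g (y i)))"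
      by (rule T.finsum_cong')
        (use x y gc hc gg oc in \<open>auto simp: act_mult act_act T.m_assoc\<close>)
    also have "\<dots> = oi k \<otimes>\<^bsub>T\<^esub> (\<Oplus>\<^bsub>T\<^esub>i\<in>I. b (h k) (x i \<otimes>\<^bsub>T\<^esub> b ?g (y i)))"
      by (rule T.finsum_rdistr[symmetric]) (use I x y hc gg oc in auto)
    also have "(\<Oplus>\<^bsub>T\<^esub>i\<in>I. b (h k) (x i \<otimes>\<^bsub>T\<^esub> b ?g (y i))) = b (h k) (\<Oplus>\<^bsub>T\<^esub>i\<in>I. x i \<otimes>\<^bsub>T\<^esub> b ?g (y i))"
      by (rule act_finsum[symmetric]) (use x y hc gg in auto)
    also have "oi k \<otimes>\<^bsub>T\<^esub> \<dots> = (if g = \<one>\<^bsub>G\<^esub> then oi k else \<zero>\<^bsub>T\<^esub>)"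
      unfolding gal[OF gH] one using oi_bu[OF k] hc oc by simp
    finally show "(\<Oplus>\<^bsub>T\<^esub>i\<in>I. oi k \<otimes>\<^bsub>T\<^esub> b (h k) (x i) \<otimes>\<^bsub>T\<^esub> b g (b (h k) (y i))) = \<dots>" .
  qed (use oi_closed in auto)
  \<comment> \<open>At the neutral element the pieces add up to \<open>e\<close>, which is 1 by
    assumption.\<close>
  also have "\<dots> = (if g = \<one>\<^bsub>G\<^esub> then \<one>\<^bsub>T\<^esub> else \<zero>\<^bsub>T\<^esub>)"
    using e by (simp add: e_def)
  finally show "(\<Oplus>\<^bsub>T\<^esub>z\<in>{1..m} \<times> I. oi (fst z) \<otimes>\<^bsub>T\<^esub> b (h (fst z)) (x (snd z)) \<otimes>\<^bsub>T\<^esub> b g (b (h (fst z)) (y (snd z)))) = \<dots>" .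
qed (use I x y h_closed oi_closed in auto)

end

section \<open>The action of the quotient group\<close>

context global_action
begin

context
  fixes H
  assumes nH: "H \<lhd> G"
begin

interpretation normal H G by (rule nH)

lemma coset_carrier: "g \<in> carrier G \<Longrightarrow> g <#\<^bsub>G\<^esub> H \<in> carrier (G Mod H)"
  using coset_eq by (auto simp: FactGroup_def RCOSETS_def)

lemma coset_repE:
  assumes "C \<in> carrier (G Mod H)"
  obtains "coset_rep C \<in> carrier G" "C = coset_rep C <#\<^bsub>G\<^esub> H"
proof -
  obtain a where a: "a \<in> carrier G" "C = H #>\<^bsub>G\<^esub> a"
    using assms by (auto simp: FactGroup_def RCOSETS_def)
  have "a \<in> C" using a G.rcos_self[OF a(1) is_subgroup] by simp
  hence r: "coset_rep C \<in> C" unfolding coset_rep_def by (rule someI)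
  hence rc: "coset_rep C \<in> carrier G" using a G.r_coset_subset_G[OF subset a(1)] by blast
  have "C = H #>\<^bsub>G\<^esub> coset_rep C" using G.repr_independence[OF _ a(1) is_subgroup] r a(2) by simp
  thus ?thesis using that rc coset_eq by simp
qed

text \<open>An element of the coset is \<open>g\<close> times an element of \<open>H\<close>, and
  the latter fixes \<open>t\<close>. Hence the chosen representatives do not matter on fixed
  elements.\<close>

lemma act_coset:
  assumes "g \<in> carrier G" "k \<in> g <#\<^bsub>G\<^esub> H" "t \<in> fixed H"
  shows "b k t = b g t"
proof -
  obtain l where l: "l \<in> H" "k = g \<otimes>\<^bsub>G\<^esub> l" using assms(2) by (auto simp: l_coset_def)
  thus ?thesis using act_act[of g l t] assms fixed_act[OF assms(3) l(1)] fixed_closed by simp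
qed

lemma act_coset_rep:
  assumes "C \<in> carrier (G Mod H)" "k \<in> C" "t \<in> fixed H"
  shows "b (coset_rep C) t = b k t"
  using act_coset[of "coset_rep C" k t] coset_repE[OF assms(1)] assms by metis

lemma act_coset_rep_eq:
  assumes "g \<in> carrier G" "t \<in> fixed H"
  shows "b (coset_rep (g <#\<^bsub>G\<^esub> H)) t = b g t"
proof (rule act_coset_rep[OF coset_carrier[OF assms(1)] _ assms(2)])
  have "g = g \<otimes>\<^bsub>G\<^esub> \<one>\<^bsub>G\<^esub>" using assms by simp
  thus "g \<in> g <#\<^bsub>G\<^esub> H" unfolding l_coset_def using one_closed by blast
qed

text \<open>Normality puts the product of \<open>k\<close> and \<open>g\<close> in the left coset of
  \<open>g\<close>, where every element acts on \<open>t\<close> as \<open>g\<close> does.\<close>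

lemma fixed_act_closed:
  assumes g: "g \<in> carrier G" and t: "t \<in> fixed H"
  shows "b g t \<in> fixed H"
proof -
  have "b k (b g t) = b g t" if k: "k \<in> H" for k
  proof -
    have "k \<otimes>\<^bsub>G\<^esub> g \<in> g <#\<^bsub>G\<^esub> H" using coset_eq g k by (auto simp: r_coset_def)
    thus ?thesis using act_coset[OF g _ t] act_act[of k g t] g k fixed_closed[OF t] by simp
  qed
  thus ?thesis using g fixed_closed[OF t] by (simp add: fixed_def)
qed

lemma quotient_action:
  "global_action (G Mod H) (T\<lparr>carrier := fixed H\<rparr>) (\<lambda>C. b (coset_rep C))"
proof (intro global_action.intro global_action_axioms.intro)
  show grp: "group (G Mod H)" by (rule factorgroup_is_group)
  show "cring (T\<lparr>carrier := fixed H\<rparr>)" using fixed_cring subset by blast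
  fix C assume C: "C \<in> carrier (G Mod H)"
  then have r: "coset_rep C \<in> carrier G" "C = coset_rep C <#\<^bsub>G\<^esub> H" using coset_repE by blast+
  show "b (coset_rep C) \<in> ring_hom (T\<lparr>carrier := fixed H\<rparr>) (T\<lparr>carrier := fixed H\<rparr>)"
    using r fixed_act_closed fixed_closed by (intro ring_hom_memI) (auto simp: act_add act_mult)
  fix C' t assume C': "C' \<in> carrier (G Mod H)" and "t \<in> carrier (T\<lparr>carrier := fixed H\<rparr>)"
  then have r': "coset_rep C' \<in> carrier G" "C' = coset_rep C' <#\<^bsub>G\<^esub> H" and t: "t \<in> fixed H"
    using coset_repE by auto
  have self: "g \<in> g <#\<^bsub>G\<^esub> H" if "g \<in> carrier G" for g
    using that G.rcos_self[OF that is_subgroup] coset_eq by simp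
  have "C \<otimes>\<^bsub>G Mod H\<^esub> C' \<in> carrier (G Mod H)" using group.is_monoid[OF grp] C C' monoid.m_closed by metis
  \<comment> \<open>The product of the representatives need not be the chosen representative of the
    product coset, but it lies in that coset.\<close>
  moreover have "coset_rep C \<otimes>\<^bsub>G\<^esub> coset_rep C' \<in> C \<otimes>\<^bsub>G Mod H\<^esub> C'"
    using self[OF r(1)] self[OF r'(1)] r r' by (auto simp: FactGroup_def set_mult_def)
  ultimately show "b (coset_rep C) (b (coset_rep C') t) = b (coset_rep (C \<otimes>\<^bsub>G Mod H\<^esub> C')) t"
    using act_coset_rep[OF _ _ t] act_act r r' fixed_closed[OF t] by simp
next
  fix t assume "t \<in> carrier (T\<lparr>carrier := fixed H\<rparr>)"
  hence t: "t \<in> fixed H" by simp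
  have "\<one>\<^bsub>G Mod H\<^esub> = \<one>\<^bsub>G\<^esub> <#\<^bsub>G\<^esub> H"
    using G.lcos_mult_one[OF subset] by (simp add: FactGroup_def)
  thus "b (coset_rep \<one>\<^bsub>G Mod H\<^esub>) t = t"
    using act_coset_rep_eq[OF G.one_closed t] act_one[OF fixed_closed[OF t]] by metis
qed

lemma quotient_galois_system:
  assumes I: "finite I" and x: "x \<in> I \<rightarrow> fixed H" and y: "y \<in> I \<rightarrow> fixed H"
    and gal: "\<And>g. g \<in> carrier G \<Longrightarrow>
      (\<Oplus>\<^bsub>T\<^esub>i\<in>I. x i \<otimes>\<^bsub>T\<^esub> b g (y i)) = (if g \<in> H then \<one>\<^bsub>T\<^esub> else \<zero>\<^bsub>T\<^esub>)"
  shows "global_action.galois_system (G Mod H) (T\<lparr>carrier := fixed H\<rparr>) (\<lambda>C. b (coset_rep C))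
    (carrier (G Mod H)) I x y"
proof -
  interpret Q: global_action "G Mod H" "T\<lparr>carrier := fixed H\<rparr>" "\<lambda>C. b (coset_rep C)"
    by (rule quotient_action)
  interpret incl: ring_hom_cring "T\<lparr>carrier := fixed H\<rparr>" T "\<lambda>t. t"
    by (intro ring_hom_cring.intro ring_hom_cring_axioms.intro Q.T.cring_axioms T.cring_axioms)
      (auto simp: ring_hom_def fixed_closed)
  have "(\<Oplus>\<^bsub>T\<lparr>carrier := fixed H\<rparr>\<^esub>i\<in>I. x i \<otimes>\<^bsub>T\<^esub> b (coset_rep C) (y i))
      = (if C = H then \<one>\<^bsub>T\<^esub> else \<zero>\<^bsub>T\<^esub>)" if C: "C \<in> carrier (G Mod H)" for C
  proof -
    have r: "coset_rep C \<in> carrier G" "C = coset_rep C <#\<^bsub>G\<^esub> H" using coset_repE[OF C] by blast+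
    \<comment> \<open>The case distinction on the identity of the quotient thus matches the one in
      \<open>gal\<close>.\<close>
    have "C = H \<longleftrightarrow> coset_rep C \<in> H"
      using r coset_eq G.coset_join1[OF _ _ is_subgroup] G.coset_join2[OF _ is_subgroup] by metis
    moreover have "x i \<otimes>\<^bsub>T\<^esub> b (coset_rep C) (y i) \<in> fixed H" if "i \<in> I" for i
      using Q.T.m_closed[of "x i" "b (coset_rep C) (y i)"] that x y fixed_act_closed[OF r(1)] by auto
    ultimately show ?thesis
      using incl.hom_finsum[of "\<lambda>i. x i \<otimes>\<^bsub>T\<^esub> b (coset_rep C) (y i)" I] gal[OF r(1)]
      by (simp add: comp_def)
  qed
  thus ?thesis unfolding Q.galois_system_def using I x y by (simp add: FactGroup_def)
qed

end

end

section \<open>The globalization\<close>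

context globalization
begin

sublocale global: global_action G T b
  by (rule T.global_actionI) simp

abbreviation u where "u \<equiv> j \<one>\<^bsub>S\<^esub>"

text \<open>This is multiplication by the identity of \<open>S\<close>, read in \<open>S\<close>;
  the values of \<open>induced_one\<close> and \<open>induced_map\<close> are values of
  \<open>proj\<close>.\<close>

definition proj where "proj t = inv_into (carrier S) j (t \<otimes>\<^bsub>T\<^esub> u)"

lemma j_closed [simp]: "s \<in> carrier S \<Longrightarrow> j s \<in> carrier T"
  using ideal.Icarr[OF j_ideal] by blast

lemma j_u: "s \<in> carrier S \<Longrightarrow> j s \<otimes>\<^bsub>T\<^esub> u = j s"
  using j_mult[of s "\<one>\<^bsub>S\<^esub>"] by simp

lemma j_zero: "j \<zero>\<^bsub>S\<^esub> = \<zero>\<^bsub>T\<^esub>"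
  using j_add[of "\<zero>\<^bsub>S\<^esub>" "\<zero>\<^bsub>S\<^esub>"] T.R.add.r_cancel_one'[of "j \<zero>\<^bsub>S\<^esub>" "j \<zero>\<^bsub>S\<^esub>"] by simp

lemma j_finsum:
  assumes "finite A" "f \<in> A \<rightarrow> carrier S"
  shows "j (\<Oplus>\<^bsub>S\<^esub>i\<in>A. f i) = (\<Oplus>\<^bsub>T\<^esub>i\<in>A. j (f i))"
  using assms
proof (induction A rule: finite_induct)
  case empty
  show ?case by (simp add: j_zero)
next
  case (insert i A)
  moreover from this have "(\<Oplus>\<^bsub>S\<^esub>i\<in>A. f i) \<in> carrier S" by (intro R.finsum_closed) auto
  ultimately show ?case by (simp add: j_add Pi_def)
qed

lemma j_proj:
  assumes "t \<in> carrier T"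
  shows "proj t \<in> carrier S" "j (proj t) = t \<otimes>\<^bsub>T\<^esub> u"
proof -
  have "t \<otimes>\<^bsub>T\<^esub> u \<in> j ` carrier S" using ideal.I_l_closed[OF j_ideal _ assms] by simp
  thus "proj t \<in> carrier S" "j (proj t) = t \<otimes>\<^bsub>T\<^esub> u"
    unfolding proj_def by (rule inv_into_into, rule f_inv_into_f)
qed

lemma j_eqI: "s \<in> carrier S \<Longrightarrow> s' \<in> carrier S \<Longrightarrow> j s = j s' \<Longrightarrow> s = s'"
  using j_inj by (simp add: inj_on_def)

lemma proj_eqI: "t \<in> carrier T \<Longrightarrow> s \<in> carrier S \<Longrightarrow> t \<otimes>\<^bsub>T\<^esub> u = j s \<Longrightarrow> proj t = s"
  by (rule j_eqI) (simp_all add: j_proj)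

lemma proj_hom: "proj \<in> ring_hom T S"
proof (rule ring_hom_memI)
  fix s t assume s: "s \<in> carrier T" and t: "t \<in> carrier T"
  show "proj s \<in> carrier S" using j_proj s by simp
  have "s \<otimes>\<^bsub>T\<^esub> t \<otimes>\<^bsub>T\<^esub> u = s \<otimes>\<^bsub>T\<^esub> t \<otimes>\<^bsub>T\<^esub> (u \<otimes>\<^bsub>T\<^esub> u)" using j_u by simp
  also have "\<dots> = s \<otimes>\<^bsub>T\<^esub> u \<otimes>\<^bsub>T\<^esub> (t \<otimes>\<^bsub>T\<^esub> u)" using s t by (simp add: T.R.m_ac)
  finally show "proj (s \<otimes>\<^bsub>T\<^esub> t) = proj s \<otimes>\<^bsub>S\<^esub> proj t"
    using s t by (intro proj_eqI) (auto simp: j_proj j_mult)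
  show "proj (s \<oplus>\<^bsub>T\<^esub> t) = proj s \<oplus>\<^bsub>S\<^esub> proj t"
    using s t by (intro proj_eqI) (auto simp: j_proj j_add T.R.l_distr)
qed (auto intro: proj_eqI)

text \<open>Both sides lie in the image of \<open>D g\<close>, the intersection of the image of
  \<open>S\<close> with its translate, and each absorbs the other.\<close>

lemma j_unit:
  assumes g: "g \<in> carrier G"
  shows "j (unit_of g) = b g u \<otimes>\<^bsub>T\<^esub> u"
proof -
  have "j (unit_of g) \<in> b g ` j ` carrier S" using dom_eq[OF g] unit_of(1)[OF g] by blast
  then obtain s where s: "s \<in> carrier S" "j (unit_of g) = b g (j s)" by blast
  have bu: "b g u \<in> carrier T" using g by simp
  have 1: "j (unit_of g) \<otimes>\<^bsub>T\<^esub> b g u = j (unit_of g)"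
    using global.act_mult[of g "j s" u] j_u s g by simp
  have "b g u \<otimes>\<^bsub>T\<^esub> u \<in> j ` carrier S" using ideal.I_l_closed[OF j_ideal _ bu] by simp
  moreover have "b g u \<otimes>\<^bsub>T\<^esub> u \<in> b g ` j ` carrier S"
  proof -
    have "u \<otimes>\<^bsub>T\<^esub> b (inv\<^bsub>G\<^esub> g) u \<in> j ` carrier S" using ideal.I_r_closed[OF j_ideal] g by simp
    moreover have "b g (u \<otimes>\<^bsub>T\<^esub> b (inv\<^bsub>G\<^esub> g) u) = b g u \<otimes>\<^bsub>T\<^esub> u" using g by (simp add: global.act_mult)
    ultimately show ?thesis by (metis imageI)
  qed
  ultimately obtain z where z: "z \<in> D g" "b g u \<otimes>\<^bsub>T\<^esub> u = j z" using dom_eq[OF g] by blast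
  have zc: "z \<in> carrier S" using z D_carr g by blast
  have "b g u \<otimes>\<^bsub>T\<^esub> u = j (unit_of g) \<otimes>\<^bsub>T\<^esub> (b g u \<otimes>\<^bsub>T\<^esub> u)"
    using z unit_of(2)[OF g z(1)] j_mult[of "unit_of g" z] zc g by simp
  also have "\<dots> = j (unit_of g)" using 1 j_u[of "unit_of g"] g by (simp flip: T.R.m_assoc)
  finally show ?thesis ..
qed

text \<open>By \<open>j_unit\<close>, restricting \<open>s\<close> to the domain brings in
  idempotents that \<open>b g\<close> turns into \<open>u\<close> and \<open>b g u\<close>; the
  latter is absorbed by \<open>b g (j s)\<close>.\<close>

lemma j_ext_map:
  assumes g: "g \<in> carrier G" and s: "s \<in> carrier S"
  shows "j (ext_map g s) = b g (j s) \<otimes>\<^bsub>T\<^esub> u"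
proof -
  have gi: "inv\<^bsub>G\<^esub> g \<in> carrier G" using g by simp
  have "j (ext_map g s) = b g (j (s \<otimes>\<^bsub>S\<^esub> unit_of (inv\<^bsub>G\<^esub> g)))"
    unfolding ext_map_def using restrict_eq[OF g E_dom[OF g s]] by simp
  also have "\<dots> = b g (j s \<otimes>\<^bsub>T\<^esub> (b (inv\<^bsub>G\<^esub> g) u \<otimes>\<^bsub>T\<^esub> u))"
    using s gi by (simp add: j_mult j_unit)
  also have "\<dots> = b g (j s \<otimes>\<^bsub>T\<^esub> u) \<otimes>\<^bsub>T\<^esub> u"
    using s g by (simp add: global.act_mult T.R.m_ac)
  finally show ?thesis using j_u s by simp
qed

text \<open>In \<open>T\<close> the condition no longer mentions partial domains; injectivity of
  \<open>j\<close> makes the translation an equivalence.\<close>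

lemma invariants_subgroup_iff:
  assumes H: "subgroup H G"
  shows "s \<in> invariants (G\<lparr>carrier := H\<rparr>) S D a \<longleftrightarrow>
    s \<in> carrier S \<and> (\<forall>k \<in> H. b k (j s) \<otimes>\<^bsub>T\<^esub> u = j s \<otimes>\<^bsub>T\<^esub> b k u)"
proof -
  have "a k (s \<otimes>\<^bsub>S\<^esub> ideal_one S (D (inv\<^bsub>G\<lparr>carrier := H\<rparr>\<^esub> k))) = s \<otimes>\<^bsub>S\<^esub> ideal_one S (D k) \<longleftrightarrow>
      b k (j s) \<otimes>\<^bsub>T\<^esub> u = j s \<otimes>\<^bsub>T\<^esub> b k u" if s: "s \<in> carrier S" and k: "k \<in> H" for k
  proof -
    have kc: "k \<in> carrier G" using k H subgroup.mem_carrier by fast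
    have "a k (s \<otimes>\<^bsub>S\<^esub> ideal_one S (D (inv\<^bsub>G\<lparr>carrier := H\<rparr>\<^esub> k))) = ext_map k s"
      using G.m_inv_consistent[OF H k] by (simp add: ext_map_def unit_of_def)
    moreover have "ext_map k s = s \<otimes>\<^bsub>S\<^esub> unit_of k \<longleftrightarrow> j (ext_map k s) = j (s \<otimes>\<^bsub>S\<^esub> unit_of k)"
      using inj_on_eq_iff[OF j_inj] kc s by simp
    moreover have "j (s \<otimes>\<^bsub>S\<^esub> unit_of k) = j s \<otimes>\<^bsub>T\<^esub> b k u"
    proof -
      have "j (s \<otimes>\<^bsub>S\<^esub> unit_of k) = j s \<otimes>\<^bsub>T\<^esub> u \<otimes>\<^bsub>T\<^esub> b k u"
        using s kc by (simp add: j_mult j_unit T.R.m_ac)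
      thus ?thesis using j_u s by simp
    qed
    ultimately show ?thesis using j_ext_map kc s by (simp add: unit_of_def)
  qed
  thus ?thesis by (auto simp: invariants_def)
qed

lemma cover:
  fixes h :: "nat \<Rightarrow> 'g"
  shows "subgroup H G \<Longrightarrow> bij_betw h {1..m} H \<Longrightarrow> idempotent_cover G T b u H h m"
  by (intro idempotent_cover.intro idempotent_cover_axioms.intro global.global_action_axioms)
    (simp_all add: j_u)

text \<open>\<open>psi\<close> supplies a fixed preimage of an invariant element. Conversely, for a
  fixed \<open>t\<close> the two sides of the invariance condition for \<open>proj t\<close> are the
  same product of \<open>t\<close>, \<open>u\<close> and \<open>b k u\<close>.\<close>

lemma invariants_eq_proj:
  fixes h :: "nat \<Rightarrow> 'g"
  assumes H: "subgroup H G" and h: "bij_betw h {1..m} H"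
  shows "invariants (G\<lparr>carrier := H\<rparr>) S D a = proj ` global.fixed H"
proof (intro equalityI subsetI)
  interpret C: idempotent_cover G T b u H h m by (rule cover[OF H h])
  fix s assume "s \<in> invariants (G\<lparr>carrier := H\<rparr>) S D a"
  hence s: "s \<in> carrier S" "\<And>k. k \<in> H \<Longrightarrow> b k (j s) \<otimes>\<^bsub>T\<^esub> u = j s \<otimes>\<^bsub>T\<^esub> b k u"
    using invariants_subgroup_iff[OF H] by auto
  note psi = C.psi_u[OF j_closed j_u] C.psi_fixed[OF j_closed j_u]
  have "proj (psi T b u h m (j s)) = s"
    using s psi(1) by (intro proj_eqI) auto
  thus "s \<in> proj ` global.fixed H" using psi(2) s by (metis imageI)
next
  interpret C: idempotent_cover G T b u H h m by (rule cover[OF H h])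
  fix s assume "s \<in> proj ` global.fixed H"
  then obtain t where t: "t \<in> global.fixed H" "s = proj t" by blast
  have tc: "t \<in> carrier T" using t global.fixed_closed by blast
  have "b k (j s) \<otimes>\<^bsub>T\<^esub> u = j s \<otimes>\<^bsub>T\<^esub> b k u" if k: "k \<in> H" for k
    using C.H_closed[OF k] tc t global.fixed_act[OF t(1) k]
    by (simp add: j_proj global.act_mult T.R.m_ac)
  thus "s \<in> invariants (G\<lparr>carrier := H\<rparr>) S D a"
    using invariants_subgroup_iff[OF H] j_proj tc t by simp
qed

text \<open>\<open>e\<close> absorbs every translate of an element of \<open>S\<close>, and 1 is a
  sum of such translates.\<close>

lemma cover_carrier_e:
  fixes h :: "nat \<Rightarrow> 'g"
  assumes h: "bij_betw h {1..m} (carrier G)"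
  shows "idempotent_cover.e T b u h m = \<one>\<^bsub>T\<^esub>"
proof -
  interpret C: idempotent_cover G T b u "carrier G" h m by (rule cover[OF G.subgroup_self h])
  have gen: "b g (j s) \<otimes>\<^bsub>T\<^esub> C.e = b g (j s)" if "g \<in> carrier G" "s \<in> carrier S" for g s
  proof -
    have "b g (j s) = b g (j s) \<otimes>\<^bsub>T\<^esub> b g u"
      using global.act_mult[of g "j s" u] that j_u by simp
    thus ?thesis using C.bu_e[OF that(1)] that by (metis C.e_closed C.u_closed T.R.m_assoc global.act_closed j_closed)
  qed
  obtain A c where A: "finite A" "A \<subseteq> carrier G" "c \<in> A \<rightarrow> carrier S"
    and one: "\<one>\<^bsub>T\<^esub> = (\<Oplus>\<^bsub>T\<^esub>g\<in>A. b g (j (c g)))"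
    using span[of "\<one>\<^bsub>T\<^esub>"] by auto
  have bc: "b g (j (c g)) \<in> carrier T" if "g \<in> A" for g
    using that A(2) Pi_mem[OF A(3) that] by auto
  have "C.e = (\<Oplus>\<^bsub>T\<^esub>g\<in>A. b g (j (c g))) \<otimes>\<^bsub>T\<^esub> C.e"
    unfolding one[symmetric] by simp
  also have "\<dots> = (\<Oplus>\<^bsub>T\<^esub>g\<in>A. b g (j (c g)) \<otimes>\<^bsub>T\<^esub> C.e)"
    by (rule T.R.finsum_ldistr) (use A bc in auto)
  also have "\<dots> = (\<Oplus>\<^bsub>T\<^esub>g\<in>A. b g (j (c g)))"
    by (rule T.R.finsum_cong') (use A bc gen[OF subsetD[OF A(2)] Pi_mem[OF A(3)]] in auto)
  finally show ?thesis using one by simp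
qed

end

section \<open>The induced partial action and its Galois property\<close>

theorem theorem3p1:
  fixes G :: "('g, 'c) monoid_scheme" and S :: "('s, 'd) ring_scheme"
    and D :: "'g \<Rightarrow> 's set" and a :: "'g \<Rightarrow> 's \<Rightarrow> 's"
    and T :: "('t, 'e) ring_scheme" and b :: "'g \<Rightarrow> 't \<Rightarrow> 't" and j :: "'s \<Rightarrow> 't"
    and H :: "'g set" and h :: "nat \<Rightarrow> 'g" and m :: nat
  assumes "finite (carrier G)"
    and "unital_partial_action G S D a"
    and "partial_galois_extension G S D a (invariants G S D a)"
    and "globalization G S D a T b j"
    and "H \<lhd> G"
    and "bij_betw h {1..m} H" and "h 1 = \<one>\<^bsub>G\<^esub>"
  shows
    "(\<forall>g \<in> carrier G.
        quotient_dom G S D a T b j H h m (g <#\<^bsub>G\<^esub> H) = induced_dom G S D a T b j H h m g \<and>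
        (\<forall>x \<in> induced_dom G S D a T b j H h m (inv\<^bsub>G\<^esub> g).
           quotient_map S T b j h m (g <#\<^bsub>G\<^esub> H) x = induced_map S T b j h m g x)) \<and>
     unital_partial_action (G Mod H) (S\<lparr>carrier := invariants (G\<lparr>carrier := H\<rparr>) S D a\<rparr>)
       (quotient_dom G S D a T b j H h m) (quotient_map S T b j h m) \<and>
     partial_galois_extension (G Mod H) (S\<lparr>carrier := invariants (G\<lparr>carrier := H\<rparr>) S D a\<rparr>)
       (quotient_dom G S D a T b j H h m) (quotient_map S T b j h m) (invariants G S D a)"
proof -
  interpret globalization G S D a T b j by fact
  note nH = assms(5) and H = normal_imp_subgroup[OF assms(5)]
  interpret H: subgroup H G by (rule H)
  have finH: "finite H" using finite_subset[OF H.subset assms(1)] .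
  let ?E = "invariants (G\<lparr>carrier := H\<rparr>) S D a" and ?F = "global.fixed H"
  interpret C: idempotent_cover G T b u H h m by (rule cover[OF H assms(6)])
  \<comment> \<open>The whole group gets its own enumeration, to describe the invariants of
    \<open>G\<close> and to lift the Galois system to \<open>T\<close>.\<close>
  obtain h' where h': "bij_betw h' {1..card (carrier G)} (carrier G)"
    using ex_bij_betw_nat_finite_1[OF assms(1)] by blast
  interpret CG: idempotent_cover G T b u "carrier G" h' "card (carrier G)"
    by (rule cover[OF G.subgroup_self h'])
  have E: "?E = proj ` ?F" by (rule invariants_eq_proj[OF H assms(6)])
  have EG: "invariants G S D a = proj ` global.fixed (carrier G)"
    using invariants_eq_proj[OF G.subgroup_self h'] by simp
  have E_S: "s \<in> carrier S" if "s \<in> ?E" for s using that by (simp add: invariants_def)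

  interpret proj: ring_hom_ring T S proj
    by (rule ring_hom_ringI2[OF T.R.ring_axioms R.ring_axioms proj_hom])
  have subE: "subring ?E S"
    unfolding E by (rule proj.img_is_subring[OF global.fixed_subring[OF H.subset]])

  \<comment> \<open>On the invariants \<open>psi\<close> is a section of \<open>proj\<close>, with
    image in the fixed ring.\<close>
  define p where "p x = psi T b u h m (j x)" for x
  have p: "p s \<in> ?F" "p s \<otimes>\<^bsub>T\<^esub> u = j s" if "s \<in> ?E" for s
    using that C.psi_fixed[of "j s"] C.psi_u[of "j s"] invariants_subgroup_iff[OF H] j_u
    by (auto simp: p_def)
  have p_proj: "p (proj t) = t \<otimes>\<^bsub>T\<^esub> C.e" if "t \<in> ?F" for t
    using C.psi_fixed_mult[OF that] j_proj[OF global.fixed_closed[OF that]] by (simp add: p_def)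
  have one_F: "\<one>\<^bsub>T\<^esub> \<in> ?F" by (simp add: global.fixed_def)
  have p_one: "p \<one>\<^bsub>S\<^esub> = C.e"
    using p_proj[OF one_F] proj.hom_one by simp

  \<comment> \<open>The quotient group acts globally on the \<open>H\<close>-fixed ring, and the
    \<open>H\<close>-invariants of \<open>S\<close> are identified with the ideal generated there by
    \<open>C.e\<close>.\<close>
  interpret Q: ideal_restriction "G Mod H" "T\<lparr>carrier := ?F\<rparr>" "\<lambda>C. b (coset_rep C)"
    "S\<lparr>carrier := ?E\<rparr>" p proj
  proof (intro ideal_restriction.intro ideal_restriction_axioms.intro)
    show "global_action (G Mod H) (T\<lparr>carrier := ?F\<rparr>) (\<lambda>C. b (coset_rep C))"
      by (rule global.quotient_action[OF nH])
    show "cring (S\<lparr>carrier := ?E\<rparr>)"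
      using R.subcring_iff[OF subringE(1)[OF subE]] R.subcringI'[OF subE] by blast
    show "proj \<in> ring_hom (T\<lparr>carrier := ?F\<rparr>) (S\<lparr>carrier := ?E\<rparr>)"
      using proj_hom E global.fixed_closed by (auto simp: ring_hom_def)
    fix s assume "s \<in> carrier (S\<lparr>carrier := ?E\<rparr>)"
    hence s: "s \<in> ?E" by simp
    show "p s \<in> carrier (T\<lparr>carrier := ?F\<rparr>)" using p s by simp
    show "proj (p s) = s"
      using p[OF s] E_S[OF s] global.fixed_closed by (intro proj_eqI) auto
  qed (use p_proj p_one in simp)

  have dom: "quotient_dom G S D a T b j H h m = Q.dom"
    by (simp add: fun_eq_iff quotient_dom_def induced_dom_def induced_one_def Q.dom_def p_def proj_def)
  have map: "quotient_map S T b j h m = Q.map"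
    by (simp add: fun_eq_iff quotient_map_def induced_map_def Q.map_def p_def proj_def)
  have one: "induced_one S T b j h m g = proj (b g C.e)" for g
    using p_one by (simp add: induced_one_def p_def proj_def)
  have E_mult: "s \<otimes>\<^bsub>S\<^esub> t \<in> ?E" if "s \<in> ?E" "t \<in> ?E" for s t
    using subringE(6)[OF subE] that by blast
  note rep = global.act_coset_rep_eq[OF nH] and act_fixed = global.fixed_act_closed[OF nH]

  have "quotient_dom G S D a T b j H h m (g <#\<^bsub>G\<^esub> H) = induced_dom G S D a T b j H h m g"
    if g: "g \<in> carrier G" for g
    using rep[OF g C.e_fixed] by (simp add: quotient_dom_def induced_dom_def one)
  moreover have "quotient_map S T b j h m (g <#\<^bsub>G\<^esub> H) x = induced_map S T b j h m g x"
    if g: "g \<in> carrier G" and x: "x \<in> induced_dom G S D a T b j H h m (inv\<^bsub>G\<^esub> g)" for g x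
  proof -
    \<comment> \<open>\<open>x\<close> must first be seen to be \<open>H\<close>-invariant: then
      \<open>p x\<close> is \<open>H\<close>-fixed and the choice of representative is
      immaterial.\<close>
    have "proj (b (inv\<^bsub>G\<^esub> g) C.e) \<in> ?E" using act_fixed[OF _ C.e_fixed] g E by simp
    hence "x \<in> ?E" using x E_mult by (auto simp: induced_dom_def one)
    from rep[OF g p(1)[OF this]] show ?thesis
      by (simp add: quotient_map_def induced_map_def p_def)
  qed
  moreover have "unital_partial_action (G Mod H) (S\<lparr>carrier := ?E\<rparr>)
      (quotient_dom G S D a T b j H h m) (quotient_map S T b j h m)"
    unfolding dom map by (rule Q.unital_partial_action)
  moreover have "partial_galois_extension (G Mod H) (S\<lparr>carrier := ?E\<rparr>)
      (quotient_dom G S D a T b j H h m) (quotient_map S T b j h m) (invariants G S D a)"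
  proof -
    \<comment> \<open>The right-hand side is the invariance condition of the quotient action, as in
      \<open>Q.restricted_invariants\<close>.\<close>
    have "s \<in> invariants G S D a \<longleftrightarrow> s \<in> ?E \<and>
        (\<forall>C \<in> carrier (G Mod H). proj (b (coset_rep C) (p s)) = s \<otimes>\<^bsub>S\<^esub> proj (b (coset_rep C) C.e))" for s
    proof
      assume "s \<in> invariants G S D a"
      then obtain z where z: "z \<in> global.fixed (carrier G)" "s = proj z" using EG by blast
      have zF: "z \<in> ?F" using z H.subset by (auto simp: global.fixed_def)
      have zc: "z \<in> carrier T" using z global.fixed_closed by blast
      \<comment> \<open>For a \<open>G\<close>-fixed \<open>z\<close>, \<open>p s\<close> is
        \<open>z\<close> times \<open>C.e\<close>, and \<open>b g\<close> moves only the second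
        factor.\<close>
      have "proj (b g (p s)) = s \<otimes>\<^bsub>S\<^esub> proj (b g C.e)" if g: "g \<in> carrier G" for g
        using p_proj[OF zF] z(2) global.fixed_act[OF z(1) g] zc g
        by (simp add: global.act_mult)
      thus "s \<in> ?E \<and>
          (\<forall>C \<in> carrier (G Mod H). proj (b (coset_rep C) (p s)) = s \<otimes>\<^bsub>S\<^esub> proj (b (coset_rep C) C.e))"
        using z zF E global.coset_repE[OF nH] by (metis imageI)
    next
      assume s: "s \<in> ?E \<and>
        (\<forall>C \<in> carrier (G Mod H). proj (b (coset_rep C) (p s)) = s \<otimes>\<^bsub>S\<^esub> proj (b (coset_rep C) C.e))"
      have sS: "s \<in> carrier S" using s E_S by blast
      have pc: "p s \<in> carrier T" using p s global.fixed_closed by blast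
      have "b g (j s) \<otimes>\<^bsub>T\<^esub> u = j s \<otimes>\<^bsub>T\<^esub> b g u" if g: "g \<in> carrier G" for g
      proof -
        have "proj (b g (p s)) = s \<otimes>\<^bsub>S\<^esub> proj (b g C.e)"
          using s rep[OF g] p(1) C.e_fixed global.coset_carrier[OF nH g] by metis
        hence "j (proj (b g (p s))) = j (s \<otimes>\<^bsub>S\<^esub> proj (b g C.e))" by simp
        hence "b g (p s) \<otimes>\<^bsub>T\<^esub> u = j s \<otimes>\<^bsub>T\<^esub> (b g C.e \<otimes>\<^bsub>T\<^esub> u)"
          using g pc sS by (simp add: j_proj j_mult)
        \<comment> \<open>Multiplying by \<open>b g u\<close> cuts \<open>p s\<close> down to
          \<open>j s\<close> and \<open>C.e\<close> down to \<open>u\<close> under the action of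
          \<open>g\<close>.\<close>
        hence "b g (p s) \<otimes>\<^bsub>T\<^esub> u \<otimes>\<^bsub>T\<^esub> b g u = j s \<otimes>\<^bsub>T\<^esub> (b g C.e \<otimes>\<^bsub>T\<^esub> u) \<otimes>\<^bsub>T\<^esub> b g u" by simp
        hence "b g (p s) \<otimes>\<^bsub>T\<^esub> b g u \<otimes>\<^bsub>T\<^esub> u = j s \<otimes>\<^bsub>T\<^esub> u \<otimes>\<^bsub>T\<^esub> (b g C.e \<otimes>\<^bsub>T\<^esub> b g u)"
          using g pc sS by (simp add: T.R.m_ac)
        hence "b g (p s \<otimes>\<^bsub>T\<^esub> u) \<otimes>\<^bsub>T\<^esub> u = j s \<otimes>\<^bsub>T\<^esub> u \<otimes>\<^bsub>T\<^esub> b g (C.e \<otimes>\<^bsub>T\<^esub> u)"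
          using g pc by (simp add: global.act_mult)
        moreover have "C.e \<otimes>\<^bsub>T\<^esub> u = u"
          using C.e_bu[OF H.one_closed] by (simp add: global.act_one)
        ultimately show ?thesis using p(2) s j_u[OF sS] by simp
      qed
      thus "s \<in> invariants G S D a"
        using invariants_subgroup_iff[OF G.subgroup_self] sS by simp
    qed
    hence inv: "invariants G S D a = invariants (G Mod H) (S\<lparr>carrier := ?E\<rparr>) Q.dom Q.map"
      unfolding Q.restricted_invariants by (auto simp: p_one)

    obtain n x y where x: "x \<in> {1..n::nat} \<rightarrow> carrier S" and y: "y \<in> {1..n} \<rightarrow> carrier S"
      and gal: "\<And>g. g \<in> carrier G \<Longrightarrow>
        (\<Oplus>\<^bsub>S\<^esub>i\<in>{1..n}. x i \<otimes>\<^bsub>S\<^esub> ext_map g (y i)) = (if g = \<one>\<^bsub>G\<^esub> then \<one>\<^bsub>S\<^esub> else \<zero>\<^bsub>S\<^esub>)"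
      using assms(3) unfolding partial_galois_extension_def ext_map_def unit_of_def by blast
    have xy: "x i \<in> carrier S" "y i \<in> carrier S" if "i \<in> {1..n}" for i
      using Pi_mem[OF x that] Pi_mem[OF y that] by auto
    \<comment> \<open>Read in \<open>T\<close>, the partial Galois sums use the global action and
      have \<open>u\<close> in place of 1, as \<open>galois_system_lift\<close> requires.\<close>
    have "(\<Oplus>\<^bsub>T\<^esub>i\<in>{1..n}. j (x i) \<otimes>\<^bsub>T\<^esub> b g (j (y i))) = (if g = \<one>\<^bsub>G\<^esub> then u else \<zero>\<^bsub>T\<^esub>)"
      if g: "g \<in> carrier G" for g
    proof -
      have "(\<Oplus>\<^bsub>T\<^esub>i\<in>{1..n}. j (x i) \<otimes>\<^bsub>T\<^esub> b g (j (y i))) = (\<Oplus>\<^bsub>T\<^esub>i\<in>{1..n}. j (x i \<otimes>\<^bsub>S\<^esub> ext_map g (y i)))"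
      proof (rule T.R.finsum_cong')
        fix i assume "i \<in> {1..n}"
        note i = xy[OF this]
        have "j (x i \<otimes>\<^bsub>S\<^esub> ext_map g (y i)) = j (x i) \<otimes>\<^bsub>T\<^esub> u \<otimes>\<^bsub>T\<^esub> b g (j (y i))"
          using i g by (simp add: j_mult j_ext_map T.R.m_ac)
        thus "j (x i) \<otimes>\<^bsub>T\<^esub> b g (j (y i)) = j (x i \<otimes>\<^bsub>S\<^esub> ext_map g (y i))" using i j_u by simp
      qed (use xy g in auto)
      also have "\<dots> = j (\<Oplus>\<^bsub>S\<^esub>i\<in>{1..n}. x i \<otimes>\<^bsub>S\<^esub> ext_map g (y i))"
        by (rule j_finsum[symmetric]) (use xy g in auto)
      finally show ?thesis using gal[OF g] j_zero by simp
    qed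
    hence "\<exists>(I :: (nat \<times> nat) set) X Y. global.galois_system (carrier G) I X Y"
      using CG.galois_system_lift[of "{1..n}" "\<lambda>i. j (x i)" "\<lambda>i. j (y i)"] cover_carrier_e[OF h'] xy
      by simp blast
    then obtain I :: "(nat \<times> nat) set" and X Y where sys: "global.galois_system (carrier G) I X Y"
      by blast
    hence I: "finite I" by (simp add: global.galois_system_def)
    \<comment> \<open>Traces over \<open>H\<close> give a system of fixed elements; it is one for
      the quotient group, and its projection to the \<open>H\<close>-invariants of \<open>S\<close>
      is the required system.\<close>
    obtain X' Y' where "X' \<in> I \<rightarrow> ?F" "Y' \<in> I \<rightarrow> ?F" "\<And>g. g \<in> carrier G \<Longrightarrow>
        (\<Oplus>\<^bsub>T\<^esub>i\<in>I. X' i \<otimes>\<^bsub>T\<^esub> b g (Y' i)) = (if g \<in> H then \<one>\<^bsub>T\<^esub> else \<zero>\<^bsub>T\<^esub>)"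
      using global.galois_system_fixed[OF H finH sys] by blast
    from Q.restricted_galois[OF inv global.quotient_galois_system[OF nH I this]]
    show ?thesis unfolding dom map .
  qed
  ultimately show ?thesis by blast
qed

end
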